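(* Let $\Omega\Subset\mathbb{C}^{n}$, $n\geq 1$, be a bounded domain with smooth ($\mathcal{C}^{\infty}$) boundary, and let $B$ be its Bergman projection. Suppose that for a given pair $(k_{1},k_{2})\in\mathbb{N}_{0}^{2}$ there exists a constant $C>0$ such that $$\|Bf\|_{k_{2}}\leq C\|f\|_{k_{1}}\qquad\text{for all } f\in H^{k_{1}}(\Omega).$$ Let $k\in\mathbb{N}$ and $g\in\mathcal{C}^{\infty}(\overline{\Omega})$ be given. Then there exists a constant $\widetilde{C}>0$ such that $$\|B(\mu g)\|_{k_{2}}\leq\widetilde{C}\,\|\mu\|_{-k}\qquad\text{for all }\mu\in\overline{A^{0}(\Omega)}.$$
   Context: $\mathbb{N}=\{1,2,\dots\}$, $\mathbb{N}_0=\mathbb{N}\cup\{0\}$. $\mathcal{O}(\Omega)$ is the space of holomorphic functions on $\Omega$; $\mathcal{C}^{\infty}(\overline{\Omega})$ is the space of (complex-valued) functions smooth up to the boundary of $\Omega$. $L^2(\Omega)$ is taken with respect to Euclidean volume $dV$, with inner product $(f,g)=\int_\Omega f\overline{g}\,dV$. The Bergman projection $B:L^{2}(\Omega)\to L^{2}(\Omega)\cap\mathcal{O}(\Omega)$ is the orthogonal projection of $L^2(\Omega)$ onto its closed subspace of holomorphic functions. For $\ell\in\mathbb{N}_0$, $H^{\ell}(\Omega)$ is the $L^2$-Sobolev space of functions $f\in L^2(\Omega)$ whose distributional derivatives $D^\alpha f$ (in the $2n$ real coordinates) lie in $L^2(\Omega)$ for all $|\alpha|\le \ell$, with norm $\|f\|_\ell^2=\sum_{|\alpha|\le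 \ell}\|D^\alpha f\|_{L^2(\Omega)}^2$; $H^0(\Omega)=L^2(\Omega)$. An inequality $\|F\|_{\ell}\le M$ with $M<\infty$ includes the assertion $F\in H^\ell(\Omega)$. For $k\in\mathbb{N}$, $H^k_0(\Omega)$ is the closure of $\mathcal{C}^\infty_c(\Omega)$ in $H^k(\Omega)$, and $H^{-k}(\Omega)$ is the dual space of $H^k_0(\Omega)$ with the operator norm $\|f\|_{-k}=\sup\{|(f,g)|: g\in H^k_0(\Omega),\ \|g\|_k\le 1\}$, where $L^2(\Omega)\subset H^{-k}(\Omega)$ via the $L^2$ pairing. $A^{0}(\Omega)=L^{2}(\Omega)\cap\mathcal{O}(\Omega)$, and $\overline{A^{0}(\Omega)}$ is the space of functions whose complex conjugates belong to $A^{0}(\Omega)$ (the bar denotes complex conjugation, not closure). *)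

theory Defs
  imports "HOL-Analysis.Analysis" "HOL-Library.Multiset"
begin

section \<open>Smooth functions and smoothly bounded domains\<close>

text \<open>\<open>iter_deriv [v\<^sub>1, \<dots>, v\<^sub>m] f\<close> is the iterated directional derivative
  \<open>\<partial>\<^sub>v\<^sub>1 \<dots> \<partial>\<^sub>v\<^sub>m f\<close>. It is meaningful only where all derivatives involved exist.\<close>

primrec iter_deriv ::
    "'a::euclidean_space list \<Rightarrow> ('a \<Rightarrow> 'b::real_normed_vector) \<Rightarrow> 'a \<Rightarrow> 'b" where
  "iter_deriv [] f = f"
| "iter_deriv (v # vs) f = (\<lambda>x. frechet_derivative (iter_deriv vs f) (at x) v)"

text \<open>For open \<open>S\<close> this is \<open>C\<^sup>\<infinity>(S)\<close>; continuity of all the derivatives is implied by their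
  differentiability.\<close>

definition smooth_on :: "'a::euclidean_space set \<Rightarrow> ('a \<Rightarrow> 'b::real_normed_vector) \<Rightarrow> bool" where
  "smooth_on S f \<longleftrightarrow> (\<forall>vs. \<forall>x\<in>S. iter_deriv vs f differentiable (at x))"

text \<open>Smoothness up to the boundary: \<open>f\<close> is smooth in \<open>S\<close> and each derivative extends
  continuously to the closure. Only the values of \<open>f\<close> on \<open>S\<close> matter.\<close>

definition smooth_up_to_boundary ::
    "'a::euclidean_space set \<Rightarrow> ('a \<Rightarrow> 'b::real_normed_vector) \<Rightarrow> bool" where
  "smooth_up_to_boundary S f \<longleftrightarrow>
     smooth_on S f \<and>
     (\<forall>vs. \<exists>h. continuous_on (closure S) h \<and> (\<forall>x\<in>S. h x = iter_deriv vs f x))"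

definition smooth_boundary :: "'a::euclidean_space set \<Rightarrow> bool" where
  "smooth_boundary S \<longleftrightarrow>
     (\<forall>p\<in>frontier S. \<exists>U (r :: 'a \<Rightarrow> real).
        open U \<and> p \<in> U \<and> smooth_on U r \<and>
        (\<forall>x\<in>U. frechet_derivative r (at x) \<noteq> (\<lambda>v. 0)) \<and>
        S \<inter> U = {x\<in>U. r x < 0})"

definition bounded_smooth_domain :: "'a::euclidean_space set \<Rightarrow> bool" where
  "bounded_smooth_domain S \<longleftrightarrow>
     open S \<and> connected S \<and> S \<noteq> {} \<and> bounded S \<and> smooth_boundary S"


section \<open>The spaces \<open>L\<^sup>2\<close>, \<open>H\<^sup>k\<close> and \<open>H\<^sup>k\<^sub>0\<close>, and the norm of \<open>H\<^sup>-\<^sup>k\<close>\<close>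

text \<open>Elements of these spaces are represented by functions on the whole type, not by equivalence
  classes; values outside \<open>S\<close> are irrelevant.\<close>

definition L2 :: "'a::euclidean_space set \<Rightarrow> ('a \<Rightarrow> complex) set" where
  "L2 S = {f \<in> borel_measurable (lebesgue_on S). integrable (lebesgue_on S) (\<lambda>x. (cmod (f x))\<^sup>2)}"

definition l2_inner ::
    "'a::euclidean_space set \<Rightarrow> ('a \<Rightarrow> complex) \<Rightarrow> ('a \<Rightarrow> complex) \<Rightarrow> complex" where
  "l2_inner S f g = (LINT x|lebesgue_on S. f x * cnj (g x))"

text \<open>A multi-index \<open>\<alpha>\<close> is a multiset of basis vectors, \<open>count \<alpha> b\<close> being the order of
  differentiation in the direction \<open>b\<close>; thus \<open>\<bar>\<alpha>\<bar> = size \<alpha>\<close>.\<close>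

definition multi_indices :: "nat \<Rightarrow> 'a::euclidean_space multiset set" where
  "multi_indices l = {\<alpha>. set_mset \<alpha> \<subseteq> Basis \<and> size \<alpha> \<le> l}"

lemma finite_multi_indices: "finite (multi_indices l :: 'a::euclidean_space multiset set)"
proof -
  have "multi_indices l = (\<Union>m\<le>l. multisets_of_size (Basis :: 'a set) m)"
    by (auto simp: multi_indices_def multisets_of_size_def)
  then show ?thesis
    by (simp add: finite_multisets_of_size)
qed

text \<open>The order in which the derivatives are taken is immaterial for smooth functions, to which
  alone this is applied.\<close>

definition partial_deriv ::
    "'a::euclidean_space multiset \<Rightarrow> ('a \<Rightarrow> complex) \<Rightarrow> 'a \<Rightarrow> complex" where
  "partial_deriv \<alpha> \<phi> = iter_deriv (SOME vs. mset vs = \<alpha>) \<phi>"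

definition test_functions :: "'a::euclidean_space set \<Rightarrow> ('a \<Rightarrow> complex) set" where
  "test_functions S =
     {\<phi>. smooth_on UNIV \<phi> \<and> compact (closure {x. \<phi> x \<noteq> 0}) \<and> closure {x. \<phi> x \<noteq> 0} \<subseteq> S}"

text \<open>\<open>h\<close> is the distributional derivative \<open>D\<^sup>\<alpha> f\<close> on \<open>S\<close>, and lies in \<open>L\<^sup>2(S)\<close>.\<close>

definition has_L2_weak_deriv ::
    "'a::euclidean_space set \<Rightarrow> 'a multiset \<Rightarrow> ('a \<Rightarrow> complex) \<Rightarrow> ('a \<Rightarrow> complex) \<Rightarrow> bool" where
  "has_L2_weak_deriv S \<alpha> f h \<longleftrightarrow>
     h \<in> L2 S \<and>
     (\<forall>\<phi>\<in>test_functions S.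
        (LINT x|lebesgue_on S. f x * partial_deriv \<alpha> \<phi> x) =
        (- 1) ^ size \<alpha> * (LINT x|lebesgue_on S. h x * \<phi> x))"

text \<open>Weak derivatives are unique almost everywhere, so the choice does not affect the norm below.\<close>

definition weak_deriv ::
    "'a::euclidean_space set \<Rightarrow> 'a multiset \<Rightarrow> ('a \<Rightarrow> complex) \<Rightarrow> 'a \<Rightarrow> complex" where
  "weak_deriv S \<alpha> f = (SOME h. has_L2_weak_deriv S \<alpha> f h)"

definition sobolev :: "nat \<Rightarrow> 'a::euclidean_space set \<Rightarrow> ('a \<Rightarrow> complex) set" where
  "sobolev l S = {f \<in> L2 S. \<forall>\<alpha>\<in>multi_indices l. \<exists>h. has_L2_weak_deriv S \<alpha> f h}"

text \<open>Meaningful only for members of \<open>sobolev l S\<close>.\<close>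

definition sobolev_norm ::
    "nat \<Rightarrow> 'a::euclidean_space set \<Rightarrow> ('a \<Rightarrow> complex) \<Rightarrow> real" where
  "sobolev_norm l S f =
     sqrt (\<Sum>\<alpha>\<in>multi_indices l. LINT x|lebesgue_on S. (cmod (weak_deriv S \<alpha> f x))\<^sup>2)"

definition sobolev0 :: "nat \<Rightarrow> 'a::euclidean_space set \<Rightarrow> ('a \<Rightarrow> complex) set" where
  "sobolev0 k S =
     {g \<in> sobolev k S. \<forall>\<epsilon>>0. \<exists>\<phi>\<in>test_functions S. sobolev_norm k S (\<lambda>x. g x - \<phi> x) < \<epsilon>}"

text \<open>The norm in \<open>H\<^sup>-\<^sup>k(S)\<close> of (the functional induced by) \<open>f \<in> L\<^sup>2(S)\<close>. For such \<open>f\<close>, the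
  supremum is over a nonempty set bounded above by the \<open>L\<^sup>2\<close> norm of \<open>f\<close>.\<close>

definition neg_sobolev_norm ::
    "nat \<Rightarrow> 'a::euclidean_space set \<Rightarrow> ('a \<Rightarrow> complex) \<Rightarrow> real" where
  "neg_sobolev_norm k S f =
     (SUP g\<in>{g \<in> sobolev0 k S. sobolev_norm k S g \<le> 1}. cmod (l2_inner S f g))"


section \<open>The Bergman projection\<close>

text \<open>\<open>*s\<close> is multiplication of vectors by complex scalars.\<close>

definition holomorphic_on_Cn :: "(complex ^ 'n \<Rightarrow> complex) \<Rightarrow> (complex ^ 'n) set \<Rightarrow> bool" where
  "holomorphic_on_Cn f S \<longleftrightarrow>
     (\<forall>z\<in>S. \<exists>D. (f has_derivative D) (at z) \<and> (\<forall>c v. D (c *s v) = c * D v))"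

definition bergman_space :: "(complex ^ 'n) set \<Rightarrow> (complex ^ 'n \<Rightarrow> complex) set" where
  "bergman_space S = {f \<in> L2 S. holomorphic_on_Cn f S}"

definition conj_bergman_space :: "(complex ^ 'n) set \<Rightarrow> (complex ^ 'n \<Rightarrow> complex) set" where
  "conj_bergman_space S = {f. (\<lambda>z. cnj (f z)) \<in> bergman_space S}"

text \<open>The holomorphic representative of the orthogonal projection of \<open>f \<in> L\<^sup>2(S)\<close> to
  the Bergman space; the normalisation outside \<open>S\<close> makes it a unique function on the whole type.\<close>

definition bergman_proj ::
    "(complex ^ 'n) set \<Rightarrow> (complex ^ 'n \<Rightarrow> complex) \<Rightarrow> complex ^ 'n \<Rightarrow> complex" where
  "bergman_proj S f =
     (THE h. h \<in> bergman_space S \<and> (\<forall>z. z \<notin> S \<longrightarrow> h z = 0) \<and>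
             (\<forall>u\<in>bergman_space S. l2_inner S (\<lambda>z. f z - h z) u = 0))"

end

theory Submission
  imports Defs "HOL-Complex_Analysis.Complex_Analysis"
begin

text \<open>Near a boundary point let \<open>r\<close> be a local defining function and \<open>T\<close> a \<open>(1,0)\<close>-derivative with
  \<open>T r \<noteq> 0\<close>. Since \<open>T\<close> annihilates \<open>\<mu>\<close> and the conjugates of Bergman functions, \<open>T (r\<^bsup>m+1\<^esup> \<mu> G)\<close> is
  orthogonal to the Bergman space for \<open>G\<close> supported near that point, so that modulo this orthogonal
  complement \<open>r\<^bsup>m\<^esup> \<mu> H\<close> equals \<open>- r\<^bsup>m+1\<^esup> \<mu> T (H / ((m + 1) T r))\<close>. Thus \<open>\<mu> g\<close> can be replaced by
  \<open>r\<^bsup>N\<^esup> \<mu> g\<^sub>N\<close> with \<open>N\<close> arbitrarily large. Testing \<open>\<mu>\<close> against radial bumps bounds its derivatives by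
  a power of the boundary distance times the norm of \<open>\<mu>\<close> in \<open>H\<^sup>-\<^sup>k\<close>, so the replacement lies in
  \<open>H\<^bsup>k1\<^esup>\<close> with norm controlled by that norm, and the hypothesis on the Bergman projection applies to it.\<close>

section \<open>Calculus of smooth functions\<close>

text \<open>The obstacle is that \<open>\<mu>\<close> has no boundary values under control and that
  its derivatives may blow up at the boundary. At distance \<open>d\<close> from the boundary it can
  be tested only on balls of radius comparable to \<open>d\<close>: the mass of the bump costs
  \<open>d\<close> to the power of the real dimension, and each of the up to \<open>k\<close>
  derivatives of the dual norm and up to \<open>k1\<close> derivatives of the target costs another
  factor \<open>d\<close>. The sum of these three numbers is the exponent that suffices. Powers can
  be gained because pairing \<open>\<mu> g\<close> with \<open>u\<close> integrates \<open>g\<close>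
  against the single function \<open>w = \<mu> * cnj u\<close>, which is integrable and annihilated
  by \<open>T\<close>. The coefficient produced by a step does not depend on \<open>w\<close>, so
  one choice serves all \<open>\<mu>\<close> and \<open>u\<close>. Since \<open>w\<close> is merely
  integrable, boundary terms are excluded by cut-offs, and the factor \<open>r\<close> inside each
  total derivative offsets their derivatives, which are of size \<open>1 / |r|\<close>. Bergman
  functions enter as complex differentiable functions; their smoothness comes from the mean value
  property.\<close>

definition dir_deriv :: "'a::euclidean_space \<Rightarrow> ('a \<Rightarrow> 'b::real_normed_vector) \<Rightarrow> 'a \<Rightarrow> 'b" where
  "dir_deriv v f = (\<lambda>x. frechet_derivative f (at x) v)"

lemma iter_deriv_Cons: "iter_deriv (v # vs) f = dir_deriv v (iter_deriv vs f)"
  by (simp add: dir_deriv_def)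

lemma iter_deriv_append: "iter_deriv (us @ vs) f = iter_deriv us (iter_deriv vs f)"
  by (induction us) auto

text \<open>\<open>iter_deriv\<close> adds a direction on the outside. Splitting off the innermost
  one instead suits inductions that differentiate a product or a composite before the induction
  hypothesis is applied.\<close>

lemma iter_deriv_snoc: "iter_deriv (vs @ [v]) f = iter_deriv vs (dir_deriv v f)"
  by (simp add: iter_deriv_append iter_deriv_Cons del: iter_deriv.simps(2))

lemma dir_deriv_eq: "(f has_derivative f') (at x) \<Longrightarrow> dir_deriv v f x = f' v"
  unfolding dir_deriv_def by (metis frechet_derivative_at)

lemma differentiable_has_dir_deriv:
  "f differentiable (at x) \<Longrightarrow> (f has_derivative (\<lambda>v. dir_deriv v f x)) (at x)"
  unfolding dir_deriv_def by (simp add: frechet_derivative_works)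

lemma dir_deriv_cong_open:
  assumes "open S" "\<And>x. x \<in> S \<Longrightarrow> f x = g x" "x \<in> S"
  shows "dir_deriv v f x = dir_deriv v g x"
proof -
  have "(f has_derivative D) (at x) \<longleftrightarrow> (g has_derivative D) (at x)" for D
    using has_derivative_transform_within_open[of f D x UNIV S g]
      has_derivative_transform_within_open[of g D x UNIV S f] assms by auto
  then show ?thesis
    unfolding dir_deriv_def frechet_derivative_def by simp
qed

lemma differentiable_cong_open:
  assumes "open S" "\<And>x. x \<in> S \<Longrightarrow> f x = g x" "x \<in> S" "f differentiable (at x)"
  shows "g differentiable (at x)"
  using assms unfolding differentiable_def
  by (metis has_derivative_transform_within_open)

lemma iter_deriv_cong_open:
  assumes "open S" "\<And>x. x \<in> S \<Longrightarrow> f x = g x" "x \<in> S"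
  shows "iter_deriv vs f x = iter_deriv vs g x"
  using assms(3)
proof (induction vs arbitrary: x)
  case (Cons v vs)
  then show ?case
    unfolding iter_deriv_Cons using dir_deriv_cong_open[OF assms(1)] by blast
qed (use assms in auto)

text \<open>The order serves as the induction parameter for the closure properties of smooth
  functions. Derivatives of order \<open>n\<close> are still required to be differentiable, so
  \<open>smooth_upto n\<close> stands for \<open>n + 1\<close> times differentiable and level
  \<open>0\<close> for plain differentiability.\<close>

definition smooth_upto ::
    "nat \<Rightarrow> 'a::euclidean_space set \<Rightarrow> ('a \<Rightarrow> 'b::real_normed_vector) \<Rightarrow> bool" where
  "smooth_upto n S f \<longleftrightarrow>
     (\<forall>vs x. length vs \<le> n \<longrightarrow> x \<in> S \<longrightarrow> iter_deriv vs f differentiable (at x))"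

lemma smooth_upto_0: "smooth_upto 0 S f \<longleftrightarrow> (\<forall>x\<in>S. f differentiable (at x))"
  by (auto simp: smooth_upto_def)

lemma smooth_upto_Suc:
  "smooth_upto (Suc n) S f \<longleftrightarrow>
     (\<forall>x\<in>S. f differentiable (at x)) \<and> (\<forall>v. smooth_upto n S (dir_deriv v f))" (is "?l \<longleftrightarrow> ?r")
proof
  assume L: ?l
  then have "f differentiable (at x)" if "x \<in> S" for x
    using that unfolding smooth_upto_def by (metis iter_deriv.simps(1) le0 list.size(3))
  moreover have "iter_deriv vs (dir_deriv v f) differentiable (at x)"
    if "length vs \<le> n" "x \<in> S" for vs v x
    using L that unfolding smooth_upto_def by (metis Suc_le_mono iter_deriv_snoc length_append_singleton)
  ultimately show ?r
    by (auto simp: smooth_upto_def)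
next
  assume R: ?r
  have "iter_deriv vs f differentiable (at x)" if "length vs \<le> Suc n" "x \<in> S" for vs x
  proof (cases vs rule: rev_cases)
    case Nil
    then show ?thesis using R that by auto
  next
    case (snoc us v)
    then show ?thesis using R that by (auto simp: iter_deriv_snoc smooth_upto_def)
  qed
  then show ?l by (auto simp: smooth_upto_def)
qed

lemma smooth_on_iff_upto: "smooth_on S f \<longleftrightarrow> (\<forall>n. smooth_upto n S f)"
  unfolding smooth_on_def smooth_upto_def by blast

lemma smooth_upto_mono: "smooth_upto n S f \<Longrightarrow> m \<le> n \<Longrightarrow> smooth_upto m S f"
  unfolding smooth_upto_def by auto

lemma smooth_on_differentiable: "smooth_on S f \<Longrightarrow> x \<in> S \<Longrightarrow> f differentiable (at x)"
  unfolding smooth_on_def by (metis iter_deriv.simps(1))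

lemma smooth_on_iter_deriv: "smooth_on S f \<Longrightarrow> smooth_on S (iter_deriv vs f)"
  unfolding smooth_on_def by (metis iter_deriv_append)

lemma smooth_on_dir_deriv: "smooth_on S f \<Longrightarrow> smooth_on S (dir_deriv v f)"
  using smooth_on_iter_deriv[of S f "[v]"] by (simp add: dir_deriv_def)

lemma smooth_on_subset: "smooth_on S f \<Longrightarrow> T \<subseteq> S \<Longrightarrow> smooth_on T f"
  unfolding smooth_on_def by auto

lemma smooth_on_Un: "smooth_on S f \<Longrightarrow> smooth_on T f \<Longrightarrow> smooth_on (S \<union> T) f"
  unfolding smooth_on_def by auto

lemma smooth_on_continuous: "smooth_on S f \<Longrightarrow> continuous_on S f"
  by (meson continuous_at_imp_continuous_on differentiable_imp_continuous_within smooth_on_differentiable)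

lemma smooth_upto_cong:
  assumes "open S" "\<And>x. x \<in> S \<Longrightarrow> f x = g x" "smooth_upto n S f"
  shows "smooth_upto n S g"
  unfolding smooth_upto_def
proof (intro allI impI)
  fix vs :: "'a list" and x
  assume *: "length vs \<le> n" "x \<in> S"
  then have "iter_deriv vs f differentiable (at x)"
    using assms(3) by (simp add: smooth_upto_def)
  with iter_deriv_cong_open[OF assms(1,2)] *(2) show "iter_deriv vs g differentiable (at x)"
    by (rule differentiable_cong_open[OF assms(1)])
qed

lemma smooth_on_cong:
  assumes "open S" "\<And>x. x \<in> S \<Longrightarrow> f x = g x" "smooth_on S f"
  shows "smooth_on S g"
  using assms smooth_upto_cong unfolding smooth_on_iff_upto by blast

section \<open>Rules for a single directional derivative\<close>

lemma dir_deriv_add: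
  assumes "f differentiable (at x)" "g differentiable (at x)"
  shows "dir_deriv v (\<lambda>x. f x + g x) x = dir_deriv v f x + dir_deriv v g x"
  by (rule dir_deriv_eq) (intro has_derivative_add differentiable_has_dir_deriv assms)

lemma dir_deriv_mult:
  fixes f g :: "'a::euclidean_space \<Rightarrow> 'b::real_normed_algebra"
  assumes "f differentiable (at x)" "g differentiable (at x)"
  shows "dir_deriv v (\<lambda>x. f x * g x) x = f x * dir_deriv v g x + dir_deriv v f x * g x"
  by (rule dir_deriv_eq) (intro has_derivative_mult differentiable_has_dir_deriv assms)

lemma dir_deriv_bounded_linear:
  assumes "bounded_linear L" "f differentiable (at x)"
  shows "dir_deriv v (\<lambda>x. L (f x)) x = L (dir_deriv v f x)"
  by (rule dir_deriv_eq) (intro bounded_linear.has_derivative[OF assms(1)] differentiable_has_dir_deriv assms)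

lemma dir_deriv_inverse:
  fixes f :: "'a::euclidean_space \<Rightarrow> 'b::real_normed_field"
  assumes "f differentiable (at x)" "f x \<noteq> 0"
  shows "dir_deriv v (\<lambda>x. inverse (f x)) x = - (inverse (f x) * dir_deriv v f x * inverse (f x))"
  by (rule dir_deriv_eq[OF Deriv.has_derivative_inverse[OF _ differentiable_has_dir_deriv]]) (use assms in auto)

lemma dir_deriv_linear: "bounded_linear L \<Longrightarrow> dir_deriv v L = (\<lambda>x. L v)"
  by (rule ext, rule dir_deriv_eq) (simp add: bounded_linear_imp_has_derivative)

lemma dir_deriv_const [simp]: "dir_deriv v (\<lambda>x. c) = (\<lambda>x. 0)"
  by (simp add: dir_deriv_def)

lemma dir_deriv_compose_real:
  fixes f :: "'a::euclidean_space \<Rightarrow> real" and \<phi> :: "real \<Rightarrow> real"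
  assumes "f differentiable (at x)" "\<phi> differentiable (at (f x))"
  shows "dir_deriv v (\<lambda>x. \<phi> (f x)) x = dir_deriv 1 \<phi> (f x) * dir_deriv v f x"
proof -
  have "dir_deriv v (\<lambda>x. \<phi> (f x)) x = dir_deriv (dir_deriv v f x) \<phi> (f x)"
    by (rule dir_deriv_eq)
      (intro has_derivative_compose[OF differentiable_has_dir_deriv differentiable_has_dir_deriv] assms)
  also have "\<dots> = dir_deriv v f x * dir_deriv 1 \<phi> (f x)"
    using linear_cmul[OF linear_frechet_derivative[OF assms(2)], of "dir_deriv v f x" 1]
    by (simp add: dir_deriv_def)
  finally show ?thesis by simp
qed

section \<open>Closure properties of smooth functions\<close>

lemma smooth_upto_const: "smooth_upto n S (\<lambda>x. c)"
  by (induction n arbitrary: c) (auto simp: smooth_upto_0 smooth_upto_Suc)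

lemma smooth_on_const [simp]: "smooth_on S (\<lambda>x. c)"
  by (simp add: smooth_on_iff_upto smooth_upto_const)

lemma smooth_upto_add:
  assumes "open S"
  shows "smooth_upto n S f \<Longrightarrow> smooth_upto n S g \<Longrightarrow> smooth_upto n S (\<lambda>x. f x + g x)"
proof (induction n arbitrary: f g)
  case 0
  then show ?case by (auto simp: smooth_upto_0)
next
  case (Suc n)
  have "smooth_upto n S (dir_deriv v (\<lambda>x. f x + g x))" for v
  proof (rule smooth_upto_cong[OF assms])
    show "dir_deriv v f x + dir_deriv v g x = dir_deriv v (\<lambda>x. f x + g x) x" if "x \<in> S" for x
      using Suc.prems that by (simp add: smooth_upto_Suc dir_deriv_add)
    show "smooth_upto n S (\<lambda>x. dir_deriv v f x + dir_deriv v g x)"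
      using Suc.prems by (intro Suc.IH) (auto simp: smooth_upto_Suc)
  qed
  with Suc.prems show ?case by (auto simp: smooth_upto_Suc)
qed

lemma smooth_on_add:
  "open S \<Longrightarrow> smooth_on S f \<Longrightarrow> smooth_on S g \<Longrightarrow> smooth_on S (\<lambda>x. f x + g x)"
  by (simp add: smooth_on_iff_upto smooth_upto_add)

lemma smooth_upto_bounded_linear:
  assumes "open S" "bounded_linear L"
  shows "smooth_upto n S f \<Longrightarrow> smooth_upto n S (\<lambda>x. L (f x))"
proof (induction n arbitrary: f)
  case 0
  then show ?case
    using differentiable_compose[OF bounded_linear_imp_differentiable[OF assms(2)]] by (auto simp: smooth_upto_0)
next
  case (Suc n)
  have "smooth_upto n S (dir_deriv v (\<lambda>x. L (f x)))" for v
  proof (rule smooth_upto_cong[OF assms(1)])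
    show "L (dir_deriv v f x) = dir_deriv v (\<lambda>x. L (f x)) x" if "x \<in> S" for x
      using Suc.prems that by (simp add: smooth_upto_Suc dir_deriv_bounded_linear[OF assms(2)])
    show "smooth_upto n S (\<lambda>x. L (dir_deriv v f x))"
      using Suc.prems by (intro Suc.IH) (auto simp: smooth_upto_Suc)
  qed
  with Suc.prems show ?case
    using differentiable_compose[OF bounded_linear_imp_differentiable[OF assms(2)]]
    unfolding smooth_upto_Suc by blast
qed

lemma smooth_on_bounded_linear:
  "open S \<Longrightarrow> bounded_linear L \<Longrightarrow> smooth_on S f \<Longrightarrow> smooth_on S (\<lambda>x. L (f x))"
  by (simp add: smooth_on_iff_upto smooth_upto_bounded_linear)

lemma smooth_on_linear: "bounded_linear L \<Longrightarrow> smooth_on S L"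
  unfolding smooth_on_iff_upto
proof
  fix n assume L: "bounded_linear L"
  then show "smooth_upto n S L"
    by (cases n) (auto simp: smooth_upto_0 smooth_upto_Suc dir_deriv_linear smooth_upto_const
        bounded_linear_imp_differentiable)
qed

lemma smooth_upto_mult:
  fixes f g :: "'a::euclidean_space \<Rightarrow> 'b::real_normed_algebra"
  assumes "open S"
  shows "smooth_upto n S f \<Longrightarrow> smooth_upto n S g \<Longrightarrow> smooth_upto n S (\<lambda>x. f x * g x)"
proof (induction n arbitrary: f g)
  case 0
  then show ?case by (auto simp: smooth_upto_0)
next
  case (Suc n)
  have "smooth_upto n S (dir_deriv v (\<lambda>x. f x * g x))" for v
  proof (rule smooth_upto_cong[OF assms])
    show "f x * dir_deriv v g x + dir_deriv v f x * g x = dir_deriv v (\<lambda>x. f x * g x) x"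
      if "x \<in> S" for x
      using Suc.prems that by (auto simp: smooth_upto_Suc dir_deriv_mult)
    show "smooth_upto n S (\<lambda>x. f x * dir_deriv v g x + dir_deriv v f x * g x)"
      using Suc.prems smooth_upto_mono[of "Suc n" S _ n]
      by (intro smooth_upto_add[OF assms] Suc.IH) (auto simp: smooth_upto_Suc)
  qed
  with Suc.prems show ?case by (auto simp: smooth_upto_Suc)
qed

lemma smooth_on_mult:
  fixes f g :: "'a::euclidean_space \<Rightarrow> 'b::real_normed_algebra"
  shows "open S \<Longrightarrow> smooth_on S f \<Longrightarrow> smooth_on S g \<Longrightarrow> smooth_on S (\<lambda>x. f x * g x)"
  by (simp add: smooth_on_iff_upto smooth_upto_mult)

lemma smooth_on_minus: "open S \<Longrightarrow> smooth_on S f \<Longrightarrow> smooth_on S (\<lambda>x. - f x)"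
  by (rule smooth_on_bounded_linear[OF _ bounded_linear_minus[OF bounded_linear_ident]])

lemma smooth_on_diff:
  "open S \<Longrightarrow> smooth_on S f \<Longrightarrow> smooth_on S g \<Longrightarrow> smooth_on S (\<lambda>x. f x - g x)"
  using smooth_on_add[of S f "\<lambda>x. - g x"] smooth_on_minus[of S g] by simp

lemma smooth_on_power:
  fixes f :: "'a::euclidean_space \<Rightarrow> 'b::real_normed_algebra_1"
  shows "open S \<Longrightarrow> smooth_on S f \<Longrightarrow> smooth_on S (\<lambda>x. f x ^ n)"
  by (induction n) (auto intro: smooth_on_mult)

lemma smooth_on_sum:
  "open S \<Longrightarrow> (\<And>i. i \<in> I \<Longrightarrow> smooth_on S (f i)) \<Longrightarrow> smooth_on S (\<lambda>x. \<Sum>i\<in>I. f i x)"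
  by (induction I rule: infinite_finite_induct) (auto intro: smooth_on_add)

text \<open>The derivative of the inverse contains the inverse again, but it is needed there at one
  order less, so the induction closes by the product rule.\<close>

lemma smooth_upto_inverse:
  fixes f :: "'a::euclidean_space \<Rightarrow> 'b::real_normed_field"
  assumes "open S" "\<And>x. x \<in> S \<Longrightarrow> f x \<noteq> 0"
  shows "smooth_upto n S f \<Longrightarrow> smooth_upto n S (\<lambda>x. inverse (f x))"
proof (induction n)
  case 0
  then show ?case using assms by (auto simp: smooth_upto_0)
next
  case (Suc n)
  then have inv: "smooth_upto n S (\<lambda>x. inverse (f x))"
    using smooth_upto_mono[of "Suc n" S f n] by simp
  have "smooth_upto n S (dir_deriv v (\<lambda>x. inverse (f x)))" for v
  proof (rule smooth_upto_cong[OF assms(1)])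
    show "- (inverse (f x) * dir_deriv v f x * inverse (f x)) = dir_deriv v (\<lambda>x. inverse (f x)) x"
      if "x \<in> S" for x
      using Suc.prems that assms by (auto simp: smooth_upto_Suc dir_deriv_inverse)
    show "smooth_upto n S (\<lambda>x. - (inverse (f x) * dir_deriv v f x * inverse (f x)))"
      using Suc.prems inv
      by (intro smooth_upto_bounded_linear[OF assms(1) bounded_linear_minus[OF bounded_linear_ident]]
          smooth_upto_mult[OF assms(1)]) (auto simp: smooth_upto_Suc)
  qed
  with Suc.prems assms show ?case by (auto simp: smooth_upto_Suc)
qed

lemma smooth_on_inverse:
  fixes f :: "'a::euclidean_space \<Rightarrow> 'b::real_normed_field"
  shows "open S \<Longrightarrow> smooth_on S f \<Longrightarrow> (\<And>x. x \<in> S \<Longrightarrow> f x \<noteq> 0) \<Longrightarrow> smooth_on S (\<lambda>x. inverse (f x))"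
  by (simp add: smooth_on_iff_upto smooth_upto_inverse)

text \<open>The chain rule replaces \<open>\<phi>\<close> by its derivative, hence an induction over
  all \<open>\<phi>\<close>.\<close>

lemma smooth_upto_compose_real:
  fixes f :: "'a::euclidean_space \<Rightarrow> real" and \<phi> :: "real \<Rightarrow> real"
  assumes "open S"
  shows "smooth_on UNIV \<phi> \<Longrightarrow> smooth_upto n S f \<Longrightarrow> smooth_upto n S (\<lambda>x. \<phi> (f x))"
proof (induction n arbitrary: \<phi>)
  case 0
  then show ?case
    using differentiable_compose[of \<phi> f] smooth_on_differentiable[of UNIV \<phi>]
    by (auto simp: smooth_upto_0)
next
  case (Suc n)
  have diff: "\<phi> differentiable (at t)" for t
    using Suc.prems smooth_on_differentiable by blast
  have "smooth_upto n S (dir_deriv v (\<lambda>x. \<phi> (f x)))" for v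
  proof (rule smooth_upto_cong[OF assms(1)])
    show "dir_deriv 1 \<phi> (f x) * dir_deriv v f x = dir_deriv v (\<lambda>x. \<phi> (f x)) x"
      if "x \<in> S" for x
      using Suc.prems that diff by (auto simp: smooth_upto_Suc dir_deriv_compose_real)
    show "smooth_upto n S (\<lambda>x. dir_deriv 1 \<phi> (f x) * dir_deriv v f x)"
    proof (rule smooth_upto_mult[OF assms(1)])
      show "smooth_upto n S (\<lambda>x. dir_deriv 1 \<phi> (f x))"
        using Suc.prems smooth_upto_mono[of "Suc n" S f n]
        by (intro Suc.IH[OF smooth_on_dir_deriv]) auto
    qed (use Suc.prems in \<open>auto simp: smooth_upto_Suc\<close>)
  qed
  with Suc.prems diff show ?case
    using differentiable_compose[of \<phi> f] by (auto simp: smooth_upto_Suc)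
qed

lemma smooth_on_compose_real:
  fixes f :: "'a::euclidean_space \<Rightarrow> real" and \<phi> :: "real \<Rightarrow> real"
  shows "open S \<Longrightarrow> smooth_on UNIV \<phi> \<Longrightarrow> smooth_on S f \<Longrightarrow> smooth_on S (\<lambda>x. \<phi> (f x))"
  using smooth_upto_compose_real[of S \<phi> _ f] by (auto simp: smooth_on_iff_upto[of S])

section \<open>Iterated derivatives of sums and under linear and affine maps\<close>

lemma iter_deriv_add:
  assumes "open S" "smooth_on S f" "smooth_on S g" "x \<in> S"
  shows "iter_deriv vs (\<lambda>x. f x + g x) x = iter_deriv vs f x + iter_deriv vs g x"
  using assms(4)
proof (induction vs arbitrary: x)
  case (Cons v vs)
  have "dir_deriv v (iter_deriv vs (\<lambda>x. f x + g x)) x =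
      dir_deriv v (\<lambda>x. iter_deriv vs f x + iter_deriv vs g x) x"
    by (rule dir_deriv_cong_open[OF assms(1)]) (use Cons in auto)
  then show ?case
    using Cons.prems assms
    by (simp add: iter_deriv_Cons dir_deriv_add smooth_on_differentiable[of S] smooth_on_iter_deriv
        del: iter_deriv.simps(2))
qed simp

lemma iter_deriv_bounded_linear:
  assumes "open S" "bounded_linear L" "smooth_on S f" "x \<in> S"
  shows "iter_deriv vs (\<lambda>x. L (f x)) x = L (iter_deriv vs f x)"
  using assms(4)
proof (induction vs arbitrary: x)
  case (Cons v vs)
  have "dir_deriv v (iter_deriv vs (\<lambda>x. L (f x))) x = dir_deriv v (\<lambda>x. L (iter_deriv vs f x)) x"
    by (rule dir_deriv_cong_open[OF assms(1)]) (use Cons in auto)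
  then show ?case
    using Cons.prems assms
    by (simp add: iter_deriv_Cons dir_deriv_bounded_linear smooth_on_differentiable[of S]
        smooth_on_iter_deriv del: iter_deriv.simps(2))
qed simp

text \<open>Each derivative contributes one factor \<open>c\<close>. With \<open>c = 1 / e\<close>
  this is the source of the powers of the inverse radius when a bump is rescaled.\<close>

lemma iter_deriv_affine:
  fixes f :: "'a::euclidean_space \<Rightarrow> 'b::real_normed_vector"
  assumes "smooth_on UNIV f"
  shows "iter_deriv vs (\<lambda>x. f (c *\<^sub>R x + a)) = (\<lambda>x. c ^ length vs *\<^sub>R iter_deriv vs f (c *\<^sub>R x + a))"
proof (induction vs)
  case (Cons v vs)
  show ?case
  proof
    fix x
    have lin: "linear (\<lambda>v. dir_deriv v (iter_deriv vs f) y)" for y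
      using assms has_derivative_linear smooth_on_def differentiable_has_dir_deriv by blast
    have "((\<lambda>x. c *\<^sub>R x + a) has_derivative (\<lambda>v. c *\<^sub>R v)) (at x)"
      by (auto intro!: derivative_eq_intros)
    moreover have "(iter_deriv vs f has_derivative (\<lambda>v. dir_deriv v (iter_deriv vs f) (c *\<^sub>R x + a)))
        (at (c *\<^sub>R x + a))"
      using assms differentiable_has_dir_deriv unfolding smooth_on_def by blast
    ultimately have "((\<lambda>x. iter_deriv vs f (c *\<^sub>R x + a)) has_derivative
        (\<lambda>v. dir_deriv (c *\<^sub>R v) (iter_deriv vs f) (c *\<^sub>R x + a))) (at x)"
      by (rule has_derivative_compose)
    then have "((\<lambda>x. c ^ length vs *\<^sub>R iter_deriv vs f (c *\<^sub>R x + a)) has_derivative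
        (\<lambda>v. c ^ length vs *\<^sub>R dir_deriv (c *\<^sub>R v) (iter_deriv vs f) (c *\<^sub>R x + a))) (at x)"
      by (rule has_derivative_scaleR_right)
    then show "iter_deriv (v # vs) (\<lambda>x. f (c *\<^sub>R x + a)) x =
        c ^ length (v # vs) *\<^sub>R iter_deriv (v # vs) f (c *\<^sub>R x + a)"
      by (simp add: iter_deriv_Cons Cons dir_deriv_eq linear_cmul[OF lin] mult.commute
          del: iter_deriv.simps(2))
  qed
qed simp

lemma smooth_on_affine:
  fixes f :: "'a::euclidean_space \<Rightarrow> 'b::real_normed_vector"
  assumes "smooth_on UNIV f"
  shows "smooth_on UNIV (\<lambda>x. f (c *\<^sub>R x + a))"
  unfolding smooth_on_def
proof (intro allI ballI)
  fix vs x
  have "iter_deriv vs f differentiable at (c *\<^sub>R x + a)"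
    using assms unfolding smooth_on_def by blast
  then have "(\<lambda>x. iter_deriv vs f (c *\<^sub>R x + a)) differentiable (at x)"
    by (rule differentiable_compose) (intro derivative_intros)
  then show "iter_deriv vs (\<lambda>x. f (c *\<^sub>R x + a)) differentiable (at x)"
    unfolding iter_deriv_affine[OF assms] by (intro derivative_intros) 
qed

lemma smooth_on_of_real:
  fixes f :: "'a::euclidean_space \<Rightarrow> real"
  shows "open S \<Longrightarrow> smooth_on S f \<Longrightarrow> smooth_on S (\<lambda>x. complex_of_real (f x))"
  by (rule smooth_on_bounded_linear[OF _ bounded_linear_of_real])

lemma iter_deriv_zero: "iter_deriv vs (\<lambda>x. 0) = (\<lambda>x. 0)"
  by (induction vs) (simp_all add: iter_deriv_Cons del: iter_deriv.simps(2))

lemma iter_deriv_zero_open: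
  assumes "open S" "\<And>x. x \<in> S \<Longrightarrow> f x = 0" "x \<in> S"
  shows "iter_deriv vs f x = 0"
  using iter_deriv_cong_open[OF assms(1), of f "\<lambda>x. 0" x vs] assms by (simp add: iter_deriv_zero)

section \<open>Bump functions\<close>

text \<open>The family containing \<open>exp (- 1 / t)\<close> that is closed under differentiation.\<close>

definition flat_exp :: "real poly \<Rightarrow> real \<Rightarrow> real" where
  "flat_exp p t = (if t > 0 then poly p (1 / t) * exp (- (1 / t)) else 0)"

text \<open>Substituting \<open>x = 1 / t\<close> turns the limit into that of a polynomial over
  \<open>exp x\<close> at infinity.\<close>

lemma flat_exp_tendsto: "((\<lambda>t. poly p (1 / t) * exp (- (1 / t))) \<longlongrightarrow> 0) (at_right (0::real))"
proof -
  have "((\<lambda>x. \<Sum>i\<le>degree p. coeff p i * (x ^ i / exp x)) \<longlongrightarrow> (\<Sum>i\<le>degree p. coeff p i * 0)) at_top"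
    by (intro tendsto_intros tendsto_power_div_exp_0)
  then have "((\<lambda>x. poly p x * exp (- x)) \<longlongrightarrow> 0) at_top"
    by (simp add: poly_altdef sum_distrib_right exp_minus divide_inverse mult.assoc)
  from filterlim_compose[OF this filterlim_inverse_at_top_right] show ?thesis
    by (simp add: inverse_eq_divide)
qed

text \<open>With \<open>x = 1 / t\<close>, the derivative of \<open>p(x) * exp (- x)\<close> in
  \<open>t\<close> is \<open>x^2 * (p(x) - p'(x)) * exp (- x)\<close>, and
  \<open>[:0, 0, 1:]\<close> is the polynomial \<open>x^2\<close>.\<close>

lemma flat_exp_has_derivative:
  "(flat_exp p has_real_derivative flat_exp ([:0, 0, 1:] * (p - pderiv p)) t) (at t)"
proof -
  consider "t > 0" | "t < 0" | "t = 0" by linarith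
  then show ?thesis
  proof cases
    case 1
    have "((\<lambda>t. poly p (1 / t) * exp (- (1 / t))) has_real_derivative
        flat_exp ([:0, 0, 1:] * (p - pderiv p)) t) (at t)"
      using 1 by (auto intro!: derivative_eq_intros simp: flat_exp_def field_simps power2_eq_square)
    then show ?thesis
      by (rule has_field_derivative_transform_within_open[of _ _ _ "{0<..}"])
        (use 1 in \<open>auto simp: flat_exp_def\<close>)
  next
    case 2
    have "((\<lambda>t. 0) has_real_derivative flat_exp ([:0, 0, 1:] * (p - pderiv p)) t) (at t)"
      using 2 by (simp add: flat_exp_def)
    then show ?thesis
      by (rule has_field_derivative_transform_within_open[of _ _ _ "{..<0}"])
        (use 2 in \<open>auto simp: flat_exp_def\<close>)
  next
    case 3
    have "((\<lambda>h. flat_exp p h / h) \<longlongrightarrow> 0) (at 0)"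
    proof (rule filterlim_split_at)
      show "((\<lambda>h. flat_exp p h / h) \<longlongrightarrow> 0) (at_left 0)"
        by (rule Lim_transform_eventually[of "\<lambda>_. 0"])
          (auto simp: flat_exp_def eventually_at_filter)
      \<comment> \<open>Dividing by \<open>h\<close> multiplies the polynomial by
        \<open>x = 1 / h\<close>, which is the passage to \<open>pCons 0 p\<close>.\<close>
      show "((\<lambda>h. flat_exp p h / h) \<longlongrightarrow> 0) (at_right 0)"
        by (rule Lim_transform_eventually[OF flat_exp_tendsto[of "pCons 0 p"]])
          (auto simp: flat_exp_def eventually_at_filter field_simps)
    qed
    then show ?thesis
      using 3 by (simp add: DERIV_def flat_exp_def)
  qed
qed

lemma smooth_on_flat_exp: "smooth_on UNIV (flat_exp p)"
proof -
  have "smooth_upto n UNIV (flat_exp p)" for n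
  proof (induction n arbitrary: p)
    case 0
    then show ?case
      using flat_exp_has_derivative[of p]
      by (auto simp: smooth_upto_0 has_field_derivative_def differentiable_def)
  next
    case (Suc n)
    have "dir_deriv v (flat_exp p) = (\<lambda>t. v * flat_exp ([:0, 0, 1:] * (p - pderiv p)) t)" for v
      by (rule ext, rule dir_deriv_eq)
        (use flat_exp_has_derivative[of p, unfolded has_field_derivative_def] in
          \<open>auto simp: mult.commute[of _ "flat_exp _ _"] simp del: mult_pCons_left\<close>)
    moreover have "flat_exp p differentiable (at t)" for t
      using flat_exp_has_derivative[of p]
      by (auto simp: has_field_derivative_def differentiable_def)
    ultimately show ?case
      using Suc by (auto simp: smooth_upto_Suc intro!: smooth_upto_mult smooth_upto_const)
  qed
  then show ?thesis by (simp add: smooth_on_iff_upto)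
qed

text \<open>Composing \<open>exp (- 1 / t)\<close> with itself makes the function constant on both sides of \<open>[0, 1]\<close>.\<close>

definition smooth_step :: "real \<Rightarrow> real" where
  "smooth_step t = inverse (flat_exp 1 (flat_exp 1 1)) * flat_exp 1 (flat_exp 1 1 - flat_exp 1 t)"

lemma smooth_on_smooth_step: "smooth_on UNIV smooth_step"
  unfolding smooth_step_def
  by (intro smooth_on_mult[OF open_UNIV] smooth_on_const smooth_on_diff[OF open_UNIV]
      smooth_on_compose_real[OF open_UNIV smooth_on_flat_exp] smooth_on_flat_exp)

lemma flat_exp_1_mono: "0 < s \<Longrightarrow> s \<le> t \<Longrightarrow> flat_exp 1 s \<le> flat_exp 1 t"
  by (auto simp: flat_exp_def field_simps)

lemma smooth_step_eq_1: "t \<le> 0 \<Longrightarrow> smooth_step t = 1"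
  by (simp add: smooth_step_def flat_exp_def)

lemma smooth_step_eq_0: "t \<ge> 1 \<Longrightarrow> smooth_step t = 0"
  using flat_exp_1_mono[of 1 t] by (simp add: smooth_step_def flat_exp_def)

lemma smooth_step_nonneg: "smooth_step t \<ge> 0"
  by (simp add: smooth_step_def flat_exp_def)

lemma smooth_step_le_1: "smooth_step t \<le> 1"
proof -
  have "flat_exp 1 (flat_exp 1 1 - flat_exp 1 t) \<le> flat_exp 1 (flat_exp 1 1)"
  proof (cases "flat_exp 1 1 - flat_exp 1 t > 0")
    case True
    have "flat_exp 1 t \<ge> 0" by (simp add: flat_exp_def)
    then show ?thesis using True flat_exp_1_mono by auto
  next
    case False
    then show ?thesis by (simp add: flat_exp_def)
  qed
  moreover have "flat_exp 1 (flat_exp 1 1) > 0"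
    by (simp add: flat_exp_def)
  ultimately show ?thesis by (simp add: smooth_step_def field_simps)
qed

text \<open>The argument of the step is \<open>0\<close> at distance \<open>e / 2\<close> from \<open>p\<close> and \<open>1\<close> at distance \<open>e\<close>.\<close>

definition bump :: "'a::euclidean_space \<Rightarrow> real \<Rightarrow> 'a \<Rightarrow> real" where
  "bump p e x = smooth_step (4 / (3 * e\<^sup>2) * ((x - p) \<bullet> (x - p)) - 1 / 3)"

lemma smooth_on_inner:
  fixes f g :: "'a::euclidean_space \<Rightarrow> 'a"
  assumes "open S" "smooth_on S f" "smooth_on S g"
  shows "smooth_on S (\<lambda>x. f x \<bullet> g x)"
proof -
  have "smooth_on S (\<lambda>x. \<Sum>b\<in>Basis. (f x \<bullet> b) * (g x \<bullet> b))"
    by (intro smooth_on_sum smooth_on_mult smooth_on_bounded_linear[OF _ bounded_linear_inner_left] assms)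
  then show ?thesis
    by (simp add: euclidean_inner[symmetric])
qed

lemma smooth_on_ident: "smooth_on S (\<lambda>x. x)"
  by (rule smooth_on_linear) (rule bounded_linear_ident)

lemma smooth_on_bump: "smooth_on UNIV (bump p e)"
  unfolding bump_def
    by (intro smooth_on_compose_real[OF open_UNIV smooth_on_smooth_step] smooth_on_diff[OF open_UNIV]
        smooth_on_mult[OF open_UNIV] smooth_on_const smooth_on_inner[OF open_UNIV] smooth_on_ident)

lemma bump_eq_1:
  assumes "e > 0" "dist p x \<le> e / 2"
  shows "bump p e x = 1"
proof -
  have "(norm (x - p))\<^sup>2 \<le> (e / 2)\<^sup>2"
    using assms by (intro power_mono) (auto simp: dist_norm norm_minus_commute)
  then have "4 * ((x - p) \<bullet> (x - p)) \<le> e\<^sup>2"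
    by (simp add: power2_norm_eq_inner power_divide)
  then show ?thesis
    unfolding bump_def using assms
    by (intro smooth_step_eq_1) (simp add: field_simps)
qed

lemma bump_eq_0:
  assumes "e > 0" "dist p x \<ge> e"
  shows "bump p e x = 0"
proof -
  have "e\<^sup>2 \<le> (norm (x - p))\<^sup>2"
    using assms by (intro power_mono) (auto simp: dist_norm norm_minus_commute)
  then show ?thesis
    unfolding bump_def using assms
    by (intro smooth_step_eq_0) (simp add: power2_norm_eq_inner field_simps)
qed

lemma bump_nonneg: "bump p e x \<ge> 0" and bump_le_1: "bump p e x \<le> 1"
  by (simp_all add: bump_def smooth_step_nonneg smooth_step_le_1)

section \<open>Integration by parts\<close>

lemma lborel_shift:
  fixes f :: "'a::euclidean_space \<Rightarrow> 'b::{banach, second_countable_topology}"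
  assumes f: "f \<in> borel_measurable borel"
  shows "integrable lborel (\<lambda>x. f (c + x)) \<longleftrightarrow> integrable lborel f"
    "(LINT x|lborel. f (c + x)) = (LINT x|lborel. f x)"
  using integrable_distr_eq[of "(+) c" lborel borel f] integral_distr[of "(+) c" lborel borel f] f
  by (simp_all add: lborel_distr_plus)

text \<open>Difference quotients integrate to zero by translation invariance, and dominated
  convergence carries this over to the derivative; the derivative bound acts as a Lipschitz
  constant. The hypotheses are stated for a pointwise derivative with a bound, so that the lemma is
  available for holomorphic functions before their smoothness is established.\<close>

lemma integral_derivative_zero:
  fixes f :: "'a::euclidean_space \<Rightarrow> complex"
  assumes der: "\<And>x. (f has_derivative f' x) (at x)"
    and bd: "\<And>x w. cmod (f' x w) \<le> B * norm w"
    and supp: "\<And>x. norm x > R \<Longrightarrow> f x = 0"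
  shows "integrable lborel (\<lambda>x. f' x v)" "(LINT x|lborel. f' x v) = 0"
proof -
  have lip: "cmod (f y - f x) \<le> B * norm (y - x)" for x y
  proof (rule differentiable_bound[where S = UNIV])
    show "(f has_derivative f' x) (at x within UNIV)" for x using der by simp
    show "onorm (f' x) \<le> B" for x
      using bd by (rule onorm_le)
  qed auto
  have cont: "continuous_on UNIV f"
    by (intro continuous_at_imp_continuous_on ballI has_derivative_continuous[OF der])
  have B: "B * norm v \<ge> 0"
    using bd[of 0 v] norm_ge_zero order_trans by blast
  have int: "integrable lborel f"
  proof -
    have "integrable lborel (\<lambda>x. indicator (cball 0 R) x *\<^sub>R f x)"
      using cont by (intro borel_integrable_compact) (auto intro: continuous_on_subset)
    moreover have "indicator (cball 0 R) x *\<^sub>R f x = f x" for x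
      using supp[of x] by (auto simp: indicator_def)
    ultimately show ?thesis by simp
  qed
  have mf[measurable]: "f \<in> borel_measurable borel"
    using cont by (rule borel_measurable_continuous_onI)
  define q where "q n x = of_real (real (Suc n)) * (f ((1 / real (Suc n)) *\<^sub>R v + x) - f x)" for n x
  have q0: "(LINT x|lborel. q n x) = 0" for n
    unfolding q_def by (simp add: lborel_shift[OF mf] int)
  have qlim: "(\<lambda>n. q n x) \<longlonglongrightarrow> f' x v" for x
  proof -
    have "f' x (k *\<^sub>R v) = k *\<^sub>R f' x v" for k
      using linear_cmul[OF has_derivative_linear[OF der]] .
    moreover have "((\<lambda>t. f (x + t *\<^sub>R v)) has_derivative (\<lambda>k. f' x (k *\<^sub>R v))) (at 0)"
      by (rule has_derivative_compose[of "\<lambda>t. x + t *\<^sub>R v" "\<lambda>k. k *\<^sub>R v"])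
        (auto intro!: derivative_eq_intros der)
    ultimately have "((\<lambda>t. (1 / norm (t - 0)) *\<^sub>R (f (x + t *\<^sub>R v) - (f (x + 0 *\<^sub>R v) + (t - 0) *\<^sub>R f' x v)))
        \<longlongrightarrow> 0) (at 0)"
      by (simp add: has_derivative_within)
    moreover have "filterlim (\<lambda>n. 1 / real (Suc n)) (at 0) sequentially"
      unfolding filterlim_at using LIMSEQ_Suc[OF lim_1_over_n] by auto
    ultimately have "(\<lambda>n. (1 / norm (1 / real (Suc n) - 0)) *\<^sub>R (f (x + (1 / real (Suc n)) *\<^sub>R v) -
        (f (x + 0 *\<^sub>R v) + (1 / real (Suc n) - 0) *\<^sub>R f' x v))) \<longlonglongrightarrow> 0"
      by (rule filterlim_compose)
    moreover have "(1 / norm (1 / real (Suc n) - 0)) *\<^sub>R (f (x + (1 / real (Suc n)) *\<^sub>R v) -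
        (f (x + 0 *\<^sub>R v) + (1 / real (Suc n) - 0) *\<^sub>R f' x v)) = q n x - f' x v" for n
      by (simp add: q_def scaleR_diff_right scaleR_add_right add.commute algebra_simps
          scaleR_conv_of_real[of "real (Suc n)"] del: of_nat_Suc)
    ultimately show ?thesis
      by (simp only: LIM_zero_iff)
  qed
  \<comment> \<open>A shift by at most \<open>norm v\<close> leaves every point outside radius
    \<open>R + norm v\<close> outside radius \<open>R\<close>, so the quotients share one compact
    support.\<close>
  have qbd: "norm (q n x) \<le> indicator (cball 0 (R + norm v)) x *\<^sub>R (B * norm v)" for n x
  proof (cases "x \<in> cball 0 (R + norm v)")
    case True
    have "cmod (f ((1 / real (Suc n)) *\<^sub>R v + x) - f x) \<le> B * norm ((1 / real (Suc n)) *\<^sub>R v)"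
      using lip[of "(1 / real (Suc n)) *\<^sub>R v + x" x] by simp
    also have "\<dots> = (B * norm v) / real (Suc n)" by simp
    finally have "real (Suc n) * cmod (f ((1 / real (Suc n)) *\<^sub>R v + x) - f x) \<le> B * norm v"
      by (simp add: field_simps del: of_nat_Suc)
    then show ?thesis
      using True unfolding q_def norm_mult norm_of_real by simp
  next
    case False
    then have *: "norm x > R + norm v" by simp
    have "norm ((1 / real (Suc n)) *\<^sub>R v) \<le> norm v"
      by (simp add: field_simps)
    then have "norm ((1 / real (Suc n)) *\<^sub>R v + x) > R"
      using * norm_triangle_ineq2[of x "- (1 / real (Suc n)) *\<^sub>R v"] by (simp add: add.commute)
    moreover have "norm x > R" using * norm_ge_zero[of v] by linarith
    ultimately show ?thesis using False supp by (simp add: q_def)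
  qed
  have dom: "integrable lborel (\<lambda>x::'a. indicator (cball 0 (R + norm v)) x *\<^sub>R (B * norm v))"
    by (rule borel_integrable_compact) auto
  have mq: "q n \<in> borel_measurable lborel" for n
    unfolding q_def by measurable
  have mf': "(\<lambda>x. f' x v) \<in> borel_measurable lborel"
    by (rule borel_measurable_LIMSEQ_metric[OF mq qlim])
  show "integrable lborel (\<lambda>x. f' x v)"
    by (rule integrable_dominated_convergence[where s = q, OF mf' mq dom]) (use qlim qbd in auto)
  have "(\<lambda>n. LINT x|lborel. q n x) \<longlonglongrightarrow> (LINT x|lborel. f' x v)"
    by (rule integral_dominated_convergence[where s = q, OF mf' mq dom]) (use qlim qbd in auto)
  then show "(LINT x|lborel. f' x v) = 0"
    unfolding q0 by (simp add: LIMSEQ_const_iff)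
qed

lemma lebesgue_on_eq_lborel:
  fixes f g :: "'a::euclidean_space \<Rightarrow> 'b::{banach, second_countable_topology}"
  assumes "open S" "g \<in> borel_measurable borel" "\<And>x. x \<in> S \<Longrightarrow> f x = g x" "\<And>x. x \<notin> S \<Longrightarrow> g x = 0"
  shows "integrable (lebesgue_on S) f \<longleftrightarrow> integrable lborel g"
    "integral\<^sup>L (lebesgue_on S) f = integral\<^sup>L lborel g"
proof -
  have S: "S \<inter> space lebesgue \<in> sets lebesgue" using assms(1) by simp
  have eq: "indicator S x *\<^sub>R f x = g x" for x
    using assms(3,4)[of x] by (auto simp: indicator_def)
  show "integrable (lebesgue_on S) f \<longleftrightarrow> integrable lborel g"
    unfolding integrable_restrict_space[OF S] eq using assms(2) by (simp add: integrable_completion)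
  show "integral\<^sup>L (lebesgue_on S) f = integral\<^sup>L lborel g"
    unfolding integral_restrict_space[OF S] eq using assms(2) by (simp add: integral_completion)
qed

text \<open>Smoothness is local, and \<open>S\<close> and the complement of \<open>K\<close> are two
  open sets that cover the space.\<close>

lemma smooth_on_extend_zero:
  assumes "open S" "compact K" "K \<subseteq> S" "smooth_on S f" "\<And>x. x \<in> S - K \<Longrightarrow> f x = 0"
  shows "smooth_on UNIV (\<lambda>x. if x \<in> S then f x else 0)" (is "smooth_on _ ?g")
proof -
  have "smooth_on S ?g"
    by (rule smooth_on_cong[OF assms(1) _ assms(4)]) auto
  moreover have "smooth_on (- K) ?g"
    by (rule smooth_on_cong[of _ "\<lambda>x. 0"]) (use assms in \<open>auto simp: open_Compl compact_imp_closed\<close>)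
  moreover have "S \<union> - K = UNIV" using assms(3) by blast
  ultimately show ?thesis using smooth_on_Un by metis
qed

lemma continuous_compact_support_bounded:
  fixes f :: "'a::euclidean_space \<Rightarrow> 'b::real_normed_vector"
  assumes "continuous_on K f" "compact K" "\<And>x. x \<in> S - K \<Longrightarrow> f x = 0"
  obtains B where "B \<ge> 0" "\<And>x. x \<in> S \<Longrightarrow> norm (f x) \<le> B"
proof -
  have "bounded (f ` K)"
    using assms compact_continuous_image compact_imp_bounded by blast
  then obtain B where B: "B > 0" "\<And>x. x \<in> K \<Longrightarrow> norm (f x) \<le> B"
    unfolding bounded_pos by auto
  show ?thesis
    using B assms(3) by (intro that[of B]) (auto, metis DiffI norm_zero less_imp_le)
qed

lemma iter_deriv_zero_off:
  assumes "open S" "compact K" "\<And>x. x \<in> S - K \<Longrightarrow> f x = 0" "x \<in> S - K"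
  shows "iter_deriv vs f x = 0"
  by (rule iter_deriv_zero_open[of "S - K"]) (use assms in \<open>auto simp: open_Diff compact_imp_closed\<close>)

lemma dir_deriv_zero_off:
  assumes "closed K" "\<And>x. x \<notin> K \<Longrightarrow> f x = 0" "x \<notin> K"
  shows "dir_deriv v f x = 0"
  using dir_deriv_cong_open[of "- K" f "\<lambda>x. 0" x v] assms by auto

lemma linear_Basis_bound:
  fixes L :: "'a::euclidean_space \<Rightarrow> 'b::real_normed_vector"
  assumes "linear L" and C: "\<And>b. b \<in> Basis \<Longrightarrow> norm (L b) \<le> C b"
  shows "norm (L w) \<le> (\<Sum>b\<in>Basis. C b) * norm w"
proof -
  have "L w = L (\<Sum>b\<in>Basis. (w \<bullet> b) *\<^sub>R b)"
    by (simp add: euclidean_representation)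
  also have "\<dots> = (\<Sum>b\<in>Basis. (w \<bullet> b) *\<^sub>R L b)"
    by (simp add: linear_sum[OF assms(1)] linear_cmul[OF assms(1)])
  finally have "norm (L w) \<le> (\<Sum>b\<in>Basis. norm ((w \<bullet> b) *\<^sub>R L b))"
    by (metis norm_sum)
  also have "\<dots> \<le> (\<Sum>b\<in>Basis. C b * norm w)"
  proof (rule sum_mono)
    fix b :: 'a assume b: "b \<in> Basis"
    then have "\<bar>w \<bullet> b\<bar> * norm (L b) \<le> norm w * C b"
      using C[OF b] by (intro mult_mono) (auto simp: Basis_le_norm)
    then show "norm ((w \<bullet> b) *\<^sub>R L b) \<le> C b * norm w"
      by (simp add: mult.commute)
  qed
  finally show ?thesis by (simp add: sum_distrib_right)
qed

lemma smooth_compact_support_deriv_bound: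
  fixes g :: "'a::euclidean_space \<Rightarrow> 'b::real_normed_vector"
  assumes g: "smooth_on UNIV g" and K: "compact K" and g0: "\<And>x. x \<notin> K \<Longrightarrow> g x = 0"
  obtains B where "B \<ge> 0" "\<And>x w. norm (dir_deriv w g x) \<le> B * norm w"
proof -
  have dg: "smooth_on UNIV (dir_deriv w g)" for w
    using g by (rule smooth_on_dir_deriv)
  have dg0: "dir_deriv w g x = 0" if "x \<notin> K" for x w
    using K g0 that by (intro dir_deriv_zero_off[of K]) (auto simp: compact_imp_closed)
  have "\<exists>C\<ge>0. \<forall>x. norm (dir_deriv w g x) \<le> C" for w
    using continuous_compact_support_bounded[of K "dir_deriv w g" UNIV] dg0
      continuous_on_subset[OF smooth_on_continuous[OF dg]] K
    by (metis DiffD2 UNIV_I top_greatest)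
  then obtain C where C: "C w \<ge> 0" "norm (dir_deriv w g x) \<le> C w" for w x
    by metis
  show ?thesis
  proof (rule that)
    show "0 \<le> (\<Sum>b\<in>Basis. C b)" using C by (simp add: sum_nonneg)
    fix x w
    have lin: "linear (\<lambda>w. dir_deriv w g x)"
      using differentiable_has_dir_deriv[OF smooth_on_differentiable[OF g]] has_derivative_linear by blast
    show "norm (dir_deriv w g x) \<le> (\<Sum>b\<in>Basis. C b) * norm w"
      by (rule linear_Basis_bound[OF lin C(2)])
  qed
qed

lemma integral_dir_deriv_zero:
  fixes f :: "'a::euclidean_space \<Rightarrow> complex"
  assumes S: "open S" and K: "compact K" "K \<subseteq> S" and f: "smooth_on S f"
    and supp: "\<And>x. x \<in> S - K \<Longrightarrow> f x = 0"
  shows "integrable (lebesgue_on S) (dir_deriv v f)" "(LINT x|lebesgue_on S. dir_deriv v f x) = 0"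
proof -
  define g where "g x = (if x \<in> S then f x else 0)" for x
  have g: "smooth_on UNIV g"
    unfolding g_def by (rule smooth_on_extend_zero[OF S K f supp])
  have g0: "g x = 0" if "x \<in> UNIV - K" for x
    using that supp by (auto simp: g_def)
  have dg: "smooth_on UNIV (dir_deriv w g)" for w
    using g by (rule smooth_on_dir_deriv)
  have dg0: "dir_deriv w g x = 0" if "x \<notin> K" for x w
    using iter_deriv_zero_off[OF open_UNIV K(1) g0, where x = x and vs = "[w]"] that by (simp add: dir_deriv_def)
  obtain B where bd: "\<And>x w. cmod (dir_deriv w g x) \<le> B * norm w"
    using smooth_compact_support_deriv_bound[OF g K(1)] g0 by (metis DiffI UNIV_I)
  have der: "(g has_derivative (\<lambda>w. dir_deriv w g x)) (at x)" for x
    using differentiable_has_dir_deriv smooth_on_differentiable[OF g] by blast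
  obtain R where R: "\<And>x. x \<in> K \<Longrightarrow> norm x \<le> R"
    using compact_imp_bounded[OF K(1)] unfolding bounded_iff by blast
  have gR: "g x = 0" if "norm x > R" for x
    using that R g0 by force
  note * = integral_derivative_zero[OF der bd gR, where v = v]
  have m: "dir_deriv v g \<in> borel_measurable borel"
    using borel_measurable_continuous_onI[OF smooth_on_continuous[OF dg]] .
  have eq: "dir_deriv v f x = dir_deriv v g x" if "x \<in> S" for x
    by (rule dir_deriv_cong_open[OF S _ that]) (simp add: g_def)
  have z: "dir_deriv v g x = 0" if "x \<notin> S" for x
    using that K dg0 by auto
  show "integrable (lebesgue_on S) (dir_deriv v f)" "(LINT x|lebesgue_on S. dir_deriv v f x) = 0"
    using lebesgue_on_eq_lborel[OF S m eq z] * by auto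
qed

lemma integrable_compact_support:
  fixes f :: "'a::euclidean_space \<Rightarrow> complex"
  assumes "open S" "compact K" "K \<subseteq> S" "smooth_on S f" "\<And>x. x \<in> S - K \<Longrightarrow> f x = 0"
  shows "integrable (lebesgue_on S) f"
proof -
  have "continuous_on K f"
    using smooth_on_continuous[OF assms(4)] assms(3) by (rule continuous_on_subset)
  then have "integrable lborel (\<lambda>x. indicator K x *\<^sub>R f x)"
    using assms(2) by (intro borel_integrable_compact)
  moreover from borel_measurable_integrable[OF this]
  have "(\<lambda>x. indicator K x *\<^sub>R f x) \<in> borel_measurable borel"
    by simp
  ultimately show ?thesis
    using assms by (subst lebesgue_on_eq_lborel(1)[of S "\<lambda>x. indicator K x *\<^sub>R f x"])
      (auto simp: indicator_def)
qed

lemma integration_by_parts: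
  fixes f g :: "'a::euclidean_space \<Rightarrow> complex"
  assumes S: "open S" and K: "compact K" "K \<subseteq> S" and f: "smooth_on S f" and g: "smooth_on S g"
    and supp: "\<And>x. x \<in> S - K \<Longrightarrow> g x = 0"
  shows "(LINT x|lebesgue_on S. f x * dir_deriv v g x) = - (LINT x|lebesgue_on S. dir_deriv v f x * g x)"
proof -
  have g': "dir_deriv v g x = 0" if "x \<in> S - K" for x
    using iter_deriv_zero_off[OF S K(1) supp that, where vs = "[v]"] by (simp add: dir_deriv_def)
  have i1: "integrable (lebesgue_on S) (\<lambda>x. f x * dir_deriv v g x)"
    using g' by (intro integrable_compact_support[OF S K] smooth_on_mult[OF S] f smooth_on_dir_deriv[OF g]) auto
  have i2: "integrable (lebesgue_on S) (\<lambda>x. dir_deriv v f x * g x)"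
    using supp by (intro integrable_compact_support[OF S K] smooth_on_mult[OF S] g smooth_on_dir_deriv[OF f]) auto
  have "0 = (LINT x|lebesgue_on S. dir_deriv v (\<lambda>x. f x * g x) x)"
    by (rule integral_dir_deriv_zero(2)[symmetric, OF S K smooth_on_mult[OF S f g]]) (simp add: supp)
  also have "\<dots> = (LINT x|lebesgue_on S. f x * dir_deriv v g x + dir_deriv v f x * g x)"
    by (rule Bochner_Integration.integral_cong)
      (auto simp: dir_deriv_mult smooth_on_differentiable[OF f] smooth_on_differentiable[OF g])
  also have "\<dots> = (LINT x|lebesgue_on S. f x * dir_deriv v g x) + (LINT x|lebesgue_on S. dir_deriv v f x * g x)"
    by (rule Bochner_Integration.integral_add[OF i1 i2])
  finally show ?thesis by (simp add: eq_neg_iff_add_eq_0)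
qed

text \<open>The outermost derivative of \<open>g\<close> is moved before the others and so becomes
  the innermost one on \<open>f\<close>. Hence \<open>rev vs\<close>, and symmetry of mixed
  derivatives does not enter.\<close>

lemma integration_by_parts_iter:
  fixes f g :: "'a::euclidean_space \<Rightarrow> complex"
  assumes S: "open S" and K: "compact K" "K \<subseteq> S" and g: "smooth_on S g"
    and supp: "\<And>x. x \<in> S - K \<Longrightarrow> g x = 0"
  shows "smooth_on S f \<Longrightarrow> (LINT x|lebesgue_on S. f x * iter_deriv vs g x) =
    (- 1) ^ length vs * (LINT x|lebesgue_on S. iter_deriv (rev vs) f x * g x)"
proof (induction vs arbitrary: f)
  case (Cons v vs)
  have "(LINT x|lebesgue_on S. f x * iter_deriv (v # vs) g x) =
      - (LINT x|lebesgue_on S. dir_deriv v f x * iter_deriv vs g x)"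
    unfolding iter_deriv_Cons
    using iter_deriv_zero_off[OF S K(1) supp, where vs = vs]
    by (intro integration_by_parts[OF S K Cons.prems smooth_on_iter_deriv[OF g]])
  also have "\<dots> = - ((- 1) ^ length vs * (LINT x|lebesgue_on S. iter_deriv (rev vs) (dir_deriv v f) x * g x))"
    by (simp add: Cons.IH smooth_on_dir_deriv[OF Cons.prems])
  finally show ?case
    by (simp add: iter_deriv_snoc)
qed simp

section \<open>Test functions and weak derivatives\<close>

lemma test_functionsI:
  assumes "smooth_on UNIV \<phi>" "compact K" "K \<subseteq> S" "\<And>x. x \<notin> K \<Longrightarrow> \<phi> x = 0"
  shows "\<phi> \<in> test_functions S"
proof -
  have "closure {x. \<phi> x \<noteq> 0} \<subseteq> K"
    using assms by (intro closure_minimal) (auto simp: compact_imp_closed)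
  moreover from this have "compact (closure {x. \<phi> x \<noteq> 0})"
    using assms(2) closed_Int_compact[OF closed_closure] by (metis inf.absorb_iff1)
  ultimately show ?thesis
    using assms by (auto simp: test_functions_def)
qed

lemma test_functionsE:
  assumes "\<phi> \<in> test_functions S"
  obtains K where "smooth_on UNIV \<phi>" "compact K" "K \<subseteq> S" "\<And>x. x \<notin> K \<Longrightarrow> \<phi> x = 0"
proof
  show "\<phi> x = 0" if "x \<notin> closure {x. \<phi> x \<noteq> 0}" for x
    using that closure_subset[of "{x. \<phi> x \<noteq> 0}"] by auto
qed (use assms in \<open>auto simp: test_functions_def\<close>)

lemma smooth_on_prod:
  fixes f :: "'i \<Rightarrow> 'a::euclidean_space \<Rightarrow> 'b::{real_normed_algebra_1, comm_monoid_mult}"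
  shows "open S \<Longrightarrow> (\<And>i. i \<in> I \<Longrightarrow> smooth_on S (f i)) \<Longrightarrow> smooth_on S (\<lambda>x. \<Prod>i\<in>I. f i x)"
  by (induction I rule: infinite_finite_induct) (auto intro: smooth_on_mult)

text \<open>The function \<open>1 - \<Prod>(1 - bump)\<close> equals \<open>1\<close> as soon as one
  bump does and \<open>0\<close> where all of them vanish. The balls of half radius, on which the
  bumps are \<open>1\<close>, are chosen to cover \<open>K\<close>.\<close>

lemma smooth_plateau:
  fixes K :: "'a::euclidean_space set"
  assumes K: "compact K" and S: "open S" "K \<subseteq> S"
  obtains \<phi> :: "'a \<Rightarrow> real" and L where "smooth_on UNIV \<phi>" "\<And>x. 0 \<le> \<phi> x" "\<And>x. \<phi> x \<le> 1"
    "\<And>x. x \<in> K \<Longrightarrow> \<phi> x = 1" "compact L" "L \<subseteq> S" "\<And>x. x \<notin> L \<Longrightarrow> \<phi> x = 0"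
proof -
  have "\<exists>e>0. cball x e \<subseteq> S" if "x \<in> K" for x
    using that S open_contains_cball by blast
  then obtain e where e: "e x > 0" "cball x (e x) \<subseteq> S" if "x \<in> K" for x
    by metis
  obtain D where D: "D \<subseteq> K" "finite D" "K \<subseteq> (\<Union>x\<in>D. ball x (e x / 2))"
  proof (rule compactE_image[OF K, of K "\<lambda>x. ball x (e x / 2)"])
    show "K \<subseteq> (\<Union>x\<in>K. ball x (e x / 2))"
      using e(1) by force
  qed auto
  define \<phi> where "\<phi> x = 1 - (\<Prod>p\<in>D. 1 - bump p (e p) x)" for x
  have le: "0 \<le> 1 - bump p (e p) x" "1 - bump p (e p) x \<le> 1" for p x
    using bump_nonneg[of p "e p" x] bump_le_1[of p "e p" x] by auto
  show ?thesis
  proof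
    show "smooth_on UNIV \<phi>"
      unfolding \<phi>_def
      by (intro smooth_on_diff[OF open_UNIV] smooth_on_prod[OF open_UNIV] smooth_on_const smooth_on_bump)
    show "0 \<le> \<phi> x" "\<phi> x \<le> 1" for x
      using le prod_le_1[of D "\<lambda>p. 1 - bump p (e p) x"] prod_nonneg[of D "\<lambda>p. 1 - bump p (e p) x"]
      by (auto simp: \<phi>_def)
    show "\<phi> x = 1" if x: "x \<in> K" for x
    proof -
      obtain p where p: "p \<in> D" "dist p x < e p / 2"
        using subsetD[OF D(3) x] by auto
      then have "bump p (e p) x = 1"
        using e D by (intro bump_eq_1) auto
      then have "(\<Prod>p\<in>D. 1 - bump p (e p) x) = 0"
        using p D by (intro prod_zero) auto
      then show ?thesis by (simp add: \<phi>_def)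
    qed
    show "compact (\<Union>p\<in>D. cball p (e p))"
      using D by (intro compact_UN) auto
    show "(\<Union>p\<in>D. cball p (e p)) \<subseteq> S"
      by (intro UN_least e(2) subsetD[OF D(1)])
    show "\<phi> x = 0" if "x \<notin> (\<Union>p\<in>D. cball p (e p))" for x
    proof -
      have "bump p (e p) x = 0" if "p \<in> D" for p
        using that \<open>x \<notin> _\<close> e D by (intro bump_eq_0) (auto simp: not_le less_imp_le)
      then show ?thesis by (simp add: \<phi>_def)
    qed
  qed
qed

text \<open>Plateau functions along an exhaustion of \<open>A\<close> by compact sets converge
  pointwise to the indicator of \<open>A\<close> and stay between \<open>0\<close> and
  \<open>1\<close>, so \<open>norm (h x)\<close> dominates.\<close>

lemma fundamental_lemma_open:
  fixes h :: "'a::euclidean_space \<Rightarrow> complex"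
  assumes S: "open S" and h: "integrable (lebesgue_on S) h"
    and orth: "\<And>\<phi>. \<phi> \<in> test_functions S \<Longrightarrow> (LINT x|lebesgue_on S. h x * \<phi> x) = 0"
    and A: "open A" "A \<subseteq> S"
  shows "(LINT x|lebesgue_on S. indicator A x *\<^sub>R h x) = 0"
proof -
  obtain C where C: "\<And>n::nat. compact (C n)" "\<And>n. C n \<subseteq> A" "\<And>n. C n \<subseteq> interior (C (Suc n))"
    "\<Union>(range C) = A" "\<And>K. \<lbrakk>compact K; K \<subseteq> A\<rbrakk> \<Longrightarrow> \<exists>N. \<forall>n\<ge>N. K \<subseteq> C n"
    using open_Union_compact_subsets[OF A(1)] by metis
  have "\<exists>\<phi> :: 'a \<Rightarrow> real. \<exists>L. smooth_on UNIV \<phi> \<and> (\<forall>x. 0 \<le> \<phi> x \<and> \<phi> x \<le> 1) \<and> (\<forall>x\<in>C n. \<phi> x = 1) \<and>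
      compact L \<and> L \<subseteq> A \<and> (\<forall>x. x \<notin> L \<longrightarrow> \<phi> x = 0)" for n
    using smooth_plateau[OF C(1) A(1) C(2), of n] by metis
  then obtain \<phi> :: "nat \<Rightarrow> 'a \<Rightarrow> real" and L where \<phi>: "\<And>n. smooth_on UNIV (\<phi> n)"
    "\<And>n x. 0 \<le> \<phi> n x" "\<And>n x. \<phi> n x \<le> 1" "\<And>n x. x \<in> C n \<Longrightarrow> \<phi> n x = 1"
    and L: "\<And>n. compact (L n)" "\<And>n. L n \<subseteq> A" "\<And>n x. x \<notin> L n \<Longrightarrow> \<phi> n x = 0"
    by metis
  have z: "(LINT x|lebesgue_on S. \<phi> n x *\<^sub>R h x) = 0" for n
  proof -
    have "(\<lambda>x. complex_of_real (\<phi> n x)) \<in> test_functions S"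
      by (rule test_functionsI[OF smooth_on_of_real[OF open_UNIV \<phi>(1)] L(1)]) (use L(2,3) A(2) in \<open>auto simp: subset_iff\<close>)
    from orth[OF this] show ?thesis
      by (simp add: scaleR_conv_of_real mult.commute)
  qed
  have lim: "(\<lambda>n. \<phi> n x *\<^sub>R h x) \<longlonglongrightarrow> indicator A x *\<^sub>R h x" for x
  proof (cases "x \<in> A")
    case True
    then obtain N where "\<forall>n\<ge>N. {x} \<subseteq> C n"
      using C(5)[of "{x}"] by auto
    then have "\<forall>\<^sub>F n in sequentially. \<phi> n x *\<^sub>R h x = indicator A x *\<^sub>R h x"
      using True \<phi>(4) unfolding eventually_sequentially by (intro exI[of _ N]) simp
    then show ?thesis by (simp add: tendsto_eventually)
  next
    case False
    then have "\<phi> n x = 0" for n using L by blast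
    then show ?thesis using False by simp
  qed
  have m: "\<phi> n \<in> borel_measurable (lebesgue_on S)" for n
    using borel_measurable_continuous_onI[OF smooth_on_continuous[OF \<phi>(1)]]
    by (simp add: borel_measurable_if_I measurable_completion measurable_restrict_space1)
  have hm: "h \<in> borel_measurable (lebesgue_on S)" using h by simp
  have Am: "A \<in> sets (lebesgue_on S)"
    using A S by (simp add: sets_restrict_space_iff)
  have "(\<lambda>n. LINT x|lebesgue_on S. \<phi> n x *\<^sub>R h x) \<longlonglongrightarrow> (LINT x|lebesgue_on S. indicator A x *\<^sub>R h x)"
  proof (rule integral_dominated_convergence[where w = "\<lambda>x. norm (h x)"])
    show "(\<lambda>x. indicator A x *\<^sub>R h x) \<in> borel_measurable (lebesgue_on S)"
      using hm Am by (intro borel_measurable_scaleR borel_measurable_indicator)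
    show "(\<lambda>x. \<phi> n x *\<^sub>R h x) \<in> borel_measurable (lebesgue_on S)" for n
      using hm m by (intro borel_measurable_scaleR)
    show "AE x in lebesgue_on S. norm (\<phi> n x *\<^sub>R h x) \<le> norm (h x)" for n
      using \<phi>(2,3)[of n] by (intro AE_I2) (simp add: mult_left_le_one_le)
  qed (use lim h in auto)
  then show ?thesis
    unfolding z by (simp add: LIMSEQ_const_iff)
qed

text \<open>A Lebesgue set is a countable intersection of open sets up to a null set, so the case of
  open sets shows that \<open>h\<close> has integral zero over every measurable subset of
  \<open>S\<close>.\<close>

lemma fundamental_lemma:
  fixes h :: "'a::euclidean_space \<Rightarrow> complex"
  assumes S: "open S" and h: "integrable (lebesgue_on S) h"
    and orth: "\<And>\<phi>. \<phi> \<in> test_functions S \<Longrightarrow> (LINT x|lebesgue_on S. h x * \<phi> x) = 0"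
  shows "AE x in lebesgue_on S. h x = 0"
proof -
  have zero: "(LINT x|lebesgue_on S. indicator E x *\<^sub>R h x) = 0" if E: "E \<in> sets (lebesgue_on S)" for E
  proof -
    have E': "E \<in> sets lebesgue" "E \<subseteq> S"
      using E S by (auto simp: sets_restrict_space_iff)
    obtain C T where C: "gdelta C" "T \<in> null_sets lebesgue" "E \<union> T = C"
      using lebesgue_set_almost_gdelta[OF E'(1)] by metis
    obtain F :: "nat \<Rightarrow> 'a set" where F: "\<And>n. open (F n)" "C = \<Inter>(range F)"
      using C(1) by (metis gdelta.cases)
    \<comment> \<open>Finite intersections with \<open>S\<close> give open sets that decrease to
      \<open>S \<inter> C\<close>, and \<open>C\<close> differs from \<open>E\<close> only within
      the null set \<open>T\<close>.\<close>
    define G where "G n = S \<inter> (\<Inter>i\<le>n. F i)" for n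
    have G: "open (G n)" "G n \<subseteq> S" for n
      using S F by (auto simp: G_def intro!: open_Int open_INT)
    have z: "(LINT x|lebesgue_on S. indicator (G n) x *\<^sub>R h x) = 0" for n
      by (rule fundamental_lemma_open[OF S h orth G])
    have hm: "h \<in> borel_measurable (lebesgue_on S)" using h by simp
    have "(\<lambda>n. LINT x|lebesgue_on S. indicator (G n) x *\<^sub>R h x) \<longlonglongrightarrow> (LINT x|lebesgue_on S. indicator E x *\<^sub>R h x)"
    proof (rule integral_dominated_convergence[where w = "\<lambda>x. norm (h x)"])
      show "(\<lambda>x. indicator E x *\<^sub>R h x) \<in> borel_measurable (lebesgue_on S)"
        using hm E by (intro borel_measurable_scaleR borel_measurable_indicator)
      have "G n \<in> sets (lebesgue_on S)" for n
        using G[of n] S by (simp add: sets_restrict_space_iff)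
      then show "(\<lambda>x. indicator (G n) x *\<^sub>R h x) \<in> borel_measurable (lebesgue_on S)" for n
        using hm by (intro borel_measurable_scaleR borel_measurable_indicator)
      show "AE x in lebesgue_on S. (\<lambda>n. indicator (G n) x *\<^sub>R h x) \<longlonglongrightarrow> indicator E x *\<^sub>R h x"
      proof -
        have "AE x in lebesgue. x \<notin> T" using C(2) by (rule AE_not_in)
        then have "AE x in lebesgue_on S. x \<notin> T"
          using S by (subst AE_restrict_space_iff) auto
        moreover have "AE x in lebesgue_on S. x \<in> S"
          by (rule AE_I2) simp
        ultimately show ?thesis
        proof eventually_elim
          case (elim x)
          show ?case
          proof (cases "x \<in> E")
            case True
            then have "x \<in> G n" for n using elim C F by (auto simp: G_def)
            then show ?thesis using True by simp
          next
            case False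
            then have "x \<notin> C" using elim C by auto
            then obtain N where "x \<notin> F N" using F by auto
            then have "\<forall>n\<ge>N. x \<notin> G n" by (auto simp: G_def)
            then have "\<forall>\<^sub>F n in sequentially. indicator (G n) x *\<^sub>R h x = indicator E x *\<^sub>R h x"
              using False unfolding eventually_sequentially by (intro exI[of _ N]) simp
            then show ?thesis by (simp add: tendsto_eventually)
          qed
        qed
      qed
    qed (use h in \<open>auto simp: indicator_def\<close>)
    then show ?thesis
      unfolding z by (simp add: LIMSEQ_const_iff)
  qed
  \<comment> \<open>Uniqueness of densities is available for real functions; \<open>L\<close> will
    be the real and the imaginary part.\<close>
  have "AE x in lebesgue_on S. L (h x) = 0" if L: "bounded_linear L" for L :: "complex \<Rightarrow> real"
  proof (rule density_unique_real)
    show "integrable (lebesgue_on S) (\<lambda>x. L (h x))"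
      using h by (rule integrable_bounded_linear[OF L])
    show "(\<integral>x\<in>E. L (h x) \<partial>lebesgue_on S) = (\<integral>x\<in>E. 0 \<partial>lebesgue_on S)" if E: "E \<in> sets (lebesgue_on S)" for E
      using integral_bounded_linear[OF L integrable_mult_indicator[OF E h]] zero[OF E]
      by (simp add: set_lebesgue_integral_def linear_cmul[OF bounded_linear.linear[OF L]]
          linear_0[OF bounded_linear.linear[OF L]])
  qed simp
  from this[OF bounded_linear_Re] this[OF bounded_linear_Im] show ?thesis
    by eventually_elim (simp add: complex_eq_iff)
qed

section \<open>Sobolev norms of smooth functions\<close>

text \<open>The same arbitrary ordering of a multiset that \<open>partial_deriv\<close> chooses,
  named so that its directions and its length can be spoken of.\<close>

definition multi_index_list :: "'a multiset \<Rightarrow> 'a list" where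
  "multi_index_list \<alpha> = (SOME vs. mset vs = \<alpha>)"

lemma mset_multi_index_list [simp]: "mset (multi_index_list \<alpha>) = \<alpha>"
  unfolding multi_index_list_def by (rule someI_ex) (rule ex_mset)

lemma multi_index_list_props:
  assumes "\<alpha> \<in> multi_indices l"
  shows "set (multi_index_list \<alpha>) \<subseteq> Basis" "length (multi_index_list \<alpha>) \<le> l"
  using assms unfolding multi_indices_def
  by (metis (mono_tags, lifting) mem_Collect_eq mset_multi_index_list set_mset_mset)
    (use assms in \<open>simp add: multi_indices_def flip: size_mset\<close>)

lemma partial_deriv_eq: "partial_deriv \<alpha> \<phi> = iter_deriv (multi_index_list \<alpha>) \<phi>"
  by (simp add: partial_deriv_def multi_index_list_def)

section \<open>Square integrable functions\<close>

lemma L2_bounded: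
  assumes S: "open S" "bounded S" and f: "f \<in> borel_measurable (lebesgue_on S)"
    and bd: "\<And>x. x \<in> S \<Longrightarrow> cmod (f x) \<le> A"
  shows "f \<in> L2 S" "(LINT x|lebesgue_on S. (cmod (f x))\<^sup>2) \<le> A\<^sup>2 * measure lebesgue S"
proof -
  have fin: "S \<in> lmeasurable" using S by (simp add: bounded_set_imp_lmeasurable)
  have c: "integrable (lebesgue_on S) (\<lambda>x. A\<^sup>2)"
    using fin by (simp add: finite_measure.integrable_const finite_measure_lebesgue_on)
  have i: "integrable (lebesgue_on S) (\<lambda>x. (cmod (f x))\<^sup>2)"
  proof (rule Bochner_Integration.integrable_bound[OF c])
    show "(\<lambda>x. (cmod (f x))\<^sup>2) \<in> borel_measurable (lebesgue_on S)" using f by simp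
    show "AE x in lebesgue_on S. norm ((cmod (f x))\<^sup>2) \<le> norm (A\<^sup>2)"
      using bd by (intro AE_I2) (simp add: power_mono)
  qed
  then show "f \<in> L2 S" using f by (simp add: L2_def)
  have "(LINT x|lebesgue_on S. (cmod (f x))\<^sup>2) \<le> (LINT x|lebesgue_on S. A\<^sup>2)"
    using bd by (intro integral_mono i c) (simp add: power_mono)
  also have "\<dots> = A\<^sup>2 * measure lebesgue S"
    using fin by (simp add: measure_restrict_space fmeasurableD)
  finally show "(LINT x|lebesgue_on S. (cmod (f x))\<^sup>2) \<le> A\<^sup>2 * measure lebesgue S" .
qed

lemma smooth_on_borel_measurable:
  "open S \<Longrightarrow> smooth_on S f \<Longrightarrow> f \<in> borel_measurable (lebesgue_on S)"
  by (rule continuous_imp_measurable_on_sets_lebesgue[OF smooth_on_continuous]) auto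

lemma L2_measurable: "f \<in> L2 S \<Longrightarrow> f \<in> borel_measurable (lebesgue_on S)"
  by (simp add: L2_def)

text \<open>The elementary bound \<open>2 * a * b \<le> a^2 + b^2\<close> takes the place of
  Cauchy-Schwarz. The constant is not sharp, but it serves for integrability and for showing that a
  supremum is finite.\<close>

lemma L2_mult_integrable:
  assumes "f \<in> L2 S" "g \<in> L2 S"
  shows "integrable (lebesgue_on S) (\<lambda>x. f x * g x)"
    "cmod (LINT x|lebesgue_on S. f x * g x) \<le>
      ((LINT x|lebesgue_on S. (cmod (f x))\<^sup>2) + (LINT x|lebesgue_on S. (cmod (g x))\<^sup>2)) / 2"
proof -
  have i: "integrable (lebesgue_on S) (\<lambda>x. ((cmod (f x))\<^sup>2 + (cmod (g x))\<^sup>2) / 2)"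
    using assms by (simp add: L2_def)
  have le: "norm (f x * g x) \<le> ((cmod (f x))\<^sup>2 + (cmod (g x))\<^sup>2) / 2" for x
    using sum_squares_bound[of "cmod (f x)" "cmod (g x)"] by (simp add: norm_mult)
  have m: "(\<lambda>x. f x * g x) \<in> borel_measurable (lebesgue_on S)"
    by (intro borel_measurable_times L2_measurable assms)
  show "integrable (lebesgue_on S) (\<lambda>x. f x * g x)"
    using le by (intro Bochner_Integration.integrable_bound[OF i m] AE_I2) force
  have "cmod (LINT x|lebesgue_on S. f x * g x) \<le> (LINT x|lebesgue_on S. norm (f x * g x))"
    by (rule integral_norm_bound)
  also have "\<dots> \<le> (LINT x|lebesgue_on S. ((cmod (f x))\<^sup>2 + (cmod (g x))\<^sup>2) / 2)"
    using le \<open>integrable (lebesgue_on S) (\<lambda>x. f x * g x)\<close> by (intro integral_mono i) auto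
  also have "\<dots> = ((LINT x|lebesgue_on S. (cmod (f x))\<^sup>2) + (LINT x|lebesgue_on S. (cmod (g x))\<^sup>2)) / 2"
    using assms by (simp add: L2_def)
  finally show "cmod (LINT x|lebesgue_on S. f x * g x) \<le>
      ((LINT x|lebesgue_on S. (cmod (f x))\<^sup>2) + (LINT x|lebesgue_on S. (cmod (g x))\<^sup>2)) / 2" .
qed

lemma L2_cnj: "f \<in> L2 S \<Longrightarrow> (\<lambda>x. cnj (f x)) \<in> L2 S"
  using measurable_compose[OF L2_measurable borel_measurable_continuous_onI[of cnj], of f S]
  by (simp add: L2_def continuous_on_cnj)

lemma L2_const: "open S \<Longrightarrow> bounded S \<Longrightarrow> (\<lambda>x. c) \<in> L2 S"
  by (rule L2_bounded(1)[where A = "cmod c"]) auto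

lemma L2_integrable:
  assumes "open S" "bounded S" "f \<in> L2 S"
  shows "integrable (lebesgue_on S) f"
  using L2_mult_integrable(1)[OF assms(3) L2_const[OF assms(1,2), of 1]] by simp

lemma L2_mult_bounded:
  assumes g: "g \<in> borel_measurable (lebesgue_on S)" and bd: "\<And>x. x \<in> S \<Longrightarrow> cmod (g x) \<le> A"
    and f: "f \<in> L2 S"
  shows "(\<lambda>x. f x * g x) \<in> L2 S"
proof -
  have m: "(\<lambda>x. f x * g x) \<in> borel_measurable (lebesgue_on S)"
    by (intro borel_measurable_times L2_measurable f g)
  have i: "integrable (lebesgue_on S) (\<lambda>x. A\<^sup>2 * (cmod (f x))\<^sup>2)"
    using f by (simp add: L2_def)
  have "integrable (lebesgue_on S) (\<lambda>x. (cmod (f x * g x))\<^sup>2)"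
  proof (rule Bochner_Integration.integrable_bound[OF i])
    show "(\<lambda>x. (cmod (f x * g x))\<^sup>2) \<in> borel_measurable (lebesgue_on S)"
      using m by simp
    show "AE x in lebesgue_on S. norm ((cmod (f x * g x))\<^sup>2) \<le> norm (A\<^sup>2 * (cmod (f x))\<^sup>2)"
      using bd by (intro AE_I2)
        (simp add: norm_mult power_mult_distrib mult.commute[of "(cmod (f _))\<^sup>2"] mult_right_mono power_mono)
  qed
  with m show ?thesis by (simp add: L2_def)
qed

text \<open>Integration by parts reverses the order in which the derivatives are taken, so the
  classical derivative along the reversed list is the one that satisfies the defining
  identity.\<close>

lemma has_L2_weak_deriv_smooth:
  assumes "open S" "smooth_on S f" "iter_deriv (rev (multi_index_list \<alpha>)) f \<in> L2 S"
  shows "has_L2_weak_deriv S \<alpha> f (iter_deriv (rev (multi_index_list \<alpha>)) f)"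
  unfolding has_L2_weak_deriv_def
proof (intro conjI ballI assms)
  fix \<phi> assume "\<phi> \<in> test_functions S"
  then obtain K where K: "smooth_on UNIV \<phi>" "compact K" "K \<subseteq> S" "\<And>x. x \<notin> K \<Longrightarrow> \<phi> x = 0"
    by (rule test_functionsE) blast
  have "length (multi_index_list \<alpha>) = size \<alpha>"
    by (simp flip: size_mset)
  then show "(LINT x|lebesgue_on S. f x * partial_deriv \<alpha> \<phi> x) =
      (- 1) ^ size \<alpha> * (LINT x|lebesgue_on S. iter_deriv (rev (multi_index_list \<alpha>)) f x * \<phi> x)"
    using integration_by_parts_iter[OF assms(1) K(2,3) smooth_on_subset[OF K(1)] K(4) assms(2)]
    by (simp add: partial_deriv_eq)
qed

lemma test_functions_L2:
  assumes "\<phi> \<in> test_functions S" "open S" "bounded S"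
  shows "\<phi> \<in> L2 S"
proof -
  obtain K where K: "smooth_on UNIV \<phi>" "compact K" "K \<subseteq> S" "\<And>x. x \<notin> K \<Longrightarrow> \<phi> x = 0"
    using assms(1) by (rule test_functionsE) blast
  have "continuous_on K \<phi>"
    using smooth_on_continuous[OF K(1)] by (rule continuous_on_subset) simp
  then obtain B where "\<And>x. x \<in> S \<Longrightarrow> cmod (\<phi> x) \<le> B"
    using continuous_compact_support_bounded[of K \<phi> S] K(2,4) by (metis DiffD2)
  then show ?thesis
    using K assms smooth_on_subset[OF K(1)]
    by (intro L2_bounded(1)[OF _ _ smooth_on_borel_measurable]) auto
qed

lemma weak_deriv_unique:
  assumes S: "open S" "bounded S" and h: "has_L2_weak_deriv S \<alpha> f h1" "has_L2_weak_deriv S \<alpha> f h2"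
  shows "AE x in lebesgue_on S. h1 x = h2 x"
proof -
  have L: "h1 \<in> L2 S" "h2 \<in> L2 S" using h by (auto simp: has_L2_weak_deriv_def)
  have "AE x in lebesgue_on S. h1 x - h2 x = 0"
  proof (rule fundamental_lemma[OF S(1) Bochner_Integration.integrable_diff[OF L2_integrable[OF S L(1)] L2_integrable[OF S L(2)]]])
    fix \<phi> assume \<phi>: "\<phi> \<in> test_functions S"
    have "(- 1) ^ size \<alpha> * (LINT x|lebesgue_on S. h1 x * \<phi> x) =
        ((- 1) ^ size \<alpha> * (LINT x|lebesgue_on S. h2 x * \<phi> x) :: complex)"
      using bspec[OF conjunct2[OF h(1)[unfolded has_L2_weak_deriv_def]] \<phi>]
        bspec[OF conjunct2[OF h(2)[unfolded has_L2_weak_deriv_def]] \<phi>] by (rule trans[OF sym])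
    moreover have "(LINT x|lebesgue_on S. (h1 x - h2 x) * \<phi> x) =
        (LINT x|lebesgue_on S. h1 x * \<phi> x) - (LINT x|lebesgue_on S. h2 x * \<phi> x)"
      unfolding left_diff_distrib
      by (rule Bochner_Integration.integral_diff[OF L2_mult_integrable(1)[OF L(1) test_functions_L2[OF \<phi> S]]
            L2_mult_integrable(1)[OF L(2) test_functions_L2[OF \<phi> S]]])
    ultimately show "(LINT x|lebesgue_on S. (h1 x - h2 x) * \<phi> x) = 0"
      by simp
  qed
  then show ?thesis by simp
qed

text \<open>\<open>weak_deriv\<close> is an arbitrary choice, and all choices agree almost
  everywhere. This is what allows a Sobolev norm to be computed from an explicit derivative.\<close>

lemma weak_deriv_norm:
  assumes S: "open S" "bounded S" and h: "has_L2_weak_deriv S \<alpha> f h"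
  shows "(LINT x|lebesgue_on S. (cmod (weak_deriv S \<alpha> f x))\<^sup>2) = (LINT x|lebesgue_on S. (cmod (h x))\<^sup>2)"
proof -
  have w: "has_L2_weak_deriv S \<alpha> f (weak_deriv S \<alpha> f)"
    unfolding weak_deriv_def by (rule someI[of "has_L2_weak_deriv S \<alpha> f", OF h])
  show ?thesis
  proof (rule integral_cong_AE)
    show "AE x in lebesgue_on S. (cmod (weak_deriv S \<alpha> f x))\<^sup>2 = (cmod (h x))\<^sup>2"
      using weak_deriv_unique[OF S w h] by eventually_elim simp
  qed (use w h in \<open>auto simp: has_L2_weak_deriv_def L2_def\<close>)
qed

definition sobolev_const :: "nat \<Rightarrow> 'a::euclidean_space set \<Rightarrow> real" where
  "sobolev_const l S = sqrt (real (card (multi_indices l :: 'a multiset set)) * measure lebesgue S)"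

text \<open>Each multi-index adds at most \<open>A^2\<close> times the volume of \<open>S\<close> to
  the squared norm, which explains \<open>sobolev_const\<close>. In this way pointwise bounds become
  Sobolev bounds, both for test functions in the dual norm and for the smooth replacement of
  \<open>\<mu> g\<close>.\<close>

lemma sobolev_smooth_bounded:
  fixes S :: "'a::euclidean_space set"
  assumes S: "open S" "bounded S" and f: "smooth_on S f"
    and bd: "\<And>vs x. set vs \<subseteq> Basis \<Longrightarrow> length vs \<le> l \<Longrightarrow> x \<in> S \<Longrightarrow> cmod (iter_deriv vs f x) \<le> A"
    and A: "A \<ge> 0"
  shows "f \<in> sobolev l S" "sobolev_norm l S f \<le> sobolev_const l S * A"
proof -
  let ?D = "\<lambda>\<alpha>. iter_deriv (rev (multi_index_list \<alpha>)) f"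
  have D: "cmod (?D \<alpha> x) \<le> A" if "\<alpha> \<in> multi_indices l" "x \<in> S" for \<alpha> x
    using multi_index_list_props[OF that(1)] that(2) by (intro bd) auto
  note m = smooth_on_borel_measurable[OF S(1) smooth_on_iter_deriv[OF f]]
  have w: "has_L2_weak_deriv S \<alpha> f (?D \<alpha>)" if "\<alpha> \<in> multi_indices l" for \<alpha>
    using D[OF that] by (intro has_L2_weak_deriv_smooth S f L2_bounded(1)[OF S m])
  have "f \<in> L2 S"
    using bd[of "[]"] by (intro L2_bounded(1)[OF S smooth_on_borel_measurable[OF S(1) f]]) auto
  then show "f \<in> sobolev l S"
    using w by (auto simp: sobolev_def)
  have "(\<Sum>\<alpha>\<in>multi_indices l. LINT x|lebesgue_on S. (cmod (weak_deriv S \<alpha> f x))\<^sup>2) =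
      (\<Sum>\<alpha>\<in>multi_indices l. LINT x|lebesgue_on S. (cmod (?D \<alpha> x))\<^sup>2)"
    using w by (intro sum.cong refl weak_deriv_norm[OF S]) auto
  also have "\<dots> \<le> (\<Sum>\<alpha>\<in>(multi_indices l :: 'a multiset set). A\<^sup>2 * measure lebesgue S)"
    using D by (intro sum_mono L2_bounded(2)[OF S m])
  finally have "sobolev_norm l S f \<le>
      sqrt (real (card (multi_indices l :: 'a multiset set)) * (A\<^sup>2 * measure lebesgue S))"
    by (simp add: sobolev_norm_def)
  also have "\<dots> = sobolev_const l S * A"
    using A by (simp add: sobolev_const_def real_sqrt_mult mult.commute mult.left_commute)
  finally show "sobolev_norm l S f \<le> sobolev_const l S * A" .
qed

text \<open>A function is its own weak derivative for the empty multi-index, so its squared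
  \<open>L2\<close> norm is one of the summands.\<close>

lemma L2_norm_le_sobolev_norm:
  fixes S :: "'a::euclidean_space set"
  assumes S: "open S" "bounded S" and f: "f \<in> sobolev l S"
  shows "(LINT x|lebesgue_on S. (cmod (f x))\<^sup>2) \<le> (sobolev_norm l S f)\<^sup>2"
proof -
  have e: "({#} :: 'a multiset) \<in> multi_indices l" by (simp add: multi_indices_def)
  have n: "multi_index_list {#} = []"
    by (metis mset_multi_index_list mset_zero_iff)
  have "has_L2_weak_deriv S {#} f f"
    using f by (simp add: has_L2_weak_deriv_def sobolev_def partial_deriv_eq n)
  then have "(LINT x|lebesgue_on S. (cmod (f x))\<^sup>2) = (LINT x|lebesgue_on S. (cmod (weak_deriv S {#} f x))\<^sup>2)"
    by (simp add: weak_deriv_norm[OF S])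
  also have "\<dots> \<le> (\<Sum>\<alpha>\<in>multi_indices l. LINT x|lebesgue_on S. (cmod (weak_deriv S \<alpha> f x))\<^sup>2)"
    using e by (intro member_le_sum finite_multi_indices) auto
  also have "\<dots> = (sobolev_norm l S f)\<^sup>2"
    unfolding sobolev_norm_def by (simp add: sum_nonneg)
  finally show ?thesis .
qed

section \<open>The negative norm and pairings with test functions\<close>

lemma neg_sobolev_norm_upper:
  fixes S :: "'a::euclidean_space set"
  assumes S: "open S" "bounded S" and \<mu>: "\<mu> \<in> L2 S"
    and g: "g \<in> sobolev0 k S" "sobolev_norm k S g \<le> 1"
  shows "cmod (l2_inner S \<mu> g) \<le> neg_sobolev_norm k S \<mu>"
  unfolding neg_sobolev_norm_def
proof (rule cSUP_upper)
  \<comment> \<open>A real supremum dominates its members only when the set is bounded above. The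
    bound found here may depend on \<open>\<mu>\<close> in any way; half of the squared
    \<open>L2\<close> norm plus one half will do.\<close>
  show "bdd_above ((\<lambda>g. cmod (l2_inner S \<mu> g)) ` {g \<in> sobolev0 k S. sobolev_norm k S g \<le> 1})"
  proof (rule bdd_aboveI2)
    fix g assume "g \<in> {g \<in> sobolev0 k S. sobolev_norm k S g \<le> 1}"
    then have g: "g \<in> sobolev k S" "sobolev_norm k S g \<le> 1"
      by (auto simp: sobolev0_def)
    then have "g \<in> L2 S" by (simp add: sobolev_def)
    from L2_mult_integrable(2)[OF \<mu> L2_cnj[OF this]]
    have "cmod (l2_inner S \<mu> g) \<le>
        ((LINT x|lebesgue_on S. (cmod (\<mu> x))\<^sup>2) + (LINT x|lebesgue_on S. (cmod (g x))\<^sup>2)) / 2"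
      by (simp add: l2_inner_def)
    also have "(LINT x|lebesgue_on S. (cmod (g x))\<^sup>2) \<le> (sobolev_norm k S g)\<^sup>2"
      by (rule L2_norm_le_sobolev_norm[OF S g(1)])
    also have "\<dots> \<le> 1"
      using g(2) by (simp add: abs_square_le_1 sobolev_norm_def sum_nonneg)
    finally show "cmod (l2_inner S \<mu> g) \<le> ((LINT x|lebesgue_on S. (cmod (\<mu> x))\<^sup>2) + 1) / 2"
      by simp
  qed
qed (use g in auto)

lemma sobolev_zero: "open S \<Longrightarrow> bounded S \<Longrightarrow> (\<lambda>x. 0) \<in> sobolev l S \<and> sobolev_norm l S (\<lambda>x. 0) = 0"
  using sobolev_smooth_bounded[of S "\<lambda>x. 0" l 0]
  by (auto simp: iter_deriv_zero sobolev_norm_def sum_nonneg intro: antisym)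

lemma test_functions_zero: "(\<lambda>x. 0) \<in> test_functions S"
  by (rule test_functionsI[of _ "{}"]) auto

lemma neg_sobolev_norm_nonneg:
  assumes "open S" "bounded S" "\<mu> \<in> L2 S"
  shows "0 \<le> neg_sobolev_norm k S \<mu>"
proof -
  have "(\<lambda>x. 0) \<in> sobolev0 k S"
    using sobolev_zero[OF assms(1,2), of k] test_functions_zero[of S]
    by (auto simp: sobolev0_def intro!: bexI[of _ "\<lambda>x. 0"])
  from neg_sobolev_norm_upper[OF assms this] show ?thesis
    using sobolev_zero[OF assms(1,2), of k] by (simp add: l2_inner_def)
qed

text \<open>A multiple of the conjugate of \<open>\<phi>\<close> lies in the unit ball of
  \<open>sobolev0 k S\<close> and is thus admissible in the supremum; the bound \<open>A\<close> on
  derivatives up to order \<open>k\<close> determines how small the multiple has to be.\<close>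

lemma neg_sobolev_norm_pairing:
  fixes S :: "'a::euclidean_space set"
  assumes S: "open S" "bounded S" and \<mu>: "\<mu> \<in> L2 S" and \<phi>: "\<phi> \<in> test_functions S"
    and bd: "\<And>vs x. set vs \<subseteq> Basis \<Longrightarrow> length vs \<le> k \<Longrightarrow> x \<in> S \<Longrightarrow> cmod (iter_deriv vs \<phi> x) \<le> A"
    and A: "A > 0"
  shows "cmod (LINT x|lebesgue_on S. \<mu> x * \<phi> x) \<le> (1 + sobolev_const k S) * A * neg_sobolev_norm k S \<mu>"
proof -
  obtain K where K: "smooth_on UNIV \<phi>" "compact K" "K \<subseteq> S" "\<And>x. x \<notin> K \<Longrightarrow> \<phi> x = 0"
    using \<phi> by (rule test_functionsE) blast
  have C: "sobolev_const k S \<ge> 0" by (simp add: sobolev_const_def)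
  \<comment> \<open>The \<open>1 +\<close> keeps the divisor positive even if
    \<open>sobolev_const\<close> vanishes. The conjugation in \<open>\<psi>\<close> below cancels
    the one in the second argument of \<open>l2_inner\<close>.\<close>
  define c where "c = 1 / ((1 + sobolev_const k S) * A)"
  have c: "c > 0" using C A by (simp add: c_def add_pos_nonneg)
  define \<psi> where "\<psi> x = c *\<^sub>R cnj (\<phi> x)" for x
  have L: "bounded_linear (\<lambda>z. c *\<^sub>R cnj z)"
    by (intro bounded_linear_compose[OF bounded_linear_scaleR_right] bounded_linear_cnj)
  have s\<psi>: "smooth_on UNIV \<psi>"
    unfolding \<psi>_def by (rule smooth_on_bounded_linear[OF open_UNIV L K(1)])
  have t\<psi>: "\<psi> \<in> test_functions S"
    using K by (intro test_functionsI[OF s\<psi> K(2,3)]) (simp add: \<psi>_def)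
  have bd\<psi>: "cmod (iter_deriv vs \<psi> x) \<le> 1 / (1 + sobolev_const k S)"
    if "set vs \<subseteq> Basis" "length vs \<le> k" "x \<in> S" for vs x
  proof -
    have "cmod (iter_deriv vs \<psi> x) = c * cmod (iter_deriv vs \<phi> x)"
      unfolding \<psi>_def using c by (simp add: iter_deriv_bounded_linear[OF open_UNIV L K(1)])
    also have "\<dots> \<le> c * A" using bd[OF that] c by simp
    also have "\<dots> = 1 / (1 + sobolev_const k S)" using A by (simp add: c_def)
    finally show ?thesis .
  qed
  have p: "0 \<le> 1 / (1 + sobolev_const k S)" using C by simp
  have sob: "\<psi> \<in> sobolev k S" "sobolev_norm k S \<psi> \<le> sobolev_const k S * (1 / (1 + sobolev_const k S))"
    by (rule sobolev_smooth_bounded[OF S smooth_on_subset[OF s\<psi> subset_UNIV] bd\<psi> p]; assumption)+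
  have "\<psi> \<in> sobolev0 k S"
    using sob(1) t\<psi> sobolev_zero[OF S, of k] by (auto simp: sobolev0_def intro!: bexI[of _ \<psi>])
  moreover have "sobolev_norm k S \<psi> \<le> 1"
    by (rule order_trans[OF sob(2)]) (use C in \<open>simp add: field_simps\<close>)
  ultimately have "cmod (l2_inner S \<mu> \<psi>) \<le> neg_sobolev_norm k S \<mu>"
    by (rule neg_sobolev_norm_upper[OF S \<mu>])
  also have "l2_inner S \<mu> \<psi> = c *\<^sub>R (LINT x|lebesgue_on S. \<mu> x * \<phi> x)"
    by (simp add: l2_inner_def \<psi>_def)
  finally have "c * cmod (LINT x|lebesgue_on S. \<mu> x * \<phi> x) \<le> neg_sobolev_norm k S \<mu>"
    using c by simp
  then show ?thesis
    using C A by (simp add: c_def field_simps add_pos_nonneg)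
qed

section \<open>Interior estimates for conjugate holomorphic functions\<close>

lemma norm_vector_scalar_complex: "norm (c *s (v :: complex ^ 'n)) = cmod c * norm v"
  by (simp add: norm_vec_def norm_mult L2_set_right_distrib)

lemma bounded_linear_vector_scalar_left: "bounded_linear (\<lambda>c. c *s (v :: complex ^ 'n))"
  by (rule bounded_linear_intro[of _ "norm v"])
    (auto simp: vec_eq_iff algebra_simps norm_vector_scalar_complex)

lemma bounded_linear_vector_scalar_right: "bounded_linear (\<lambda>v :: complex ^ 'n. c *s v)"
  by (rule bounded_linear_intro[of _ "cmod c"])
    (auto simp: vec_eq_iff algebra_simps norm_vector_scalar_complex)

lemma inner_i_self: "(\<i> *s v) \<bullet> (v :: complex ^ 'n) = 0"
  by (simp add: inner_vec_def inner_complex_def mult.commute)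

lemma holomorphic_on_Cn_dir_deriv:
  assumes "holomorphic_on_Cn h S" "z \<in> S"
  shows "(h has_derivative (\<lambda>w. dir_deriv w h z)) (at z)" "dir_deriv (c *s w) h z = c * dir_deriv w h z"
proof -
  obtain D where D: "(h has_derivative D) (at z)" "\<And>c v. D (c *s v) = c * D v"
    using assms unfolding holomorphic_on_Cn_def by blast
  show "(h has_derivative (\<lambda>w. dir_deriv w h z)) (at z)"
    using D(1) differentiable_has_dir_deriv unfolding differentiable_def by blast
  show "dir_deriv (c *s w) h z = c * dir_deriv w h z"
    using D by (simp add: dir_deriv_eq)
qed

text \<open>On the complex line through \<open>x\<close> in direction \<open>w\<close> the function
  is holomorphic in one variable, and Cauchy's inequality applies. The result is a bound on the
  derivative near \<open>z\<close>, as required for integrating derivatives of holomorphic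
  functions.\<close>

lemma holomorphic_deriv_bound:
  fixes h :: "complex ^ 'n \<Rightarrow> complex"
  assumes h: "holomorphic_on_Cn h S" and S: "cball z r \<subseteq> S" and r: "r > 0"
  obtains B where "B \<ge> 0" "\<And>x w. x \<in> cball z (r / 2) \<Longrightarrow> cmod (dir_deriv w h x) \<le> B * norm w"
proof -
  have "continuous_on (cball z r) h"
    using holomorphic_on_Cn_dir_deriv(1)[OF h] S
    by (meson continuous_at_imp_continuous_on has_derivative_continuous subset_iff)
  then have "bounded (h ` cball z r)"
    by (intro compact_imp_bounded compact_continuous_image compact_cball)
  then obtain M where M: "M > 0" "\<And>x. x \<in> cball z r \<Longrightarrow> cmod (h x) \<le> M"
    unfolding bounded_pos by blast
  show ?thesis
  proof (rule that[of "2 * M / r"])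
    fix x w assume x: "x \<in> cball z (r / 2)"
    show "cmod (dir_deriv w h x) \<le> 2 * M / r * norm w"
    proof (cases "w = 0")
      case True
      have "x \<in> S" using x S r by auto
      from holomorphic_on_Cn_dir_deriv(2)[OF h this, of 0 0] True show ?thesis by simp
    next
      case False
      \<comment> \<open>The length \<open>r / 2\<close> measured in units of \<open>w\<close>: a
        disc of this radius about a point of the half ball stays in
        \<open>cball z r\<close>.\<close>
      define \<rho> where "\<rho> = r / 2 / norm w"
      have \<rho>: "\<rho> > 0" using r False by (simp add: \<rho>_def)
      have inb: "x + c *s w \<in> cball z r" if "cmod c \<le> \<rho>" for c
      proof -
        have "norm (c *s w) \<le> r / 2"
          using that False by (simp add: norm_vector_scalar_complex \<rho>_def field_simps)
        moreover have "dist z (x + c *s w) \<le> dist z x + norm (c *s w)"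
          using dist_triangle[of z "x + c *s w" x] by (simp add: dist_norm)
        ultimately show ?thesis using x by simp
      qed
      define f where "f c = h (x + c *s w)" for c
      have df: "(f has_field_derivative dir_deriv w h (x + c *s w)) (at c)" if "cmod c \<le> \<rho>" for c
      proof -
        have "x + c *s w \<in> S" using inb[OF that] S by blast
        note hd = holomorphic_on_Cn_dir_deriv[OF h this]
        have "((\<lambda>c. x + c *s w) has_derivative (\<lambda>d. d *s w)) (at c)"
          by (rule has_derivative_add[OF has_derivative_const
              bounded_linear_imp_has_derivative[OF bounded_linear_vector_scalar_left], simplified])
        from has_derivative_compose[OF this hd(1)] show ?thesis
          unfolding f_def[abs_def] has_field_derivative_def hd(2)
          by (rule has_derivative_eq_rhs) (auto simp: mult.commute)
      qed
      have "norm ((deriv ^^ 1) f 0) \<le> fact 1 * M / \<rho> ^ 1"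
      proof (rule Cauchy_inequality[OF _ _ \<rho>])
        show "f holomorphic_on ball 0 \<rho>"
          unfolding holomorphic_on_def field_differentiable_def
        proof
          fix c :: complex assume "c \<in> ball 0 \<rho>"
          then have "(f has_field_derivative dir_deriv w h (x + c *s w)) (at c within ball 0 \<rho>)"
            by (intro has_field_derivative_at_within[OF df]) auto
          then show "\<exists>f'. (f has_field_derivative f') (at c within ball 0 \<rho>)" ..
        qed
        show "continuous_on (cball 0 \<rho>) f"
          using df by (intro continuous_at_imp_continuous_on ballI DERIV_isCont) auto
        show "norm (f c) \<le> M" if "norm (0 - c) = \<rho>" for c
          using inb[of c] M that by (simp add: f_def)
      qed
      moreover have "deriv f 0 = dir_deriv w h x"
        using DERIV_imp_deriv[OF df[of 0]] \<rho> by simp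
      ultimately show ?thesis
        by (simp add: \<rho>_def field_simps)
    qed
  qed (use M r in auto)
qed

text \<open>For each \<open>b\<close> the derivative in direction \<open>b\<close> of
  \<open>f x * ((\<i> *s x) \<bullet> b)\<close> has integral zero. Since
  \<open>(\<i> *s b) \<bullet> b = 0\<close>, the field has no divergence, and the sum over
  \<open>b\<close> is the derivative of \<open>f\<close> along the field.\<close>

lemma integral_derivative_rotation_zero:
  fixes f :: "complex ^ 'n \<Rightarrow> complex"
  assumes der: "\<And>x. (f has_derivative f' x) (at x)"
    and bd: "\<And>x w. cmod (f' x w) \<le> B * norm w"
    and supp: "\<And>x. norm x > R \<Longrightarrow> f x = 0"
  shows "integrable lborel (\<lambda>x. f' x (\<i> *s x))" "(LINT x|lborel. f' x (\<i> *s x)) = 0"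
proof -
  have cont: "continuous_on UNIV f"
    by (intro continuous_at_imp_continuous_on ballI has_derivative_continuous[OF der])
  obtain M where M: "M \<ge> 0" "\<And>x. cmod (f x) \<le> M"
    using continuous_compact_support_bounded[of "cball 0 R" f UNIV] continuous_on_subset[OF cont] supp
    by (metis Diff_iff UNIV_I compact_cball dist_0_norm mem_cball not_le top_greatest)
  have B: "B \<ge> 0"
  proof -
    obtain b :: "complex ^ 'n" where "b \<in> Basis" using nonempty_Basis by blast
    with bd[of 0 b] show ?thesis
      by (simp add: order_trans[OF norm_ge_zero])
  qed
  \<comment> \<open>The field grows linearly, so bounding its product with the derivative of
    \<open>f\<close> requires that this derivative vanish outside a ball.\<close>
  have f'0: "f' x w = 0" if "norm x > R" for x w
  proof -
    have "((\<lambda>x. 0) has_derivative f' x) (at x)"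
    proof (rule has_derivative_transform_within_open[OF der])
      show "open (- cball 0 R :: (complex ^ 'n) set)" by auto
    qed (use that supp in auto)
    then show ?thesis
      using has_derivative_unique[OF _ has_derivative_const] by metis
  qed
  define G where "G b x w = f' x w * ((\<i> *s x) \<bullet> b) + f x * ((\<i> *s w) \<bullet> b)" for b x w
  have dG: "((\<lambda>x. f x * of_real ((\<i> *s x) \<bullet> b)) has_derivative G b x) (at x)" for b x
  proof -
    have L: "bounded_linear (\<lambda>x. complex_of_real ((\<i> *s x) \<bullet> b))"
      by (intro bounded_linear_compose[OF bounded_linear_of_real]
          bounded_linear_compose[OF bounded_linear_inner_left] bounded_linear_vector_scalar_right)
    show ?thesis
      unfolding G_def
      using has_derivative_mult[OF der bounded_linear_imp_has_derivative[OF L]]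
      by (simp add: add.commute)
  qed
  have G_bd: "cmod (G b x w) \<le> (B * \<bar>R\<bar> + M) * norm w" if b: "b \<in> Basis" for b x w
  proof -
    have 1: "\<bar>(\<i> *s u) \<bullet> b\<bar> \<le> norm u" for u :: "complex ^ 'n"
      using Basis_le_norm[OF b, of "\<i> *s u"] by (simp add: norm_vector_scalar_complex)
    have "cmod (f' x w) * \<bar>(\<i> *s x) \<bullet> b\<bar> \<le> (B * norm w) * \<bar>R\<bar>"
    proof (cases "norm x > R")
      case True
      then show ?thesis using f'0 B by simp
    next
      case False
      then show ?thesis using 1[of x] bd[of x w] B by (intro mult_mono) auto
    qed
    moreover have "cmod (f x) * \<bar>(\<i> *s w) \<bullet> b\<bar> \<le> M * norm w"
      using 1[of w] M by (intro mult_mono) auto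
    ultimately show ?thesis
      unfolding G_def
      by (intro order_trans[OF norm_triangle_ineq]) (simp add: norm_mult algebra_simps)
  qed
  have I: "integrable lborel (\<lambda>x. G b x b)" "(LINT x|lborel. G b x b) = 0" if "b \<in> Basis" for b
    using integral_derivative_zero[OF dG G_bd[OF that], where v = b and R = R] supp by auto
  have eq: "(\<Sum>b\<in>Basis. G b x b) = f' x (\<i> *s x)" for x
  proof -
    have lin: "linear (f' x)" using der has_derivative_linear by blast
    have "(\<Sum>b\<in>Basis. G b x b) = (\<Sum>b\<in>Basis. ((\<i> *s x) \<bullet> b) *\<^sub>R f' x b)"
      by (simp add: G_def inner_i_self scaleR_conv_of_real mult.commute)
    also have "\<dots> = f' x (\<Sum>b\<in>Basis. ((\<i> *s x) \<bullet> b) *\<^sub>R b)"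
      by (simp add: linear_sum[OF lin] linear_cmul[OF lin])
    finally show ?thesis by (simp add: euclidean_representation)
  qed
  show "integrable lborel (\<lambda>x. f' x (\<i> *s x))" "(LINT x|lborel. f' x (\<i> *s x)) = 0"
    unfolding eq[symmetric] using I by (auto simp: Bochner_Integration.integral_sum)
qed


text \<open>A bump centred at the origin depends on \<open>x\<close> only through
  \<open>x \<bullet> x\<close>, whose derivative along \<open>\<i> *s x\<close> is
  \<open>2 * (x \<bullet> (\<i> *s x)) = 0\<close>.\<close>

lemma dir_deriv_bump_rotation: "dir_deriv (\<i> *s x) (bump 0 e) (x :: complex ^ 'n) = 0"
proof -
  define c where "c = 4 / (3 * e\<^sup>2)"
  let ?q = "\<lambda>y :: complex ^ 'n. c * ((y - 0) \<bullet> (y - 0)) - 1 / 3"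
  have q: "(?q has_derivative (\<lambda>w. c * (x \<bullet> w + w \<bullet> x))) (at x)"
    by (auto intro!: derivative_eq_intros)
  have "smooth_step differentiable (at (?q x))"
    by (rule smooth_on_differentiable[OF smooth_on_smooth_step]) simp
  then have "dir_deriv (\<i> *s x) (\<lambda>y. smooth_step (?q y)) x =
      dir_deriv 1 smooth_step (?q x) * dir_deriv (\<i> *s x) ?q x"
    using q by (intro dir_deriv_compose_real) (auto simp: differentiable_def)
  also have "dir_deriv (\<i> *s x) ?q x = 0"
    unfolding dir_deriv_eq[OF q] by (simp add: inner_i_self inner_commute[of x])
  finally show ?thesis
    by (simp add: bump_def[abs_def] c_def)
qed

lemma bump_compact_support: "e > 0 \<Longrightarrow> x \<notin> cball p e \<Longrightarrow> bump p e x = 0"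
  by (rule bump_eq_0) auto

text \<open>\<open>t \<mapsto> \<integral> \<beta>(x) h(z + t x) dx\<close> is constant for a radial bump \<open>\<beta>\<close>: up to the factor \<open>\<i> t\<close> its derivative
  is the integral of the derivative of \<open>\<beta>(x) h(z + t x)\<close> along the rotation field \<open>\<i> x\<close>, which is
  divergence free and annihilates \<open>\<beta>\<close>.\<close>

lemma bump_mean_value:
  fixes h :: "complex ^ 'n \<Rightarrow> complex"
  assumes h: "holomorphic_on_Cn h S" and S: "cball z r \<subseteq> S" and r: "r > 0" and e: "0 < e" "e \<le> r / 2"
  shows "continuous_on UNIV (\<lambda>x. of_real (bump 0 e x) * h (z + x))"
    "(LINT x|lborel. of_real (bump 0 e x) * h (z + x)) = h z * of_real (LINT x|lborel. bump 0 e (x :: complex ^ 'n))"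
proof -
  define \<beta> :: "complex ^ 'n \<Rightarrow> real" where "\<beta> = bump 0 e"
  have \<beta>0: "\<beta> x = 0" if "x \<notin> cball 0 e" for x
    unfolding \<beta>_def using bump_compact_support[OF e(1) that] .
  have \<beta>1: "\<bar>\<beta> x\<bar> \<le> 1" for x
    using bump_nonneg[of 0 e x] bump_le_1[of 0 e x] by (simp add: \<beta>_def)
  have s\<beta>: "smooth_on UNIV \<beta>" unfolding \<beta>_def by (rule smooth_on_bump)
  obtain Q where Q: "Q \<ge> 0" "\<And>x w. norm (dir_deriv w \<beta> x) \<le> Q * norm w"
    using smooth_compact_support_deriv_bound[OF s\<beta> compact_cball \<beta>0] by blast
  have d\<beta>: "(\<beta> has_derivative (\<lambda>w. dir_deriv w \<beta> x)) (at x)" for x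
    using differentiable_has_dir_deriv[OF smooth_on_differentiable[OF s\<beta>]] by blast
  have d\<beta>0: "dir_deriv w \<beta> x = 0" if "x \<notin> cball 0 e" for x w
    using \<beta>0 that by (rule dir_deriv_zero_off[OF closed_cball])
  obtain B where B: "B \<ge> 0" "\<And>x w. x \<in> cball z (r / 2) \<Longrightarrow> cmod (dir_deriv w h x) \<le> B * norm w"
    using holomorphic_deriv_bound[OF h S r] by blast
  have dh: "(h has_derivative (\<lambda>w. dir_deriv w h x)) (at x)" if "x \<in> cball z r" for x
    using holomorphic_on_Cn_dir_deriv(1)[OF h] S that by blast
  have lip: "cmod (h y - h x) \<le> B * norm (y - x)" if "x \<in> cball z (r / 2)" "y \<in> cball z (r / 2)" for x y
  proof (rule differentiable_bound[OF convex_cball _ _ that(2) that(1)])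
    show "(h has_derivative (\<lambda>w. dir_deriv w h x)) (at x within cball z (r / 2))"
      if "x \<in> cball z (r / 2)" for x
      using dh[of x] that r by (auto intro: has_derivative_at_withinI)
    show "onorm (\<lambda>w. dir_deriv w h x) \<le> B" if "x \<in> cball z (r / 2)" for x
      using B(2)[OF that] by (rule onorm_le)
  qed
  define M where "M = cmod (h z) + B * r"
  have M: "cmod (h x) \<le> M" if "x \<in> cball z (r / 2)" for x
  proof -
    have "cmod (h x) \<le> cmod (h z) + cmod (h x - h z)"
      using norm_triangle_ineq[of "h z" "h x - h z"] by simp
    also have "cmod (h x - h z) \<le> B * norm (x - z)"
      using lip[of z x] that r by simp
    also have "\<dots> \<le> B * r"
      using that B(1) r by (intro mult_left_mono) (auto simp: dist_norm norm_minus_commute)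
    finally show ?thesis by (simp add: M_def)
  qed
  have inb: "z + t *\<^sub>R x \<in> cball z (r / 2)" if "t \<in> {0..1}" "norm x \<le> e" for t x
  proof -
    have "\<bar>t\<bar> * norm x \<le> 1 * norm x" using that by (intro mult_right_mono) auto
    then show ?thesis using that e by (simp add: dist_norm)
  qed
  define f where "f t x = of_real (\<beta> x) * h (z + t *\<^sub>R x)" for t x
  define f' where "f' t x w = of_real (dir_deriv w \<beta> x) * h (z + t *\<^sub>R x)
    + of_real (\<beta> x) * dir_deriv (t *\<^sub>R w) h (z + t *\<^sub>R x)" for t x w
  have f0: "f t x = 0" if "norm x > e" for t x
    using \<beta>0[of x] that by (simp add: f_def)
  have df: "(f t has_derivative f' t x) (at x)" if t: "t \<in> {0..1}" for t x
  proof (cases "norm x < r")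
    case True
    have "\<bar>t\<bar> * norm x \<le> 1 * norm x" using t by (intro mult_right_mono) auto
    then have "z + t *\<^sub>R x \<in> cball z r" using True by (simp add: dist_norm)
    note H = dh[OF this]
    have "((\<lambda>x. z + t *\<^sub>R x) has_derivative (\<lambda>w. t *\<^sub>R w)) (at x)"
      by (auto intro!: derivative_eq_intros)
    note H2 = has_derivative_compose[OF this H]
    have "((\<lambda>x. complex_of_real (\<beta> x)) has_derivative (\<lambda>w. of_real (dir_deriv w \<beta> x))) (at x)"
      by (rule bounded_linear.has_derivative[OF bounded_linear_of_real d\<beta>])
    from has_derivative_mult[OF this H2] show ?thesis
      unfolding f_def[abs_def] f'_def[abs_def] by (simp add: add.commute)
  next
    case False
    then have x: "x \<in> - cball 0 e" using e by auto
    have "((\<lambda>x. 0) has_derivative f' t x) (at x)"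
      unfolding f'_def[abs_def] using x d\<beta>0 \<beta>0 by simp
    then show ?thesis
      by (rule has_derivative_transform_within_open[OF _ _ x]) (use f0 in auto)
  qed
  have f'bd: "cmod (f' t x w) \<le> (Q * M + B) * norm w" if t: "t \<in> {0..1}" for t x w
  proof (cases "norm x \<le> e")
    case True
    note i = inb[OF t True]
    have "\<bar>dir_deriv w \<beta> x\<bar> * cmod (h (z + t *\<^sub>R x)) \<le> (Q * norm w) * M"
      using Q M[OF i] by (intro mult_mono) auto
    moreover have "\<bar>\<beta> x\<bar> * cmod (dir_deriv (t *\<^sub>R w) h (z + t *\<^sub>R x)) \<le> 1 * (B * norm w)"
    proof (rule mult_mono)
      have "cmod (dir_deriv (t *\<^sub>R w) h (z + t *\<^sub>R x)) \<le> B * (\<bar>t\<bar> * norm w)"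
        using B(2)[OF i] by (metis norm_scaleR)
      also have "\<dots> \<le> B * (1 * norm w)"
        using t B(1) by (intro mult_left_mono mult_right_mono) auto
      finally show "cmod (dir_deriv (t *\<^sub>R w) h (z + t *\<^sub>R x)) \<le> B * norm w" by simp
    qed (use \<beta>1 in auto)
    ultimately show ?thesis
      unfolding f'_def by (intro order_trans[OF norm_triangle_ineq]) (simp add: norm_mult algebra_simps)
  next
    case False
    have "M \<ge> 0" using B r by (simp add: M_def)
    then show ?thesis
      using False d\<beta>0[of x] \<beta>0[of x] Q B by (simp add: f'_def)
  qed
  have cont: "continuous_on UNIV (f t)" if "t \<in> {0..1}" for t
    by (intro continuous_at_imp_continuous_on ballI has_derivative_continuous[OF df[OF that]])
  from cont[of 1] show "continuous_on UNIV (\<lambda>x. of_real (bump 0 e x) * h (z + x))"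
    by (simp add: f_def[abs_def] \<beta>_def)
  have intf: "integrable lborel (f t)" if "t \<in> {0..1}" for t
  proof -
    have "integrable lborel (\<lambda>x. indicator (cball 0 e) x *\<^sub>R f t x)"
      using cont[OF that] by (intro borel_integrable_compact) (auto intro: continuous_on_subset)
    moreover have "indicator (cball 0 e) x *\<^sub>R f t x = f t x" for x
      using f0[of x] by (auto simp: indicator_def)
    ultimately show ?thesis by simp
  qed
  \<comment> \<open>This is the derivative of \<open>f t x\<close> in \<open>t\<close>. By complex
    linearity the rotational derivative of \<open>f t\<close> at \<open>x\<close> is
    \<open>\<i> * t\<close> times it.\<close>
  define d where "d t x = of_real (\<beta> x) * dir_deriv x h (z + t *\<^sub>R x)" for t x
  have hc: "dir_deriv (c *s w) h y = c * dir_deriv w h y" if "y \<in> cball z r" for c w y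
    using holomorphic_on_Cn_dir_deriv(2)[OF h] S that by blast
  have zball: "z + t *\<^sub>R x \<in> cball z r" if "t \<in> {0..1}" "norm x \<le> e" for t x
    using inb[OF that] r by auto
  have rot: "f' t x (\<i> *s x) = \<i> * of_real t * d t x" if t: "t \<in> {0..1}" for t x
  proof (cases "norm x \<le> e")
    case True
    have "t *\<^sub>R (\<i> *s x) = (\<i> * complex_of_real t) *s x"
      unfolding vec_eq_iff by (auto simp: scaleR_conv_of_real[where 'a = complex])
    then show ?thesis
      using hc[OF zball[OF t True]] by (simp add: f'_def d_def dir_deriv_bump_rotation \<beta>_def)
  next
    case False
    then show ?thesis
      using \<beta>0[of x] d\<beta>0[of x] by (simp add: f'_def d_def)
  qed
  \<comment> \<open>Dividing by \<open>\<i> * t\<close> excludes \<open>t = 0\<close>, which becomes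
    the single exceptional point of the interval at the end.\<close>
  have d_int: "integrable lborel (d t)" "(LINT x|lborel. d t x) = 0" if t: "t \<in> {0..1}" "t \<noteq> 0" for t
  proof -
    note R = integral_derivative_rotation_zero[OF df[OF t(1)] f'bd[OF t(1)] f0, unfolded rot[OF t(1)]]
    have i: "inverse (\<i> * of_real t) * (\<i> * of_real t * d t x) = d t x" for x
      using t by (simp add: field_simps)
    from integrable_mult_right[OF R(1), of "inverse (\<i> * of_real t)"] show "integrable lborel (d t)"
      unfolding i by simp
    from R(2) show "(LINT x|lborel. d t x) = 0"
      using t by simp
  qed
  have d_meas: "d t \<in> borel_measurable borel" if t: "t \<in> {0..1}" for t
  proof (cases "t = 0")
    case True
    have "bounded_linear (\<lambda>w. dir_deriv w h z)"
      using dh[of z] r has_derivative_bounded_linear by simp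
    then have "continuous_on UNIV (\<lambda>x. dir_deriv x h z)"
      by (rule linear_continuous_on)
    then have "continuous_on UNIV (d t)"
      unfolding d_def[abs_def] True using smooth_on_continuous[OF s\<beta>]
      by (auto intro!: continuous_intros)
    then show ?thesis by (rule borel_measurable_continuous_onI)
  next
    case False
    then show ?thesis using borel_measurable_integrable[OF d_int(1)[OF t]] by simp
  qed
  have dbd: "cmod (d t x) \<le> indicator (cball 0 e) x *\<^sub>R (B * e)" if t: "t \<in> {0..1}" for t x
  proof (cases "norm x \<le> e")
    case True
    have "\<bar>\<beta> x\<bar> * cmod (dir_deriv x h (z + t *\<^sub>R x)) \<le> 1 * (B * norm x)"
      using \<beta>1 B(2)[OF inb[OF t True]] by (intro mult_mono) auto
    also have "\<dots> \<le> B * e" using True B by (simp add: mult_left_mono)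
    finally show ?thesis using True by (simp add: d_def norm_mult)
  qed (use \<beta>0[of x] in \<open>simp add: d_def\<close>)
  have flip: "cmod (f s x - f t x) \<le> \<bar>s - t\<bar> * (indicator (cball 0 e) x *\<^sub>R (B * e))"
    if t: "s \<in> {0..1}" "t \<in> {0..1}" for s t x
  proof (cases "norm x \<le> e")
    case True
    have "cmod (f s x - f t x) = \<bar>\<beta> x\<bar> * cmod (h (z + s *\<^sub>R x) - h (z + t *\<^sub>R x))"
      by (simp add: f_def norm_mult flip: right_diff_distrib)
    also have "\<dots> \<le> 1 * (B * norm ((z + s *\<^sub>R x) - (z + t *\<^sub>R x)))"
      using \<beta>1 lip[OF inb[OF t(2) True] inb[OF t(1) True]] by (intro mult_mono) auto
    also have "(z + s *\<^sub>R x) - (z + t *\<^sub>R x) = (s - t) *\<^sub>R x"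
      by (simp add: algebra_simps)
    also have "1 * (B * norm ((s - t) *\<^sub>R x)) \<le> \<bar>s - t\<bar> * (B * e)"
      using mult_left_mono[OF True, of "\<bar>s - t\<bar> * B"] B by (simp add: mult_ac)
    finally show ?thesis using True by simp
  qed (use f0[of x] in simp)
  define I where "I t = (LINT x|lborel. f t x)" for t
  have dom: "integrable lborel (\<lambda>x::complex ^ 'n. indicator (cball 0 e) x *\<^sub>R (2 * (B * e)))"
    by (rule borel_integrable_compact) auto
  have domd: "integrable lborel (\<lambda>x::complex ^ 'n. indicator (cball 0 e) x *\<^sub>R (B * e))"
    by (rule borel_integrable_compact) auto
  have d_int': "integrable lborel (d t)" if "t \<in> {0..1}" for t
  proof (rule Bochner_Integration.integrable_bound[OF domd])
    show "d t \<in> borel_measurable lborel" using d_meas[OF that] by simp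
    show "AE x in lborel. norm (d t x) \<le> norm (indicator (cball 0 e) x *\<^sub>R (B * e))"
      using dbd[OF that] B e by (intro AE_I2) (simp add: abs_mult)
  qed
  \<comment> \<open>Differentiation under the integral sign, tested along sequences. On the support
    of the bump the normalised remainders are dominated by \<open>2 * (B * e)\<close>: one
    \<open>B * e\<close> for the Lipschitz difference of \<open>f\<close>, one for
    \<open>d\<close>.\<close>
  have dI: "(I has_derivative (\<lambda>k. k *\<^sub>R (LINT x|lborel. d t x))) (at t within {0..1})" if t: "t \<in> {0..1}" for t
    unfolding has_derivative_within
  proof
    show "bounded_linear (\<lambda>k. k *\<^sub>R (LINT x|lborel. d t x))"
      by (rule bounded_linear_scaleR_left)
    show "((\<lambda>y. (1 / norm (y - t)) *\<^sub>R (I y - (I t + (y - t) *\<^sub>R (LINT x|lborel. d t x)))) \<longlongrightarrow> 0)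
        (at t within {0..1})"
      unfolding tendsto_at_iff_sequentially
    proof (intro allI impI)
      fix X :: "nat \<Rightarrow> real" assume X: "\<forall>i. X i \<in> {0..1} - {t}" "X \<longlonglongrightarrow> t"
      define q where "q n x = (1 / norm (X n - t)) *\<^sub>R (f (X n) x - (f t x + (X n - t) *\<^sub>R d t x))" for n x
      have Xn: "X n \<in> {0..1}" "X n \<noteq> t" for n using X(1) by auto
      have qI: "(LINT x|lborel. q n x) =
          (1 / norm (X n - t)) *\<^sub>R (I (X n) - (I t + (X n - t) *\<^sub>R (LINT x|lborel. d t x)))" for n
        unfolding q_def I_def using intf[OF Xn(1)] intf[OF t] d_int'[OF t] by simp
      have "(\<lambda>n. LINT x|lborel. q n x) \<longlonglongrightarrow> (LINT x::complex ^ 'n|lborel. (0 :: complex))"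
      proof (rule integral_dominated_convergence[where s = q, OF _ _ dom])
        show "q n \<in> borel_measurable lborel" for n
          unfolding q_def using intf[OF Xn(1)] intf[OF t] d_int'[OF t]
          by (intro borel_measurable_scaleR borel_measurable_diff borel_measurable_add) auto
        have "(\<lambda>n. q n x) \<longlonglongrightarrow> 0" for x
        proof (cases "norm x \<le> e")
          case True
          have "((\<lambda>t. z + t *\<^sub>R x) has_derivative (\<lambda>k. k *\<^sub>R x)) (at t within {0..1})"
            by (auto intro!: derivative_eq_intros)
          from has_derivative_compose[OF this dh[OF zball[OF t True]]]
          have "((\<lambda>t. f t x) has_derivative (\<lambda>k. of_real (\<beta> x) * dir_deriv (k *\<^sub>R x) h (z + t *\<^sub>R x)))
              (at t within {0..1})"
            unfolding f_def by (rule has_derivative_mult_right)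
          moreover have "dir_deriv (k *\<^sub>R x) h (z + t *\<^sub>R x) = k *\<^sub>R dir_deriv x h (z + t *\<^sub>R x)" for k
            using linear_cmul[OF has_derivative_linear[OF dh[OF zball[OF t True]]]] by simp
          ultimately have "((\<lambda>t. f t x) has_derivative (\<lambda>k. k *\<^sub>R d t x)) (at t within {0..1})"
            by (simp add: d_def)
          then have "((\<lambda>y. (1 / norm (y - t)) *\<^sub>R (f y x - (f t x + (y - t) *\<^sub>R d t x))) \<longlongrightarrow> 0) (at t within {0..1})"
            unfolding has_derivative_within by blast
          with X show ?thesis
            unfolding tendsto_at_iff_sequentially by (simp add: q_def[abs_def] comp_def)
        next
          case False
          then show ?thesis using f0[of x] \<beta>0[of x] by (simp add: q_def d_def)
        qed
        then show "AE x in lborel. (\<lambda>n. q n x) \<longlonglongrightarrow> 0" by simp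
        have "norm (q n x) \<le> indicator (cball 0 e) x *\<^sub>R (2 * (B * e))" for n x
        proof -
          have "cmod (f (X n) x - (f t x + (X n - t) *\<^sub>R d t x)) \<le>
              cmod (f (X n) x - f t x) + \<bar>X n - t\<bar> * cmod (d t x)"
            using norm_triangle_ineq4[of "f (X n) x - f t x" "(X n - t) *\<^sub>R d t x"]
            by (simp add: diff_diff_eq)
          also have "\<dots> \<le> \<bar>X n - t\<bar> * (indicator (cball 0 e) x *\<^sub>R (B * e)) +
              \<bar>X n - t\<bar> * (indicator (cball 0 e) x *\<^sub>R (B * e))"
            using flip[OF Xn(1) t] dbd[OF t] by (intro add_mono mult_left_mono) auto
          finally have "cmod (f (X n) x - (f t x + (X n - t) *\<^sub>R d t x)) \<le>
              \<bar>X n - t\<bar> * (indicator (cball 0 e) x *\<^sub>R (2 * (B * e)))"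
            by (simp add: algebra_simps)
          then show ?thesis
            using Xn(2)[of n] by (simp add: q_def divide_le_eq mult.commute)
        qed
        then show "AE x in lborel. norm (q n x) \<le> indicator (cball 0 e) x *\<^sub>R (2 * (B * e))" for n
          by simp
      qed simp
      then show "((\<lambda>y. (1 / norm (y - t)) *\<^sub>R (I y - (I t + (y - t) *\<^sub>R (LINT x|lborel. d t x)))) \<circ> X) \<longlonglongrightarrow> 0"
        unfolding qI by (simp add: comp_def)
    qed
  qed
  \<comment> \<open>\<open>I 1\<close> is the bump average of \<open>h\<close> about
    \<open>z\<close> before normalisation, and \<open>I 0\<close> is \<open>h z\<close> times the
    mass of the bump. Continuity bridges the exceptional parameter \<open>0\<close>.\<close>
  have "I 1 = I 0"
  proof (rule has_derivative_zero_unique_strong_interval[of "{0}" 0 1 I])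
    show "continuous_on {0..1} I"
      using dI has_derivative_continuous continuous_on_eq_continuous_within by blast
    show "(I has_derivative (\<lambda>h. 0)) (at t within {0..1})" if "t \<in> {0..1} - {0}" for t
      using dI[of t] d_int(2)[of t] that by simp
  qed auto
  then show "(LINT x|lborel. of_real (bump 0 e x) * h (z + x)) =
      h z * of_real (LINT x|lborel. bump 0 e (x :: complex ^ 'n))"
    by (simp add: I_def f_def \<beta>_def mult.commute)
qed


section \<open>Convolution of an integrable function with a reflected smooth kernel\<close>

definition translate_pairing ::
    "'a::euclidean_space set \<Rightarrow> ('a \<Rightarrow> complex) \<Rightarrow> ('a \<Rightarrow> complex) \<Rightarrow> 'a \<Rightarrow> complex" where
  "translate_pairing S f \<psi> z = (LINT x|lebesgue_on S. f x * \<psi> (x - z))"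

lemma translate_pairing_integrable:
  fixes \<psi> :: "'a::euclidean_space \<Rightarrow> complex"
  assumes f: "integrable (lebesgue_on S) f" and \<psi>: "smooth_on UNIV \<psi>"
    and K: "compact K" "\<And>x. x \<notin> K \<Longrightarrow> \<psi> x = 0"
  shows "integrable (lebesgue_on S) (\<lambda>x. f x * \<psi> (x - z))"
proof -
  have "continuous_on K \<psi>"
    using smooth_on_continuous[OF \<psi>] by (rule continuous_on_subset) simp
  then obtain B where B: "B \<ge> 0" "\<And>x. cmod (\<psi> x) \<le> B"
    using continuous_compact_support_bounded[of K \<psi> UNIV] K by (metis DiffD2 UNIV_I)
  have "continuous_on UNIV (\<lambda>x. \<psi> (x - z))"
    by (intro continuous_on_compose2[OF smooth_on_continuous[OF \<psi>]] continuous_intros) auto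
  then have m: "(\<lambda>x. \<psi> (x - z)) \<in> borel_measurable (lebesgue_on S)"
    using borel_measurable_continuous_onI
    by (intro measurable_restrict_space1 measurable_completion) (simp add: borel_measurable_continuous_onI)
  show ?thesis
  proof (rule Bochner_Integration.integrable_bound)
    show "integrable (lebesgue_on S) (\<lambda>x. of_real B * f x)" using f by simp
    show "(\<lambda>x. f x * \<psi> (x - z)) \<in> borel_measurable (lebesgue_on S)"
      by (intro borel_measurable_times m borel_measurable_integrable[OF f])
    show "AE x in lebesgue_on S. norm (f x * \<psi> (x - z)) \<le> norm (of_real B * f x)"
      using B by (intro AE_I2) (simp add: norm_mult mult.commute[of B] mult_left_mono)
  qed
qed

text \<open>The first partial derivatives are Lipschitz, because their own derivatives are
  continuous with compact support. The mean value inequality for \<open>\<psi>\<close> minus its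
  linear part at \<open>y\<close> then gives a quadratic remainder whose constant does not depend on
  \<open>y\<close>.\<close>

lemma smooth_second_order_bound:
  fixes \<psi> :: "'a::euclidean_space \<Rightarrow> complex"
  assumes \<psi>: "smooth_on UNIV \<psi>" and K: "compact K" "\<And>x. x \<notin> K \<Longrightarrow> \<psi> x = 0"
  obtains C where "C \<ge> 0" "\<And>y w. cmod (\<psi> (y - w) - \<psi> y + dir_deriv w \<psi> y) \<le> C * (norm w)\<^sup>2"
proof -
  have d\<psi>: "(\<psi> has_derivative (\<lambda>w. dir_deriv w \<psi> y)) (at y)" for y
    using differentiable_has_dir_deriv[OF smooth_on_differentiable[OF \<psi>]] by blast
  have lin: "linear (\<lambda>w. dir_deriv w \<psi> y)" for y
    using d\<psi> has_derivative_linear by blast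
  have "\<exists>C\<ge>0. \<forall>x y. cmod (dir_deriv b \<psi> y - dir_deriv b \<psi> x) \<le> C * norm (y - x)" for b
  proof -
    have s: "smooth_on UNIV (dir_deriv b \<psi>)" by (rule smooth_on_dir_deriv[OF \<psi>])
    have "dir_deriv b \<psi> x = 0" if "x \<notin> K" for x
      using K that by (intro dir_deriv_zero_off[of K]) (auto simp: compact_imp_closed)
    then obtain C where C: "C \<ge> 0" "\<And>x w. norm (dir_deriv w (dir_deriv b \<psi>) x) \<le> C * norm w"
      using smooth_compact_support_deriv_bound[OF s K(1)] by blast
    have "cmod (dir_deriv b \<psi> y - dir_deriv b \<psi> x) \<le> C * norm (y - x)" for x y
    proof (rule differentiable_bound[where S = UNIV])
      show "(dir_deriv b \<psi> has_derivative (\<lambda>w. dir_deriv w (dir_deriv b \<psi>) x)) (at x within UNIV)" for x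
        using differentiable_has_dir_deriv[OF smooth_on_differentiable[OF s]] by simp
      show "onorm (\<lambda>w. dir_deriv w (dir_deriv b \<psi>) x) \<le> C" for x
        using C(2) by (rule onorm_le)
    qed auto
    with C(1) show ?thesis by blast
  qed
  then obtain C where C: "\<And>b. C b \<ge> 0"
    "\<And>b x y. cmod (dir_deriv b \<psi> y - dir_deriv b \<psi> x) \<le> C b * norm (y - x)"
    by metis
  define C' where "C' = (\<Sum>b\<in>(Basis :: 'a set). C b)"
  have C'0: "C' \<ge> 0" using C(1) by (simp add: C'_def sum_nonneg)
  have dlip: "cmod (dir_deriv v \<psi> u - dir_deriv v \<psi> y) \<le> C' * norm (u - y) * norm v" for u v y
    using linear_Basis_bound[OF linear_compose_sub[OF lin[of u] lin[of y]] C(2), of v]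
    by (simp add: C'_def sum_distrib_right)
  have "cmod (\<psi> (y - w) - \<psi> y + dir_deriv w \<psi> y) \<le> C' * (norm w)\<^sup>2" for y w
  proof -
    define G where "G u = \<psi> u - dir_deriv u \<psi> y" for u
    have bl: "bounded_linear (\<lambda>u. dir_deriv u \<psi> y)"
      using d\<psi> has_derivative_bounded_linear by blast
    have "cmod (G (y - w) - G y) \<le> C' * norm w * norm (y - w - y)"
    proof (rule differentiable_bound[where S = "cball y (norm w)"])
      show "(G has_derivative (\<lambda>v. dir_deriv v \<psi> u - dir_deriv v \<psi> y)) (at u within cball y (norm w))" for u
        unfolding G_def
        by (rule has_derivative_at_withinI[OF has_derivative_diff[OF d\<psi> bounded_linear_imp_has_derivative[OF bl]]])
      show "onorm (\<lambda>v. dir_deriv v \<psi> u - dir_deriv v \<psi> y) \<le> C' * norm w"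
        if u: "u \<in> cball y (norm w)" for u
      proof (rule onorm_le)
        fix v :: 'a
        have "C' * norm (u - y) * norm v \<le> C' * norm w * norm v"
          using u C'0 by (intro mult_right_mono mult_left_mono) (auto simp: dist_norm norm_minus_commute)
        then show "cmod (dir_deriv v \<psi> u - dir_deriv v \<psi> y) \<le> C' * norm w * norm v"
          using dlip[of v u y] by linarith
      qed
    qed (auto simp: dist_norm)
    moreover have "G (y - w) - G y = \<psi> (y - w) - \<psi> y + dir_deriv w \<psi> y"
      using linear_diff[OF lin[of y], of y w] by (simp add: G_def)
    ultimately show ?thesis by (simp add: power2_eq_square mult.assoc)
  qed
  with C'0 show ?thesis by (rule that)
qed

text \<open>The remainder of \<open>\<psi>\<close> is quadratic uniformly in the base point, so
  integrating it against \<open>cmod (f x)\<close> bounds the remainder of the pairing by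
  \<open>M * C * (norm (y - z))^2\<close>; no limit is taken under the integral.\<close>

lemma translate_pairing_has_derivative:
  assumes f: "integrable (lebesgue_on S) f" and \<psi>: "smooth_on UNIV \<psi>"
    and K: "compact K" "\<And>x. x \<notin> K \<Longrightarrow> \<psi> x = 0"
  shows "(translate_pairing S f \<psi> has_derivative (\<lambda>w. - translate_pairing S f (dir_deriv w \<psi>) z)) (at z)"
proof -
  obtain C where C: "C \<ge> 0" "\<And>y w. cmod (\<psi> (y - w) - \<psi> y + dir_deriv w \<psi> y) \<le> C * (norm w)\<^sup>2"
    using smooth_second_order_bound[OF \<psi> K] by blast
  have s: "smooth_on UNIV (dir_deriv w \<psi>)" for w by (rule smooth_on_dir_deriv[OF \<psi>])
  have s0: "dir_deriv w \<psi> x = 0" if "x \<notin> K" for x w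
    using K that by (intro dir_deriv_zero_off[of K]) (auto simp: compact_imp_closed)
  have i1: "integrable (lebesgue_on S) (\<lambda>x. f x * \<psi> (x - z))" for z
    by (rule translate_pairing_integrable[OF f \<psi> K])
  have i2: "integrable (lebesgue_on S) (\<lambda>x. f x * dir_deriv w \<psi> (x - z))" for w z
    by (rule translate_pairing_integrable[OF f s K(1) s0])
  have lin: "linear (\<lambda>w. dir_deriv w \<psi> y)" for y
    using differentiable_has_dir_deriv[OF smooth_on_differentiable[OF \<psi>]] has_derivative_linear by blast
  have "linear (\<lambda>w. - translate_pairing S f (dir_deriv w \<psi>) z)"
    unfolding translate_pairing_def
    by (rule linearI) (simp_all add: linear_add[OF lin] linear_cmul[OF lin] distrib_left i2)
  then have bl: "bounded_linear (\<lambda>w. - translate_pairing S f (dir_deriv w \<psi>) z)"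
    by (simp add: linear_conv_bounded_linear)
  define M where "M = (LINT x|lebesgue_on S. cmod (f x))"
  have est: "cmod (translate_pairing S f \<psi> y - translate_pairing S f \<psi> z
      - - translate_pairing S f (dir_deriv (y - z) \<psi>) z) \<le> M * C * (norm (y - z))\<^sup>2" for y
  proof -
    have "translate_pairing S f \<psi> y - translate_pairing S f \<psi> z
        - - translate_pairing S f (dir_deriv (y - z) \<psi>) z =
      (LINT x|lebesgue_on S. f x * \<psi> (x - y) - f x * \<psi> (x - z) + f x * dir_deriv (y - z) \<psi> (x - z))"
      by (simp add: translate_pairing_def i1 i2)
    also have "\<dots> = (LINT x|lebesgue_on S.
        f x * (\<psi> ((x - z) - (y - z)) - \<psi> (x - z) + dir_deriv (y - z) \<psi> (x - z)))" (is "_ = integral\<^sup>L _ ?g")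
      by (simp add: algebra_simps)
    finally have eq: "translate_pairing S f \<psi> y - translate_pairing S f \<psi> z
        - - translate_pairing S f (dir_deriv (y - z) \<psi>) z = integral\<^sup>L (lebesgue_on S) ?g" .
    have ig: "integrable (lebesgue_on S) ?g"
      using i1[of y] i1[of z] i2[of "y - z" z] by (simp add: algebra_simps)
    have "cmod (integral\<^sup>L (lebesgue_on S) ?g) \<le> (LINT x|lebesgue_on S. norm (?g x))"
      by (rule integral_norm_bound)
    also have "\<dots> \<le> (LINT x|lebesgue_on S. cmod (f x) * (C * (norm (y - z))\<^sup>2))"
    proof (rule integral_mono)
      show "norm (?g x) \<le> cmod (f x) * (C * (norm (y - z))\<^sup>2)" for x
        using C(2)[of "x - z" "y - z"] unfolding norm_mult by (intro mult_left_mono) auto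
    qed (use ig f in auto)
    also have "\<dots> = M * C * (norm (y - z))\<^sup>2"
      using f by (simp add: M_def)
    finally show ?thesis unfolding eq .
  qed
  show ?thesis
  proof (rule has_derivativeI_sandwich[OF zero_less_one bl])
    show "norm (translate_pairing S f \<psi> y - translate_pairing S f \<psi> z
        - - translate_pairing S f (dir_deriv (y - z) \<psi>) z) / norm (y - z) \<le> M * C * norm (y - z)"
      if "y \<noteq> z" for y
      using est[of y] that by (simp add: divide_le_eq power2_eq_square mult.assoc)
    show "((\<lambda>y. M * C * norm (y - z)) \<longlongrightarrow> 0) (at z within UNIV)"
      by (auto intro!: tendsto_eq_intros)
  qed
qed

lemma iter_deriv_translate_pairing:
  assumes f: "integrable (lebesgue_on S) f" and \<psi>: "smooth_on UNIV \<psi>"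
    and K: "compact K" "\<And>x. x \<notin> K \<Longrightarrow> \<psi> x = 0"
  shows "iter_deriv vs (translate_pairing S f \<psi>) =
    (\<lambda>z. (- 1) ^ length vs * translate_pairing S f (iter_deriv vs \<psi>) z)"
proof (induction vs)
  case (Cons v vs)
  show ?case
  proof
    fix z
    have "iter_deriv vs \<psi> x = 0" if "x \<notin> K" for x
      using iter_deriv_zero_off[OF open_UNIV K(1), where f = \<psi> and x = x and vs = vs] that K(2) by simp
    from has_derivative_mult_right[OF translate_pairing_has_derivative[OF f smooth_on_iter_deriv[OF \<psi>] K(1) this]]
    have "((\<lambda>z. (- 1) ^ length vs * translate_pairing S f (iter_deriv vs \<psi>) z) has_derivative
        (\<lambda>w. (- 1) ^ length vs * - translate_pairing S f (dir_deriv w (iter_deriv vs \<psi>)) z)) (at z)" .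
    then show "iter_deriv (v # vs) (translate_pairing S f \<psi>) z =
        (- 1) ^ length (v # vs) * translate_pairing S f (iter_deriv (v # vs) \<psi>) z"
      unfolding iter_deriv_Cons Cons by (simp add: dir_deriv_eq)
  qed
qed simp

lemma smooth_on_translate_pairing:
  fixes \<psi> :: "'a::euclidean_space \<Rightarrow> complex"
  assumes f: "integrable (lebesgue_on S) f" and \<psi>: "smooth_on UNIV \<psi>"
    and K: "compact K" "\<And>x. x \<notin> K \<Longrightarrow> \<psi> x = 0"
  shows "smooth_on UNIV (translate_pairing S f \<psi>)"
proof -
  have "(\<lambda>z. (- 1) ^ length vs * translate_pairing S f (iter_deriv vs \<psi>) z) differentiable (at z)" for vs z
  proof -
    have "iter_deriv vs \<psi> x = 0" if "x \<notin> K" for x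
      using iter_deriv_zero_off[OF open_UNIV K(1), where f = \<psi> and x = x and vs = vs] that K(2) by simp
    from has_derivative_mult_right[OF translate_pairing_has_derivative[OF f smooth_on_iter_deriv[OF \<psi>] K(1) this]]
    show ?thesis
      unfolding differentiable_def by blast
  qed
  then have "iter_deriv vs (translate_pairing S f \<psi>) differentiable (at z)" for vs z
    by (subst iter_deriv_translate_pairing[OF f \<psi> K])
  then show ?thesis
    unfolding smooth_on_def by blast
qed


section \<open>Derivatives of conjugate Bergman functions\<close>

lemma conj_bergman_L2: "\<mu> \<in> conj_bergman_space S \<Longrightarrow> \<mu> \<in> L2 S"
  using L2_cnj[of "\<lambda>z. cnj (\<mu> z)" S] by (simp add: conj_bergman_space_def bergman_space_def)

lemma bump_integrable: "e > 0 \<Longrightarrow> integrable lborel (bump (p :: 'a::euclidean_space) e)"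
proof -
  assume e: "e > 0"
  have "integrable lborel (\<lambda>x. indicator (cball p e) x *\<^sub>R bump p e x)"
    using smooth_on_continuous[OF smooth_on_bump[of p e]]
    by (intro borel_integrable_compact) (auto intro: continuous_on_subset)
  moreover have "indicator (cball p e) x *\<^sub>R bump p e x = bump p e x" for x
    using bump_compact_support[OF e, of x p] by (cases "x \<in> cball p e") auto
  then have "(\<lambda>x. indicator (cball p e) x *\<^sub>R bump p e x) = bump p e"
    by (rule ext)
  ultimately show ?thesis by simp
qed

text \<open>The bump equals \<open>1\<close> on the ball of radius \<open>e / 2\<close>. The volume
  of that ball bounds the normalising mass from below and brings the real dimension into the
  exponent of the interior estimate.\<close>

lemma bump_integral_lower:
  assumes e: "e > 0"
  shows "unit_ball_vol (real DIM('a)) * (e / 2) ^ DIM('a) \<le> (LINT x|lborel. bump (p :: 'a::euclidean_space) e x)"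
proof -
  have "unit_ball_vol (real DIM('a)) * (e / 2) ^ DIM('a) = measure lborel (cball p (e / 2))"
    using e content_cball[of "e / 2" p] by simp
  also have "\<dots> = (LINT x|lborel. indicator (cball p (e / 2)) x)"
    by simp
  also have "\<dots> \<le> (LINT x|lborel. bump p e x)"
  proof (rule integral_mono[OF _ bump_integrable[OF e]])
    show "integrable lborel (indicator (cball p (e / 2)) :: 'a \<Rightarrow> real)"
      using emeasure_lborel_cball_finite[of p "e / 2"] by (simp add: integrable_indicator_iff)
    show "indicator (cball p (e / 2)) x \<le> bump p e x" for x
      using bump_eq_1[OF e, of p x] bump_nonneg[of p e x] by (auto simp: indicator_def)
  qed
  finally show ?thesis .
qed

abbreviation cbump :: "real \<Rightarrow> 'a::euclidean_space \<Rightarrow> complex" where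
  "cbump e x \<equiv> complex_of_real (bump 0 e x)"

lemma smooth_on_cbump: "smooth_on UNIV (cbump e)"
  by (rule smooth_on_of_real[OF open_UNIV smooth_on_bump])

text \<open>The bump is real, so conjugating both sides reduces the claim to the mean value property
  of the conjugate of \<open>\<mu>\<close>, which is holomorphic.\<close>

lemma conj_bergman_mean_value:
  fixes S :: "(complex ^ 'n) set"
  assumes S: "open S" and \<mu>: "\<mu> \<in> conj_bergman_space S" and r: "r > 0" "cball z r \<subseteq> S"
    and e: "0 < e" "e \<le> r / 2"
  shows "translate_pairing S \<mu> (cbump e) z = \<mu> z * of_real (LINT x|lborel. bump 0 e (x :: complex ^ 'n))"
proof -
  define h where "h x = cnj (\<mu> x)" for x
  have h: "holomorphic_on_Cn h S"
    using \<mu> by (simp add: conj_bergman_space_def bergman_space_def h_def[abs_def])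
  note mv = bump_mean_value[OF h r(2) r(1) e]
  have m: "(\<lambda>x. cbump e x * h (z + x)) \<in> borel_measurable borel"
    by (rule borel_measurable_continuous_onI[OF mv(1)])
  have m': "(\<lambda>x. cbump e (x - z) * h x) \<in> borel_measurable borel"
  proof -
    have "(\<lambda>x. x - z) \<in> borel_measurable borel" by measurable
    from measurable_compose[OF this m] show ?thesis by simp
  qed
  have z: "cbump e (x - z) * h x = 0" if "x \<notin> S" for x
  proof -
    have "cball z e \<subseteq> S"
      using r e by (intro order_trans[OF subset_cball r(2)]) auto
    then have "x \<notin> cball z e" using that by blast
    then have "bump 0 e (x - z) = 0"
      by (intro bump_compact_support[OF e(1)]) (auto simp: dist_norm norm_minus_commute)
    then show ?thesis by simp
  qed
  have "cnj (translate_pairing S \<mu> (cbump e) z) = (LINT x|lebesgue_on S. h x * cbump e (x - z))"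
    unfolding translate_pairing_def by (simp add: h_def flip: Bochner_Integration.integral_cnj)
  also have "\<dots> = (LINT x|lborel. cbump e (x - z) * h x)"
    by (rule lebesgue_on_eq_lborel(2)[OF S m' _ z]) (auto simp: mult.commute)
  also have "\<dots> = (LINT x|lborel. cbump e ((z + x) - z) * h (z + x))"
    by (rule lborel_shift(2)[OF m', symmetric])
  also have "\<dots> = h z * of_real (LINT x|lborel. bump 0 e (x :: complex ^ 'n))"
    using mv(2) by simp
  finally have "cnj (cnj (translate_pairing S \<mu> (cbump e) z)) =
      cnj (h z * of_real (LINT x|lborel. bump 0 e (x :: complex ^ 'n)))"
    by (rule arg_cong)
  then show ?thesis by (simp add: h_def)
qed

lemma bump_scale: "e \<noteq> 0 \<Longrightarrow> bump 0 e x = bump 0 1 ((1 / e) *\<^sub>R x)"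
  by (simp add: bump_def power2_eq_square field_simps)

text \<open>On a whole ball about \<open>z\<close>, \<open>\<mu>\<close> is the pairing of itself
  with one fixed smooth kernel divided by the mass, so that smoothness and all derivatives are
  inherited from the kernel.\<close>

lemma conj_bergman_iter_deriv:
  fixes S :: "(complex ^ 'n) set"
  assumes S: "open S" "bounded S" and \<mu>: "\<mu> \<in> conj_bergman_space S" and r: "r > 0" "cball z r \<subseteq> S"
  defines "I \<equiv> LINT x|lborel. bump 0 (r / 4) (x :: complex ^ 'n)"
  shows "I > 0" "iter_deriv vs \<mu> differentiable (at z)"
    "iter_deriv vs \<mu> z = (- 1) ^ length vs * translate_pairing S \<mu> (iter_deriv vs (cbump (r / 4))) z / of_real I"
proof -
  have r4: "r / 4 > 0" using r by simp
  show I: "I > 0"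
    unfolding I_def
    by (rule less_le_trans[OF _ bump_integral_lower[OF r4]])
      (use r in \<open>auto intro!: mult_pos_pos unit_ball_vol_pos\<close>)
  have c0: "cbump (r / 4) x = 0" if "x \<notin> cball 0 (r / 4)" for x :: "complex ^ 'n"
    using bump_compact_support[OF r4 that] by simp
  have \<mu>i: "integrable (lebesgue_on S) \<mu>"
    by (rule L2_integrable[OF S conj_bergman_L2[OF \<mu>]])
  let ?J = "translate_pairing S \<mu> (cbump (r / 4))"
  \<comment> \<open>Points within \<open>r / 2\<close> of \<open>z\<close> have a closed ball of
    radius \<open>r / 2\<close> in \<open>S\<close>, and the mean value property admits bumps of
    half that radius. This is the origin of \<open>r / 4\<close>.\<close>
  have eq: "?J y / of_real I = \<mu> y" if "y \<in> ball z (r / 2)" for y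
  proof -
    have "cball y (r / 2) \<subseteq> S"
    proof
      fix x assume "x \<in> cball y (r / 2)"
      then have "dist z x \<le> r"
        using that dist_triangle[of z x y] by simp
      then show "x \<in> S" using r by auto
    qed
    then show ?thesis
      using conj_bergman_mean_value[OF S(1) \<mu> _ _ r4, of "r / 2" y] r I by (simp add: I_def)
  qed
  have sJ: "smooth_on UNIV ?J"
    by (rule smooth_on_translate_pairing[OF \<mu>i smooth_on_cbump compact_cball c0])
  have L: "bounded_linear (\<lambda>c. c / complex_of_real I)"
    by (rule bounded_linear_divide)
  have z: "z \<in> ball z (r / 2)" using r by simp
  have "smooth_on UNIV (\<lambda>y. ?J y / of_real I)"
    by (rule smooth_on_bounded_linear[OF open_UNIV L sJ])
  from smooth_on_cong[OF open_ball eq smooth_on_subset[OF this subset_UNIV]]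
  have "smooth_on (ball z (r / 2)) \<mu>" .
  then show "iter_deriv vs \<mu> differentiable (at z)"
    using z unfolding smooth_on_def by blast
  have "iter_deriv vs \<mu> z = iter_deriv vs (\<lambda>y. ?J y / of_real I) z"
    by (rule iter_deriv_cong_open[OF open_ball eq[symmetric] z])
  also have "\<dots> = iter_deriv vs ?J z / of_real I"
    by (rule iter_deriv_bounded_linear[OF open_UNIV L sJ]) simp
  also have "iter_deriv vs ?J z = (- 1) ^ length vs * translate_pairing S \<mu> (iter_deriv vs (cbump (r / 4))) z"
    by (subst iter_deriv_translate_pairing[OF \<mu>i smooth_on_cbump compact_cball[of 0 "r / 4"] c0]) auto
  finally show "iter_deriv vs \<mu> z =
      (- 1) ^ length vs * translate_pairing S \<mu> (iter_deriv vs (cbump (r / 4))) z / of_real I"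
    .
qed

lemma conj_bergman_smooth:
  assumes "open S" "bounded S" "\<mu> \<in> conj_bergman_space S"
  shows "smooth_on S \<mu>"
  unfolding smooth_on_def
proof (intro allI ballI)
  fix vs z assume "z \<in> S"
  then obtain r where "r > 0" "cball z r \<subseteq> S"
    using assms(1) open_contains_cball by blast
  then show "iter_deriv vs \<mu> differentiable (at z)"
    by (rule conj_bergman_iter_deriv(2)[OF assms])
qed

text \<open>There are finitely many basis lists \<open>ws\<close> of length at most
  \<open>k\<close>, so their bounds can be summed; the extra \<open>1\<close> makes the result
  positive.\<close>

lemma cbump_derivs_bounded:
  fixes vs :: "'a::euclidean_space list"
  obtains M where "M > 0"
    "\<And>ws x. set ws \<subseteq> Basis \<Longrightarrow> length ws \<le> k \<Longrightarrow> cmod (iter_deriv (ws @ vs) (cbump 1) (x :: 'a)) \<le> M"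
proof -
  have c0: "cbump 1 x = 0" if "x \<in> UNIV - cball 0 1" for x :: 'a
    using bump_compact_support[of 1 x 0] that by simp
  have "\<exists>B\<ge>0. \<forall>x::'a. cmod (iter_deriv us (cbump 1) x) \<le> B" for us
  proof -
    have "continuous_on (cball 0 1) (iter_deriv us (cbump 1) :: 'a \<Rightarrow> complex)"
      by (rule continuous_on_subset[OF smooth_on_continuous[OF smooth_on_iter_deriv[OF smooth_on_cbump]]]) simp
    moreover have "iter_deriv us (cbump 1) x = 0" if "x \<in> UNIV - cball 0 1" for x :: 'a
      by (rule iter_deriv_zero_off[OF open_UNIV compact_cball[of 0 1] c0 that])
    ultimately obtain B where "B \<ge> 0" "\<And>x::'a. x \<in> UNIV \<Longrightarrow> cmod (iter_deriv us (cbump 1) x) \<le> B"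
      using continuous_compact_support_bounded[of "cball 0 1" "iter_deriv us (cbump 1) :: 'a \<Rightarrow> complex" UNIV]
        compact_cball by metis
    then show ?thesis by auto
  qed
  then obtain B where B: "\<And>us. B us \<ge> 0" "\<And>us x. cmod (iter_deriv us (cbump 1) (x :: 'a)) \<le> B us"
    by metis
  define W where "W = {ws. set ws \<subseteq> (Basis :: 'a set) \<and> length ws \<le> k}"
  have fin: "finite W"
    unfolding W_def by (rule finite_lists_length_le) simp
  show ?thesis
  proof (rule that[of "1 + (\<Sum>ws\<in>W. B (ws @ vs))"])
    show "1 + (\<Sum>ws\<in>W. B (ws @ vs)) > 0"
      using B(1) by (simp add: add_pos_nonneg sum_nonneg)
    fix ws :: "'a list" and x :: 'a assume "set ws \<subseteq> Basis" "length ws \<le> k"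
    then have "B (ws @ vs) \<le> (\<Sum>ws\<in>W. B (ws @ vs))"
      using B(1) by (intro member_le_sum fin) (auto simp: W_def)
    then show "cmod (iter_deriv (ws @ vs) (cbump 1) x) \<le> 1 + (\<Sum>ws\<in>W. B (ws @ vs))"
      using B(2)[of "ws @ vs" x] by linarith
  qed
qed

text \<open>With a bump of radius \<open>r / 4\<close>, the derivatives \<open>vs\<close> and up to
  \<open>k\<close> more from the dual norm fall on the kernel and cost powers of the inverse radius.
  Dividing by the mass of the bump costs a further power equal to the real dimension
  \<open>DIM(complex ^ 'n)\<close>.\<close>

lemma conj_bergman_interior_estimate:
  fixes S :: "(complex ^ 'n) set" and vs :: "(complex ^ 'n) list"
  assumes S: "open S" "bounded S"
  obtains C where "C \<ge> 0"
    "\<And>\<mu> z r. \<mu> \<in> conj_bergman_space S \<Longrightarrow> 0 < r \<Longrightarrow> r \<le> 1 \<Longrightarrow> cball z r \<subseteq> S \<Longrightarrow>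
       cmod (iter_deriv vs \<mu> z) * r ^ (DIM(complex ^ 'n) + k + length vs) \<le> C * neg_sobolev_norm k S \<mu>"
proof -
  obtain M where M: "M > 0"
    "\<And>ws x. set ws \<subseteq> Basis \<Longrightarrow> length ws \<le> k \<Longrightarrow> cmod (iter_deriv (ws @ vs) (cbump 1) (x :: complex ^ 'n)) \<le> M"
    using cbump_derivs_bounded by blast
  define N where "N = DIM(complex ^ 'n)"
  define m where "m = k + length vs"
  define V where "V = unit_ball_vol (real N)"
  have V: "V > 0" by (simp add: V_def unit_ball_vol_pos)
  \<comment> \<open>The factor \<open>8 ^ N / V\<close> inverts the lower bound for the mass, where
    half the radius of the bump is \<open>r / 8\<close>; \<open>4 ^ m\<close> is
    \<open>(r / e) ^ m\<close> for \<open>e = r / 4\<close>.\<close>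
  define C where "C = 8 ^ N / V * ((1 + sobolev_const k S) * (M * 4 ^ m))"
  have sc: "1 + sobolev_const k S > 0" by (simp add: sobolev_const_def add_pos_nonneg)
  show ?thesis
  proof (rule that)
    show "C \<ge> 0" using V M sc by (simp add: C_def)
    fix \<mu> z r
    assume \<mu>: "\<mu> \<in> conj_bergman_space S" and r: "0 < r" "r \<le> 1" "cball z r \<subseteq> S"
    define e where "e = r / 4"
    \<comment> \<open>Here \<open>r \<le> 1\<close> is used: once \<open>1 / e \<ge> 1\<close>, all
      powers of \<open>1 / e\<close> that occur are dominated by the exponent
      \<open>m\<close>.\<close>
    have e: "e > 0" "1 / e \<ge> 1" using r by (auto simp: e_def)
    define I where "I = (LINT x|lborel. bump 0 e (x :: complex ^ 'n))"
    have I: "V * (r / 8) ^ N \<le> I"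
      using bump_integral_lower[OF e(1), of "0 :: complex ^ 'n"] by (simp add: V_def N_def I_def e_def)
    have Ipos: "I > 0" and rep: "iter_deriv vs \<mu> z =
        (- 1) ^ length vs * translate_pairing S \<mu> (iter_deriv vs (cbump e)) z / of_real I"
      using conj_bergman_iter_deriv[OF S \<mu> r(1,3)] by (auto simp: I_def e_def)
    have se: "cbump e = (\<lambda>x :: complex ^ 'n. cbump 1 ((1 / e) *\<^sub>R x + 0))"
      by (rule ext) (use e in \<open>simp add: bump_scale[of e]\<close>)
    have de: "iter_deriv us (cbump e) x = (1 / e) ^ length us *\<^sub>R iter_deriv us (cbump 1) ((1 / e) *\<^sub>R x)"
      for us and x :: "complex ^ 'n"
      unfolding se using iter_deriv_affine[OF smooth_on_cbump, of us 1 "1 / e" "0 :: complex ^ 'n"] by simp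
    define \<phi> where "\<phi> x = iter_deriv vs (cbump e) (1 *\<^sub>R x + - z)" for x
    have s\<phi>: "smooth_on UNIV \<phi>"
      unfolding \<phi>_def by (rule smooth_on_affine[OF smooth_on_iter_deriv[OF smooth_on_cbump]])
    have c0: "cbump e x = 0" if "x \<in> UNIV - cball 0 e" for x :: "complex ^ 'n"
      using bump_compact_support[OF e(1), of x 0] that by simp
    have t\<phi>: "\<phi> \<in> test_functions S"
    proof (rule test_functionsI[OF s\<phi> compact_cball[of z e]])
      show "cball z e \<subseteq> S"
        using r by (intro order_trans[OF _ r(3)]) (simp add: e_def subset_cball)
      show "\<phi> x = 0" if "x \<notin> cball z e" for x
        unfolding \<phi>_def
        by (rule iter_deriv_zero_off[OF open_UNIV compact_cball[of 0 e] c0])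
          (use that in \<open>auto simp: dist_norm norm_minus_commute\<close>)
    qed
    define A where "A = M * (1 / e) ^ m"
    have A: "A > 0" using M e by (simp add: A_def)
    have "cmod (LINT x|lebesgue_on S. \<mu> x * \<phi> x) \<le> (1 + sobolev_const k S) * A * neg_sobolev_norm k S \<mu>"
    proof (rule neg_sobolev_norm_pairing[OF S conj_bergman_L2[OF \<mu>] t\<phi> _ A])
      fix ws x assume ws: "set ws \<subseteq> (Basis :: (complex ^ 'n) set)" "length ws \<le> k"
      have "iter_deriv ws \<phi> x = iter_deriv (ws @ vs) (cbump e) (x - z)"
        unfolding \<phi>_def iter_deriv_affine[OF smooth_on_iter_deriv[OF smooth_on_cbump]]
        by (simp add: iter_deriv_append)
      also have "cmod \<dots> = (1 / e) ^ (length ws + length vs) * cmod (iter_deriv (ws @ vs) (cbump 1) ((1 / e) *\<^sub>R (x - z)))"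
        unfolding de using e by (simp add: norm_power power_divide)
      also have "\<dots> \<le> (1 / e) ^ m * M"
        using e M(2)[OF ws] ws(2) by (intro mult_mono power_increasing) (auto simp: m_def)
      finally show "cmod (iter_deriv ws \<phi> x) \<le> A"
        by (simp add: A_def mult.commute)
    qed
    moreover have "translate_pairing S \<mu> (iter_deriv vs (cbump e)) z = (LINT x|lebesgue_on S. \<mu> x * \<phi> x)"
      by (simp add: translate_pairing_def \<phi>_def)
    ultimately have J: "cmod (iter_deriv vs \<mu> z) * I \<le> (1 + sobolev_const k S) * A * neg_sobolev_norm k S \<mu>"
      unfolding rep using Ipos by (simp add: norm_mult norm_divide norm_power)
    have "cmod (iter_deriv vs \<mu> z) * r ^ (N + m) = cmod (iter_deriv vs \<mu> z) * (V * (r / 8) ^ N) * (8 ^ N / V * r ^ m)"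
      using V by (simp add: power_add power_divide field_simps)
    also have "\<dots> \<le> cmod (iter_deriv vs \<mu> z) * I * (8 ^ N / V * r ^ m)"
      using I V r by (intro mult_right_mono mult_left_mono) auto
    also have "\<dots> \<le> (1 + sobolev_const k S) * A * neg_sobolev_norm k S \<mu> * (8 ^ N / V * r ^ m)"
      using V r by (intro mult_right_mono J) auto
    also have "\<dots> = 8 ^ N / V * ((1 + sobolev_const k S) * (M * ((1 / e) ^ m * r ^ m))) * neg_sobolev_norm k S \<mu>"
      by (simp add: A_def mult_ac)
    also have "(1 / e) ^ m * r ^ m = 4 ^ m"
      using r by (simp add: e_def flip: power_mult_distrib)
    also have "8 ^ N / V * ((1 + sobolev_const k S) * (M * 4 ^ m)) = C"
      by (simp add: C_def)
    finally show "cmod (iter_deriv vs \<mu> z) * r ^ (DIM(complex ^ 'n) + k + length vs) \<le> C * neg_sobolev_norm k S \<mu>"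
      by (simp add: N_def m_def add.assoc)
  qed
qed

section \<open>Bounded smooth functions\<close>

text \<open>The coefficients of the integrations by parts. \<open>K\<close> may cross the boundary
  of \<open>S\<close>, so the support need not be compact in \<open>S\<close>; boundedness of all
  derivatives replaces smoothness up to the boundary and survives products, differentiation and
  localisation.\<close>

definition bounded_smooth :: "'a::euclidean_space set \<Rightarrow> 'a set \<Rightarrow> ('a \<Rightarrow> complex) set" where
  "bounded_smooth S K = {G. smooth_on S G \<and> (\<forall>vs. \<exists>B. \<forall>x\<in>S. cmod (iter_deriv vs G x) \<le> B) \<and>
     (\<forall>x\<in>S - K. G x = 0)}"

lemma bounded_smoothD:
  assumes "G \<in> bounded_smooth S K"
  shows "smooth_on S G" "x \<in> S \<Longrightarrow> x \<notin> K \<Longrightarrow> G x = 0"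
  using assms by (auto simp: bounded_smooth_def)

lemma bounded_smooth_bound:
  assumes "G \<in> bounded_smooth S K"
  obtains B where "B \<ge> 0" "\<And>x. x \<in> S \<Longrightarrow> cmod (iter_deriv vs G x) \<le> B"
proof -
  obtain B where "\<forall>x\<in>S. cmod (iter_deriv vs G x) \<le> B"
    using assms unfolding bounded_smooth_def by blast
  then show ?thesis by (intro that[of "max 0 B"]) (auto simp: le_max_iff_disj)
qed

lemma bounded_smooth_iter_deriv:
  assumes S: "open S" and K: "closed K" and G: "G \<in> bounded_smooth S K"
  shows "iter_deriv vs G \<in> bounded_smooth S K"
proof -
  have "iter_deriv vs G x = 0" if "x \<in> S - K" for x
    by (rule iter_deriv_zero_open[of "S - K"]) (use that S K G in \<open>auto simp: bounded_smooth_def open_Diff\<close>)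
  then show ?thesis
    using G unfolding bounded_smooth_def by (auto simp: smooth_on_iter_deriv simp flip: iter_deriv_append)
qed

lemma bounded_smooth_dir_deriv:
  "open S \<Longrightarrow> closed K \<Longrightarrow> G \<in> bounded_smooth S K \<Longrightarrow> dir_deriv v G \<in> bounded_smooth S K"
  using bounded_smooth_iter_deriv[of S K G "[v]"] by (simp add: dir_deriv_def)

lemma bounded_smooth_cong:
  assumes "open S" "G \<in> bounded_smooth S K" "\<And>x. x \<in> S \<Longrightarrow> G x = H x"
  shows "H \<in> bounded_smooth S K"
proof -
  have "iter_deriv vs H x = iter_deriv vs G x" if "x \<in> S" for vs x
    by (rule iter_deriv_cong_open[OF assms(1) _ that]) (simp add: assms(3))
  then show ?thesis
    using assms smooth_on_cong[OF assms(1,3)] unfolding bounded_smooth_def by auto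
qed

lemma bounded_smooth_add:
  assumes S: "open S" and G: "G \<in> bounded_smooth S K" and H: "H \<in> bounded_smooth S K"
  shows "(\<lambda>x. G x + H x) \<in> bounded_smooth S K"
proof -
  have "\<exists>B. \<forall>x\<in>S. cmod (iter_deriv vs (\<lambda>x. G x + H x) x) \<le> B" for vs
  proof -
    obtain B C where "\<And>x. x \<in> S \<Longrightarrow> cmod (iter_deriv vs G x) \<le> B" "\<And>x. x \<in> S \<Longrightarrow> cmod (iter_deriv vs H x) \<le> C"
      using bounded_smooth_bound[OF G] bounded_smooth_bound[OF H] by metis
    then show ?thesis
      by (intro exI[of _ "B + C"])
        (auto simp: iter_deriv_add[OF S bounded_smoothD(1)[OF G] bounded_smoothD(1)[OF H]]
          intro!: norm_triangle_le add_mono)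
  qed
  then show ?thesis
    using G H smooth_on_add[OF S] by (auto simp: bounded_smooth_def)
qed

text \<open>The product rule for the innermost derivative yields two products of the same kind, so
  the induction runs over arbitrary pairs of factors with bounded derivatives; the supports are
  dealt with separately.\<close>

lemma bounded_smooth_mult:
  assumes S: "open S"
    and G: "G \<in> bounded_smooth S K" and H: "H \<in> bounded_smooth S L"
  shows "(\<lambda>x. G x * H x) \<in> bounded_smooth S (K \<inter> L)"
proof -
  have *: "\<exists>B. \<forall>x\<in>S. cmod (iter_deriv vs (\<lambda>x. G x * H x) x) \<le> B"
    if "smooth_on S G" "smooth_on S H" "\<And>vs. \<exists>B. \<forall>x\<in>S. cmod (iter_deriv vs G x) \<le> B"
      "\<And>vs. \<exists>B. \<forall>x\<in>S. cmod (iter_deriv vs H x) \<le> B" for vs G H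
    using that
  proof (induction vs arbitrary: G H rule: rev_induct)
    case Nil
    obtain B C where B: "\<And>x. x \<in> S \<Longrightarrow> cmod (G x) \<le> B" "\<And>x. x \<in> S \<Longrightarrow> cmod (H x) \<le> C"
      using Nil(3)[of "[]"] Nil(4)[of "[]"] by auto
    have "cmod (G x * H x) \<le> B * C" if "x \<in> S" for x
      unfolding norm_mult using B[OF that] by (intro mult_mono) (auto intro: order_trans[OF norm_ge_zero])
    then show ?case by auto
  next
    case (snoc v vs)
    have s: "smooth_on S (dir_deriv v G)" "smooth_on S (dir_deriv v H)"
      using snoc.prems by (auto intro: smooth_on_dir_deriv)
    have b: "\<exists>B. \<forall>x\<in>S. cmod (iter_deriv us (dir_deriv v G) x) \<le> B"
      "\<exists>B. \<forall>x\<in>S. cmod (iter_deriv us (dir_deriv v H) x) \<le> B" for us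
      using snoc.prems(3,4)[of "us @ [v]"] by (auto simp: iter_deriv_snoc)
    obtain B where B: "\<forall>x\<in>S. cmod (iter_deriv vs (\<lambda>x. G x * dir_deriv v H x) x) \<le> B"
      using snoc.IH[OF snoc.prems(1) s(2) snoc.prems(3) b(2)] by blast
    obtain C where C: "\<forall>x\<in>S. cmod (iter_deriv vs (\<lambda>x. dir_deriv v G x * H x) x) \<le> C"
      using snoc.IH[OF s(1) snoc.prems(2) b(1) snoc.prems(4)] by blast
    have "iter_deriv (vs @ [v]) (\<lambda>x. G x * H x) x =
        iter_deriv vs (\<lambda>x. G x * dir_deriv v H x) x + iter_deriv vs (\<lambda>x. dir_deriv v G x * H x) x"
      if "x \<in> S" for x
    proof -
      have "iter_deriv (vs @ [v]) (\<lambda>x. G x * H x) x =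
          iter_deriv vs (\<lambda>x. G x * dir_deriv v H x + dir_deriv v G x * H x) x"
        unfolding iter_deriv_snoc
        by (rule iter_deriv_cong_open[OF S _ that])
          (intro dir_deriv_mult smooth_on_differentiable[of S] snoc.prems)
      then show ?thesis
        by (simp add: iter_deriv_add[OF S smooth_on_mult[OF S snoc.prems(1) s(2)]
              smooth_on_mult[OF S s(1) snoc.prems(2)] that])
    qed
    then show ?case
      using B C by (intro exI[of _ "B + C"]) (auto intro!: norm_triangle_le add_mono)
  qed
  show ?thesis
    unfolding bounded_smooth_def using * G H smooth_on_mult[OF S] by (auto simp: bounded_smooth_def)
qed

lemma bounded_smooth_mono: "G \<in> bounded_smooth S K \<Longrightarrow> K \<subseteq> L \<Longrightarrow> G \<in> bounded_smooth S L"
  by (auto simp: bounded_smooth_def)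

lemma bounded_smooth_compact_support:
  assumes S: "smooth_on UNIV f" and K: "compact K" "\<And>x. x \<notin> K \<Longrightarrow> f x = 0"
  shows "f \<in> bounded_smooth S K"
proof -
  have "\<exists>B. \<forall>x\<in>S. cmod (iter_deriv vs f x) \<le> B" for vs
  proof -
    have z: "iter_deriv vs f x = 0" if "x \<in> UNIV - K" for x
      by (rule iter_deriv_zero_off[OF open_UNIV K(1) _ that]) (use K(2) in auto)
    have "continuous_on K (iter_deriv vs f)"
      by (rule continuous_on_subset[OF smooth_on_continuous[OF smooth_on_iter_deriv[OF S]]]) simp
    from continuous_compact_support_bounded[OF this K(1), of UNIV] z show ?thesis
      by (metis UNIV_I)
  qed
  then show ?thesis
    using S K(2) by (auto simp: bounded_smooth_def intro: smooth_on_subset)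
qed

lemma iter_deriv_const: "\<exists>c'. iter_deriv vs (\<lambda>x. c) = (\<lambda>x. c')"
  by (induction vs) (auto simp: iter_deriv_Cons simp del: iter_deriv.simps(2))

lemma bounded_smooth_const: "(\<lambda>x. c) \<in> bounded_smooth S UNIV"
proof -
  have "\<exists>B. \<forall>x\<in>S. cmod (iter_deriv vs (\<lambda>x. c) x) \<le> B" for vs :: "'a list"
    using iter_deriv_const[of vs c] by auto
  then show ?thesis by (simp add: bounded_smooth_def)
qed

lemma bounded_smooth_scale:
  "open S \<Longrightarrow> G \<in> bounded_smooth S K \<Longrightarrow> (\<lambda>x. c * G x) \<in> bounded_smooth S K"
  using bounded_smooth_mult[OF _ bounded_smooth_const[of c]] by fastforce

text \<open>A plateau function equal to \<open>1\<close> on \<open>K\<close> makes \<open>f\<close>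
  smooth everywhere without changing the product. This is how a local defining function and the
  inverse of its \<open>wirtinger\<close> derivative become admissible factors.\<close>

lemma bounded_smooth_mult_local:
  assumes S: "open S" and G: "G \<in> bounded_smooth S K" and K: "compact K" and U: "open U" "K \<subseteq> U"
    and f: "smooth_on U f"
  shows "(\<lambda>x. G x * f x) \<in> bounded_smooth S K"
proof -
  obtain \<phi> :: "'a \<Rightarrow> real" and L where \<phi>: "smooth_on UNIV \<phi>" "\<And>x. x \<in> K \<Longrightarrow> \<phi> x = 1"
    "compact L" "L \<subseteq> U" "\<And>x. x \<notin> L \<Longrightarrow> \<phi> x = 0"
    using smooth_plateau[OF K U] by metis
  define F where "F x = (if x \<in> U then of_real (\<phi> x) * f x else 0)" for x
  have "smooth_on UNIV F"
    unfolding F_def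
    by (intro smooth_on_extend_zero[OF U(1) \<phi>(3,4)] smooth_on_mult[OF U(1)] f
        smooth_on_subset[OF smooth_on_of_real[OF open_UNIV \<phi>(1)]]) (auto simp: \<phi>(5))
  then have "F \<in> bounded_smooth S L"
    by (rule bounded_smooth_compact_support[OF _ \<phi>(3)]) (simp add: F_def \<phi>(5))
  from bounded_smooth_mult[OF S G this] have "(\<lambda>x. G x * F x) \<in> bounded_smooth S K"
    by (rule bounded_smooth_mono) simp
  then show ?thesis
  proof (rule bounded_smooth_cong[OF S])
    show "G x * F x = G x * f x" if "x \<in> S" for x
      using bounded_smoothD(2)[OF G that] U(2) by (cases "x \<in> K") (auto simp: F_def \<phi>(2))
  qed
qed

lemma smooth_up_to_boundary_bounded_smooth:
  assumes "bounded S" "smooth_up_to_boundary S g"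
  shows "g \<in> bounded_smooth S UNIV"
proof -
  have "\<exists>B. \<forall>x\<in>S. cmod (iter_deriv vs g x) \<le> B" for vs
  proof -
    obtain h where h: "continuous_on (closure S) h" "\<forall>x\<in>S. h x = iter_deriv vs g x"
      using assms(2) unfolding smooth_up_to_boundary_def by blast
    have "bounded (h ` closure S)"
      using h(1) assms(1) by (intro compact_imp_bounded compact_continuous_image) (auto simp: compact_closure)
    then obtain B where "\<And>x. x \<in> closure S \<Longrightarrow> cmod (h x) \<le> B"
      unfolding bounded_iff by blast
    then show ?thesis
      using h(2) closure_subset[of S] by (metis subsetD)
  qed
  then show ?thesis
    using assms(2) by (simp add: bounded_smooth_def smooth_up_to_boundary_def)
qed

lemma bounded_smooth_times_integrable:
  assumes S: "open S" and G: "G \<in> bounded_smooth S K" and w: "integrable (lebesgue_on S) w"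
  shows "integrable (lebesgue_on S) (\<lambda>x. G x * w x)"
proof -
  obtain B where B: "B \<ge> 0" "\<And>x. x \<in> S \<Longrightarrow> cmod (G x) \<le> B"
    using bounded_smooth_bound[OF G, of "[]"] by auto
  show ?thesis
  proof (rule Bochner_Integration.integrable_bound)
    show "integrable (lebesgue_on S) (\<lambda>x. of_real B * w x)" using w by simp
    show "(\<lambda>x. G x * w x) \<in> borel_measurable (lebesgue_on S)"
      by (intro borel_measurable_times smooth_on_borel_measurable[OF S bounded_smoothD(1)[OF G]]
          borel_measurable_integrable[OF w])
    show "AE x in lebesgue_on S. norm (G x * w x) \<le> norm (of_real B * w x)"
      using B by (intro AE_I2) (simp add: norm_mult mult_right_mono)
  qed
qed

section \<open>Integration by parts up to the boundary\<close>

text \<open>Twice the \<open>(1,0)\<close>-part of the derivative in direction \<open>v\<close>.\<close>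

definition wirtinger :: "complex ^ 'n \<Rightarrow> (complex ^ 'n \<Rightarrow> complex) \<Rightarrow> complex ^ 'n \<Rightarrow> complex" where
  "wirtinger v f x = dir_deriv v f x - \<i> * dir_deriv (\<i> *s v) f x"

lemma wirtinger_mult:
  assumes "f differentiable (at x)" "g differentiable (at x)"
  shows "wirtinger v (\<lambda>x. f x * g x) x = f x * wirtinger v g x + wirtinger v f x * g x"
  by (simp add: wirtinger_def dir_deriv_mult[OF assms] algebra_simps)

lemma smooth_on_wirtinger: "open S \<Longrightarrow> smooth_on S f \<Longrightarrow> smooth_on S (wirtinger v f)"
  unfolding wirtinger_def[abs_def]
  by (intro smooth_on_diff smooth_on_mult smooth_on_const smooth_on_dir_deriv)

lemma bounded_smooth_wirtinger:
  assumes "open S" "closed K" "G \<in> bounded_smooth S K"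
  shows "wirtinger v G \<in> bounded_smooth S K"
  using bounded_smooth_add[OF assms(1) bounded_smooth_dir_deriv[OF assms, of v]
      bounded_smooth_scale[OF assms(1) bounded_smooth_dir_deriv[OF assms, of "\<i> *s v"], of "- \<i>"]]
  by (simp add: wirtinger_def[abs_def])

lemma wirtinger_conj_bergman:
  assumes \<mu>: "\<mu> \<in> conj_bergman_space S" and S: "open S" "bounded S" and z: "z \<in> S"
  shows "wirtinger v \<mu> z = 0"
proof -
  have h: "holomorphic_on_Cn (\<lambda>z. cnj (\<mu> z)) S"
    using \<mu> by (simp add: conj_bergman_space_def bergman_space_def)
  have d: "\<mu> differentiable (at z)"
    using smooth_on_differentiable[OF conj_bergman_smooth[OF S \<mu>] z] .
  have "cnj (dir_deriv (\<i> *s v) \<mu> z) = \<i> * cnj (dir_deriv v \<mu> z)"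
    using holomorphic_on_Cn_dir_deriv(2)[OF h z, of \<i> v]
    by (simp add: dir_deriv_bounded_linear[OF bounded_linear_cnj d])
  then have "cnj (cnj (dir_deriv (\<i> *s v) \<mu> z)) = cnj (\<i> * cnj (dir_deriv v \<mu> z))"
    by (rule arg_cong)
  then show ?thesis by (simp add: wirtinger_def)
qed

lemma integral_wirtinger_zero:
  assumes "open S" "compact K" "K \<subseteq> S" "smooth_on S f" "\<And>x. x \<in> S - K \<Longrightarrow> f x = 0"
  shows "(LINT x|lebesgue_on S. wirtinger v f x) = 0"
proof -
  have I: "integrable (lebesgue_on S) (dir_deriv u f)" "(LINT x|lebesgue_on S. dir_deriv u f x) = 0" for u
    using assms(5) by (auto intro!: integral_dir_deriv_zero[OF assms(1-4)])
  show ?thesis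
    unfolding wirtinger_def by (subst Bochner_Integration.integral_diff) (simp_all add: I)
qed

lemma smooth_step_deriv_zero: "t < 0 \<or> t > 1 \<Longrightarrow> dir_deriv 1 smooth_step t = 0"
  using dir_deriv_cong_open[of "{..<0}" smooth_step "\<lambda>_. 1" t 1]
    dir_deriv_cong_open[of "{1<..}" smooth_step "\<lambda>_. 0" t 1] smooth_step_eq_1 smooth_step_eq_0
  by force

text \<open>For \<open>t = r x * real (Suc n)\<close> this is what remains when \<open>r\<close>
  multiplies the derivative of the cut-off \<open>smooth_step (t + 2)\<close>. It is continuous and
  supported in \<open>{-2..-1}\<close>, hence bounded independently of \<open>n\<close>.\<close>

lemma smooth_step_deriv_bound:
  obtains B where "B \<ge> 0" "\<And>t. \<bar>t * dir_deriv 1 smooth_step (t + 2)\<bar> \<le> B"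
proof -
  have c: "continuous_on UNIV (dir_deriv 1 smooth_step)"
    by (rule smooth_on_continuous[OF smooth_on_dir_deriv[OF smooth_on_smooth_step]])
  have "continuous_on {-2..-1} (\<lambda>t. t * dir_deriv 1 smooth_step (t + 2))"
    by (intro continuous_intros continuous_on_compose2[OF c]) auto
  moreover have "t * dir_deriv 1 smooth_step (t + 2) = 0" if "t \<in> UNIV - {-2..-1}" for t
    using that by (auto simp: smooth_step_deriv_zero not_le)
  ultimately obtain B where "B \<ge> 0" "\<And>t. t \<in> UNIV \<Longrightarrow> norm (t * dir_deriv 1 smooth_step (t + 2)) \<le> B"
    by (rule continuous_compact_support_bounded[OF _ compact_Icc]) auto
  then show ?thesis by (intro that[of B]) (auto simp: abs_mult)
qed

text \<open>\<open>K\<close> is compact in \<open>U\<close> but may meet the boundary of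
  \<open>S\<close>. Nondegeneracy of \<open>r\<close> is left to the lemmas that divide by its
  derivative, so that interior points fit in as well, with \<open>U = S\<close> and \<open>r\<close>
  the constant \<open>- 1\<close>.\<close>

locale boundary_chart =
  fixes S U K :: "(complex ^ 'n) set" and r :: "complex ^ 'n \<Rightarrow> real"
  assumes S: "open S" and bS: "bounded S" and U: "open U" and r: "smooth_on U r"
    and SU: "S \<inter> U = {x \<in> U. r x < 0}" and K: "compact K" "K \<subseteq> U"
begin

lemma closed_K: "closed K"
  using K by (simp add: compact_imp_closed)

abbreviation "R \<equiv> \<lambda>x. complex_of_real (r x)"

lemma smooth_R: "smooth_on U R"
  by (rule smooth_on_of_real[OF U r])

lemma r_neg: "x \<in> S \<Longrightarrow> x \<in> K \<Longrightarrow> r x < 0"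
  using SU K by blast

lemma R_power_mult:
  assumes "G \<in> bounded_smooth S K"
  shows "(\<lambda>x. R x ^ m * G x) \<in> bounded_smooth S K"
  using bounded_smooth_mult_local[OF S assms K(1) U K(2) smooth_on_power[OF U smooth_R, of m]]
  by (simp add: mult.commute)

lemma off_K:
  assumes "G \<in> bounded_smooth S K" "x \<in> S" "x \<notin> K"
  shows "G x = 0" "dir_deriv v G x = 0" "wirtinger v G x = 0"
  using bounded_smoothD(2)[OF assms] bounded_smoothD(2)[OF bounded_smooth_dir_deriv[OF S closed_K assms(1)] assms(2,3)]
  by (auto simp: wirtinger_def)

text \<open>Cut-offs near the boundary take the place of boundary values of \<open>w\<close>: with a
  cut-off inserted, the integral vanishes by the compactly supported case. The factor
  \<open>R\<close> keeps the derivatives of the cut-offs under control, and dominated convergence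
  removes them.\<close>

lemma boundary_ibp:
  assumes G: "G \<in> bounded_smooth S K" and w: "smooth_on S w" "\<And>x. x \<in> S \<Longrightarrow> wirtinger v w x = 0"
    and wi: "integrable (lebesgue_on S) w"
  shows "(LINT x|lebesgue_on S. wirtinger v (\<lambda>x. R x * G x) x * w x) = 0"
proof -
  \<comment> \<open>The shift by \<open>2\<close> makes the cut-off \<open>1\<close> where
    \<open>r x \<le> - 2 / real (Suc n)\<close> and \<open>0\<close> already where
    \<open>r x \<ge> - 1 / real (Suc n)\<close>.\<close>
  define a where "a n x = smooth_step (r x * real (Suc n) + 2)" for n x
  have sa: "smooth_on U (\<lambda>x. complex_of_real (a n x))" for n
    unfolding a_def
    by (intro smooth_on_of_real[OF U] smooth_on_compose_real[OF U smooth_on_smooth_step]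
        smooth_on_add[OF U] smooth_on_mult[OF U] smooth_on_const r)
  define Q where "Q x = R x * G x" for x
  have RG: "Q \<in> bounded_smooth S K"
    using R_power_mult[OF G, of 1] by (simp add: Q_def[abs_def])
  define P where "P n x = Q x * of_real (a n x)" for n x
  have P: "P n \<in> bounded_smooth S K" for n
    unfolding P_def by (rule bounded_smooth_mult_local[OF S RG K(1) U K(2) sa])
  have z: "(LINT x|lebesgue_on S. wirtinger v (P n) x * w x) = 0" for n
  proof -
    \<comment> \<open>Only in this part of \<open>K\<close> can the cut-off be nonzero. There
      \<open>r\<close> is bounded away from \<open>0\<close>, so it is a compact subset of
      \<open>S\<close>.\<close>
    define Kn where "Kn = K \<inter> r -` {.. - 1 / real (Suc n)}"
    have "closed Kn"
      unfolding Kn_def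
      by (intro continuous_closed_preimage continuous_on_subset[OF smooth_on_continuous[OF r] K(2)] closed_K) auto
    then have Kn: "compact Kn"
      using K by (metis Kn_def compact_Int_closed inf.idem inf_assoc)
    have KnS: "Kn \<subseteq> S"
    proof
      fix x assume "x \<in> Kn"
      then have x: "x \<in> U" "r x \<le> - 1 / real (Suc n)" using K by (auto simp: Kn_def)
      from x(2) have "r x < 0"
        by (rule order.strict_trans1) simp
      with x have "x \<in> {x \<in> U. r x < 0}" by simp
      then show "x \<in> S" using SU by blast
    qed
    have 0: "P n x * w x = 0" if "x \<in> S - Kn" for x
    proof (cases "x \<in> K")
      case True
      then have "r x > - 1 / real (Suc n)" using that by (auto simp: Kn_def)
      then have "r x * real (Suc n) + 2 \<ge> 1" by (simp add: field_simps)
      then show ?thesis by (simp add: P_def a_def smooth_step_eq_0)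
    next
      case False
      then show ?thesis using off_K(1)[OF P] that by simp
    qed
    have "(LINT x|lebesgue_on S. wirtinger v (P n) x * w x) = (LINT x|lebesgue_on S. wirtinger v (\<lambda>x. P n x * w x) x)"
    proof (rule Bochner_Integration.integral_cong)
      fix x assume "x \<in> space (lebesgue_on S)"
      then have x: "x \<in> S" by simp
      show "wirtinger v (P n) x * w x = wirtinger v (\<lambda>x. P n x * w x) x"
        using w(2)[OF x] by (simp add: wirtinger_mult smooth_on_differentiable[OF w(1) x]
            smooth_on_differentiable[OF bounded_smoothD(1)[OF P] x])
    qed simp
    also have "\<dots> = 0"
      by (rule integral_wirtinger_zero[OF S Kn KnS smooth_on_mult[OF S bounded_smoothD(1)[OF P] w(1)] 0])
    finally show ?thesis .
  qed
  \<comment> \<open>The second summand is \<open>r\<close> times the derivative of the cut-off. It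
    is bounded uniformly in \<open>n\<close> and, at a fixed point of \<open>S\<close>, zero for all
    large \<open>n\<close>.\<close>
  have wP: "wirtinger v (P n) x = wirtinger v Q x * of_real (a n x) +
      of_real ((r x * real (Suc n)) * dir_deriv 1 smooth_step (r x * real (Suc n) + 2)) * (G x * wirtinger v R x)"
    if x: "x \<in> S" for n x
  proof (cases "x \<in> K")
    case True
    then have xU: "x \<in> U" using K by blast
    have dr: "r differentiable (at x)" using smooth_on_differentiable[OF r xU] .
    have dq: "dir_deriv u (\<lambda>x. r x * real (Suc n) + 2) x = real (Suc n) * dir_deriv u r x" for u
      by (rule dir_deriv_eq) (auto intro!: derivative_eq_intros differentiable_has_dir_deriv[OF dr])
    have da: "dir_deriv u (\<lambda>x. complex_of_real (a n x)) x =
        of_real (real (Suc n) * dir_deriv 1 smooth_step (r x * real (Suc n) + 2)) * dir_deriv u R x" for u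
    proof -
      have "dir_deriv u (a n) x = dir_deriv 1 smooth_step (r x * real (Suc n) + 2) * dir_deriv u (\<lambda>x. r x * real (Suc n) + 2) x"
        unfolding a_def
        by (rule dir_deriv_compose_real[OF _ smooth_on_differentiable[OF smooth_on_smooth_step UNIV_I]])
          (intro derivative_intros dr)
      moreover have "(a n) differentiable (at x)"
        unfolding a_def
        by (rule differentiable_compose[OF smooth_on_differentiable[OF smooth_on_smooth_step UNIV_I]])
          (intro derivative_intros dr)
      ultimately show ?thesis
        by (simp add: dir_deriv_bounded_linear[OF bounded_linear_of_real] dr dq del: of_nat_Suc)
    qed
    have "wirtinger v (P n) x = Q x * wirtinger v (\<lambda>x. complex_of_real (a n x)) x +
        wirtinger v Q x * of_real (a n x)"
      unfolding P_def
      by (rule wirtinger_mult[OF smooth_on_differentiable[OF bounded_smoothD(1)[OF RG] x]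
            smooth_on_differentiable[OF sa xU]])
    then show ?thesis
      by (simp add: wirtinger_def da Q_def algebra_simps)
  next
    case False
    then show ?thesis
      using off_K[OF P x False] off_K[OF RG x False] off_K[OF G x False] by simp
  qed
  obtain B1 where B1: "B1 \<ge> 0" "\<And>x. x \<in> S \<Longrightarrow> cmod (wirtinger v Q x) \<le> B1"
    using bounded_smooth_bound[OF bounded_smooth_wirtinger[OF S closed_K RG], of "[]"] by auto
  obtain B2 where B2: "B2 \<ge> 0" "\<And>t. \<bar>t * dir_deriv 1 smooth_step (t + 2)\<bar> \<le> B2"
    using smooth_step_deriv_bound by blast
  have GR: "(\<lambda>x. G x * wirtinger v R x) \<in> bounded_smooth S K"
    by (rule bounded_smooth_mult_local[OF S G K(1) U K(2) smooth_on_wirtinger[OF U smooth_R]])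
  obtain B3 where B3: "B3 \<ge> 0" "\<And>x. x \<in> S \<Longrightarrow> cmod (G x * wirtinger v R x) \<le> B3"
    using bounded_smooth_bound[OF GR, of "[]"] by auto
  have m: "(\<lambda>x. wirtinger v H x * w x) \<in> borel_measurable (lebesgue_on S)" if "H \<in> bounded_smooth S K" for H
    by (rule smooth_on_borel_measurable[OF S smooth_on_mult[OF S smooth_on_wirtinger[OF S] w(1)]])
      (rule bounded_smoothD(1)[OF that])
  have "(\<lambda>n. LINT x|lebesgue_on S. wirtinger v (P n) x * w x) \<longlonglongrightarrow>
      (LINT x|lebesgue_on S. wirtinger v Q x * w x)"
  proof (rule integral_dominated_convergence[where w = "\<lambda>x. (B1 + B2 * B3) * cmod (w x)"])
    show "(\<lambda>x. wirtinger v Q x * w x) \<in> borel_measurable (lebesgue_on S)"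
      by (rule m[OF RG])
    show "(\<lambda>x. wirtinger v (P n) x * w x) \<in> borel_measurable (lebesgue_on S)" for n
      by (rule m[OF P])
    show "integrable (lebesgue_on S) (\<lambda>x. (B1 + B2 * B3) * cmod (w x))"
      using wi by simp
    have "(\<lambda>n. wirtinger v (P n) x * w x) \<longlonglongrightarrow> wirtinger v Q x * w x" if x: "x \<in> S" for x
    proof (cases "x \<in> K")
      case True
      then have rx: "r x < 0" using r_neg x by blast
      obtain N where N: "real N > 2 / (- r x)" using reals_Archimedean2 by blast
      have "wirtinger v (P n) x = wirtinger v Q x" if "n \<ge> N" for n
      proof -
        have "real (Suc n) > 2 / (- r x)" using N that by linarith
        then have lt: "r x * real (Suc n) + 2 < 0" using rx by (simp add: field_simps)
        then have "dir_deriv 1 smooth_step (r x * real (Suc n) + 2) = 0" "a n x = 1"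
          by (auto intro: smooth_step_deriv_zero simp: a_def smooth_step_eq_1)
        then show ?thesis using wP[OF x, of n] by simp
      qed
      then have "\<forall>\<^sub>F n in sequentially. wirtinger v (P n) x * w x = wirtinger v Q x * w x"
        unfolding eventually_sequentially by auto
      then show ?thesis by (rule tendsto_eventually)
    next
      case False
      then show ?thesis using off_K(3)[OF P x False] off_K(3)[OF RG x False] by simp
    qed
    then show "AE x in lebesgue_on S. (\<lambda>n. wirtinger v (P n) x * w x) \<longlonglongrightarrow> wirtinger v Q x * w x"
      by (intro AE_I2) simp
    have "norm (wirtinger v (P n) x * w x) \<le> (B1 + B2 * B3) * cmod (w x)" if x: "x \<in> S" for x n
    proof -
      have "cmod (wirtinger v (P n) x) \<le> B1 * 1 + B2 * B3"
        unfolding wP[OF x]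
      proof (rule norm_triangle_le, rule add_mono)
        show "cmod (wirtinger v Q x * of_real (a n x)) \<le> B1 * 1"
          unfolding norm_mult using B1 x smooth_step_nonneg[of "r x * real (Suc n) + 2"]
            smooth_step_le_1[of "r x * real (Suc n) + 2"]
          by (intro mult_mono) (auto simp: a_def)
        show "cmod (of_real ((r x * real (Suc n)) * dir_deriv 1 smooth_step (r x * real (Suc n) + 2)) * (G x * wirtinger v R x)) \<le> B2 * B3"
          unfolding norm_mult[of "of_real _"] norm_of_real using B2 B3 x by (intro mult_mono) auto
      qed
      then show ?thesis unfolding norm_mult by (intro mult_right_mono) auto
    qed
    then show "AE x in lebesgue_on S. norm (wirtinger v (P n) x * w x) \<le> (B1 + B2 * B3) * cmod (w x)" for n
      by (intro AE_I2) simp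
  qed
  then show ?thesis
    unfolding z by (simp add: LIMSEQ_const_iff Q_def[abs_def])
qed

text \<open>Differentiating \<open>R ^ Suc m\<close> brings down
  \<open>of_nat (Suc m) * wirtinger v R\<close>. Dividing \<open>H\<close> by this makes
  \<open>R ^ m * H\<close> the leading term of a total derivative, which integrates to zero against
  \<open>w\<close>; one factor \<open>R\<close> is set aside for the cut-off.\<close>

lemma gain_one_power:
  assumes v: "\<And>x. x \<in> U \<Longrightarrow> wirtinger v R x \<noteq> 0" and H: "H \<in> bounded_smooth S K"
  obtains H' where "H' \<in> bounded_smooth S K"
    "\<And>w. smooth_on S w \<Longrightarrow> (\<And>x. x \<in> S \<Longrightarrow> wirtinger v w x = 0) \<Longrightarrow> integrable (lebesgue_on S) w \<Longrightarrow>
       (LINT x|lebesgue_on S. R x ^ m * H x * w x) = (LINT x|lebesgue_on S. R x ^ Suc m * H' x * w x)"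
proof -
  have sq: "smooth_on U (\<lambda>x. inverse (of_nat (Suc m) * wirtinger v R x))"
    using v by (intro smooth_on_inverse[OF U] smooth_on_mult[OF U] smooth_on_const smooth_on_wirtinger[OF U smooth_R])
      (simp del: of_nat_Suc)
  define G where "G x = H x * inverse (of_nat (Suc m) * wirtinger v R x)" for x
  have G: "G \<in> bounded_smooth S K"
    unfolding G_def by (rule bounded_smooth_mult_local[OF S H K(1) U K(2) sq])
  define H' where "H' x = - wirtinger v G x" for x
  have H': "H' \<in> bounded_smooth S K"
    using bounded_smooth_scale[OF S bounded_smooth_wirtinger[OF S closed_K G], of "- 1"]
    by (simp add: H'_def[abs_def])
  show ?thesis
  proof (rule that[OF H'])
    fix w assume w: "smooth_on S w" "\<And>x. x \<in> S \<Longrightarrow> wirtinger v w x = 0" and wi: "integrable (lebesgue_on S) w"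
    have eq: "wirtinger v (\<lambda>x. R x * (R x ^ m * G x)) x = R x ^ m * H x - R x ^ Suc m * H' x" if x: "x \<in> S" for x
    proof (cases "x \<in> K")
      case True
      then have xU: "x \<in> U" using K by blast
      have dR: "R differentiable (at x)" using smooth_on_differentiable[OF smooth_R xU] .
      have dp: "dir_deriv u (\<lambda>x. R x ^ Suc m) x = of_nat (Suc m) * R x ^ m * dir_deriv u R x" for u
        by (rule dir_deriv_eq)
          (rule has_derivative_eq_rhs[OF has_derivative_power[OF differentiable_has_dir_deriv[OF dR]]],
            auto simp: mult_ac)
      have dpow: "(\<lambda>x. R x ^ Suc m) differentiable (at x)"
        using has_derivative_power[OF differentiable_has_dir_deriv[OF dR]] unfolding differentiable_def by blast
      have "wirtinger v (\<lambda>x. R x * (R x ^ m * G x)) x = wirtinger v (\<lambda>x. R x ^ Suc m * G x) x"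
        by (simp add: mult.assoc)
      also have "\<dots> = R x ^ Suc m * wirtinger v G x + wirtinger v (\<lambda>x. R x ^ Suc m) x * G x"
        by (rule wirtinger_mult[OF dpow smooth_on_differentiable[OF bounded_smoothD(1)[OF G] x]])
      also have "wirtinger v (\<lambda>x. R x ^ Suc m) x = of_nat (Suc m) * R x ^ m * wirtinger v R x"
        unfolding wirtinger_def dp by (simp add: algebra_simps)
      also have "of_nat (Suc m) * R x ^ m * wirtinger v R x * G x = R x ^ m * H x"
        using v[OF xU] by (simp add: G_def field_simps del: of_nat_Suc)
      finally show ?thesis by (simp add: H'_def)
    next
      case False
      then show ?thesis
        using off_K[OF H x False] off_K[OF H' x False] off_K(3)[OF R_power_mult[OF G, of "Suc m"] x False]
        by (simp add: mult.assoc)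
    qed
    have "0 = (LINT x|lebesgue_on S. wirtinger v (\<lambda>x. R x * (R x ^ m * G x)) x * w x)"
      by (rule boundary_ibp[OF R_power_mult[OF G] w wi, symmetric])
    also have "\<dots> = (LINT x|lebesgue_on S. R x ^ m * H x * w x - R x ^ Suc m * H' x * w x)"
      by (rule Bochner_Integration.integral_cong) (auto simp: eq left_diff_distrib)
    also have "\<dots> = (LINT x|lebesgue_on S. R x ^ m * H x * w x) - (LINT x|lebesgue_on S. R x ^ Suc m * H' x * w x)"
      by (intro Bochner_Integration.integral_diff bounded_smooth_times_integrable[OF S R_power_mult wi] H H')
    finally show "(LINT x|lebesgue_on S. R x ^ m * H x * w x) = (LINT x|lebesgue_on S. R x ^ Suc m * H' x * w x)"
      by simp
  qed
qed

text \<open>The coefficient \<open>H'\<close> is chosen before \<open>w\<close>. With this order of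
  quantifiers one coefficient serves all products of \<open>\<mu>\<close> with conjugates of Bergman
  functions, and the constants of later estimates do not depend on \<open>\<mu>\<close>.\<close>

lemma gain_powers:
  assumes v: "\<And>x. x \<in> U \<Longrightarrow> wirtinger v R x \<noteq> 0" and H: "H \<in> bounded_smooth S K"
  shows "\<exists>H'\<in>bounded_smooth S K. \<forall>w. smooth_on S w \<longrightarrow> (\<forall>x\<in>S. wirtinger v w x = 0) \<longrightarrow>
    integrable (lebesgue_on S) w \<longrightarrow>
    (LINT x|lebesgue_on S. H x * w x) = (LINT x|lebesgue_on S. R x ^ m * H' x * w x)"
proof (induction m)
  case 0
  show ?case using H by (intro bexI[of _ H]) auto
next
  case (Suc m)
  then obtain H' where H': "H' \<in> bounded_smooth S K" "\<And>w. smooth_on S w \<Longrightarrow> \<forall>x\<in>S. wirtinger v w x = 0 \<Longrightarrow>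
      integrable (lebesgue_on S) w \<Longrightarrow>
      (LINT x|lebesgue_on S. H x * w x) = (LINT x|lebesgue_on S. R x ^ m * H' x * w x)"
    by blast
  obtain H'' where "H'' \<in> bounded_smooth S K" "\<And>w. smooth_on S w \<Longrightarrow> (\<And>x. x \<in> S \<Longrightarrow> wirtinger v w x = 0) \<Longrightarrow>
      integrable (lebesgue_on S) w \<Longrightarrow>
      (LINT x|lebesgue_on S. R x ^ m * H' x * w x) = (LINT x|lebesgue_on S. R x ^ Suc m * H'' x * w x)"
    using gain_one_power[OF v H'(1)] by blast
  with H'(2) show ?case by (intro bexI[of _ H'']) auto
qed

text \<open>A derivative falls either on the weighted coefficient, where it lowers \<open>M\<close>
  by one, or on \<open>\<mu>\<close>, where it lengthens \<open>ws\<close>; both preserve the lower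
  bound on \<open>M\<close>. Once no derivative is left, this bound lets the weight absorb the
  negative power in the interior estimate, applied with the radius
  \<open>c * \<bar>r x\<bar>\<close>.\<close>

lemma weighted_estimate:
  assumes c: "c > 0" and ball: "\<And>x. x \<in> S \<Longrightarrow> x \<in> K \<Longrightarrow> c * \<bar>r x\<bar> \<le> 1 \<and> cball x (c * \<bar>r x\<bar>) \<subseteq> S"
  shows "H \<in> bounded_smooth S K \<Longrightarrow> M \<ge> DIM(complex ^ 'n) + k + length ws + length vs \<Longrightarrow>
    \<exists>C\<ge>0. \<forall>\<mu>\<in>conj_bergman_space S. \<forall>x\<in>S.
      cmod (iter_deriv vs (\<lambda>x. R x ^ M * H x * iter_deriv ws \<mu> x) x) \<le> C * neg_sobolev_norm k S \<mu>"
proof (induction vs arbitrary: M H ws rule: rev_induct)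
  case Nil
  define N where "N = DIM(complex ^ 'n) + k + length ws"
  obtain A where A: "A \<ge> 0" "\<And>\<mu> z r. \<mu> \<in> conj_bergman_space S \<Longrightarrow> 0 < r \<Longrightarrow> r \<le> 1 \<Longrightarrow> cball z r \<subseteq> S \<Longrightarrow>
      cmod (iter_deriv ws \<mu> z) * r ^ N \<le> A * neg_sobolev_norm k S \<mu>"
    using conj_bergman_interior_estimate[OF S bS, of ws k] unfolding N_def by blast
  obtain B where B: "B \<ge> 0" "\<And>x. x \<in> S \<Longrightarrow> cmod (R x ^ (M - N) * H x) \<le> B"
    using bounded_smooth_bound[OF R_power_mult[OF Nil(1), of "M - N"], of "[]"] by auto
  \<comment> \<open>\<open>N\<close> of the powers pay for the interior estimate, and the other
    \<open>M - N\<close> stay with the bounded coefficient.\<close>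
  have M: "M = N + (M - N)" using Nil(2) by (simp add: N_def)
  have "cmod (R x ^ M * H x * iter_deriv ws \<mu> x) \<le> B * A / c ^ N * neg_sobolev_norm k S \<mu>"
    if \<mu>: "\<mu> \<in> conj_bergman_space S" and x: "x \<in> S" for \<mu> x
  proof (cases "x \<in> K")
    case True
    then have rx: "\<bar>r x\<bar> > 0" using r_neg[OF x] by simp
    have "cmod (iter_deriv ws \<mu> x) * (c * \<bar>r x\<bar>) ^ N \<le> A * neg_sobolev_norm k S \<mu>"
      using ball[OF x True] c rx by (intro A(2)[OF \<mu>]) auto
    then have 1: "\<bar>r x\<bar> ^ N * cmod (iter_deriv ws \<mu> x) \<le> A * neg_sobolev_norm k S \<mu> / c ^ N"
      using c by (simp add: power_mult_distrib field_simps)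
    have "cmod (R x ^ M * H x * iter_deriv ws \<mu> x) =
        cmod (R x ^ (M - N) * H x) * (\<bar>r x\<bar> ^ N * cmod (iter_deriv ws \<mu> x))"
      by (subst M) (simp add: power_add norm_mult norm_power mult_ac)
    also have "\<dots> \<le> B * (A * neg_sobolev_norm k S \<mu> / c ^ N)"
      using B x 1 by (intro mult_mono) auto
    finally show ?thesis by simp
  next
    case False
    then show ?thesis
      using off_K(1)[OF Nil(1) x] A B c neg_sobolev_norm_nonneg[OF S bS conj_bergman_L2[OF \<mu>], of k] by simp
  qed
  moreover have "B * A / c ^ N \<ge> 0" using A B c by simp
  ultimately show ?case by auto
next
  case (snoc v vs)
  then obtain m where m: "M = Suc m" by (cases M) auto
  \<comment> \<open>The derivative of \<open>R ^ M * H\<close> with the common factor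
    \<open>R ^ m\<close> taken out; as \<open>M = Suc m\<close>, one \<open>R\<close> is left over
    in the summand where \<open>H\<close> is differentiated.\<close>
  define H2 where "H2 x = of_nat M * (H x * dir_deriv v R x) + R x * dir_deriv v H x" for x
  have dH: "dir_deriv v H \<in> bounded_smooth S K"
    by (rule bounded_smooth_dir_deriv[OF S closed_K snoc.prems(1)])
  have H2: "H2 \<in> bounded_smooth S K"
    unfolding H2_def
    using R_power_mult[OF dH, of 1]
    by (intro bounded_smooth_add[OF S] bounded_smooth_scale[OF S]
        bounded_smooth_mult_local[OF S snoc.prems(1) K(1) U K(2) smooth_on_dir_deriv[OF smooth_R]]) simp
  obtain C1 where C1: "C1 \<ge> 0" "\<And>\<mu> x. \<mu> \<in> conj_bergman_space S \<Longrightarrow> x \<in> S \<Longrightarrow>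
      cmod (iter_deriv vs (\<lambda>x. R x ^ m * H2 x * iter_deriv ws \<mu> x) x) \<le> C1 * neg_sobolev_norm k S \<mu>"
    using snoc.IH[OF H2, of ws m] snoc.prems(2) m by auto
  obtain C2 where C2: "C2 \<ge> 0" "\<And>\<mu> x. \<mu> \<in> conj_bergman_space S \<Longrightarrow> x \<in> S \<Longrightarrow>
      cmod (iter_deriv vs (\<lambda>x. R x ^ M * H x * iter_deriv (v # ws) \<mu> x) x) \<le> C2 * neg_sobolev_norm k S \<mu>"
    using snoc.IH[OF snoc.prems(1), of "v # ws" M] snoc.prems(2) by auto
  have "cmod (iter_deriv (vs @ [v]) (\<lambda>x. R x ^ M * H x * iter_deriv ws \<mu> x) x) \<le> (C1 + C2) * neg_sobolev_norm k S \<mu>"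
    if \<mu>: "\<mu> \<in> conj_bergman_space S" and x: "x \<in> S" for \<mu> x
  proof -
    note s\<mu> = conj_bergman_smooth[OF S bS \<mu>]
    have s1: "smooth_on S (\<lambda>x. R x ^ m * H2 x * iter_deriv ws \<mu> x)"
      by (intro smooth_on_mult[OF S] bounded_smoothD(1)[OF R_power_mult[OF H2]] smooth_on_iter_deriv[OF s\<mu>])
    have s2: "smooth_on S (\<lambda>x. R x ^ M * H x * iter_deriv (v # ws) \<mu> x)"
      by (rule smooth_on_mult[OF S bounded_smoothD(1)[OF R_power_mult[OF snoc.prems(1)]] smooth_on_iter_deriv[OF s\<mu>]])
    have eq: "dir_deriv v (\<lambda>x. R x ^ M * H x * iter_deriv ws \<mu> x) y =
        R y ^ m * H2 y * iter_deriv ws \<mu> y + R y ^ M * H y * iter_deriv (v # ws) \<mu> y" if y: "y \<in> S" for y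
    proof -
      have d: "dir_deriv v (\<lambda>x. R x ^ M * H x) y = R y ^ m * H2 y"
      proof (cases "y \<in> K")
        case True
        then have yU: "y \<in> U" using K by blast
        have dR: "R differentiable (at y)" using smooth_on_differentiable[OF smooth_R yU] .
        have dp: "dir_deriv v (\<lambda>x. R x ^ M) y = of_nat M * R y ^ m * dir_deriv v R y"
          unfolding m by (rule dir_deriv_eq)
            (rule has_derivative_eq_rhs[OF has_derivative_power[OF differentiable_has_dir_deriv[OF dR]]],
              auto simp: mult_ac)
        have dpow: "(\<lambda>x. R x ^ M) differentiable (at y)"
          using has_derivative_power[OF differentiable_has_dir_deriv[OF dR]] unfolding differentiable_def by blast
        have "dir_deriv v (\<lambda>x. R x ^ M * H x) y = R y ^ M * dir_deriv v H y + dir_deriv v (\<lambda>x. R x ^ M) y * H y"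
          by (rule dir_deriv_mult[OF dpow smooth_on_differentiable[OF bounded_smoothD(1)[OF snoc.prems(1)] y]])
        then show ?thesis
          unfolding dp H2_def by (simp add: m algebra_simps del: of_nat_Suc)
      next
        case False
        then show ?thesis
          using off_K(2)[OF R_power_mult[OF snoc.prems(1)] y False] off_K(1)[OF H2 y False] by simp
      qed
      have "dir_deriv v (\<lambda>x. R x ^ M * H x * iter_deriv ws \<mu> x) y =
          R y ^ M * H y * dir_deriv v (iter_deriv ws \<mu>) y + dir_deriv v (\<lambda>x. R x ^ M * H x) y * iter_deriv ws \<mu> y"
        by (rule dir_deriv_mult[OF smooth_on_differentiable[OF bounded_smoothD(1)[OF R_power_mult[OF snoc.prems(1)]] y]
              smooth_on_differentiable[OF smooth_on_iter_deriv[OF s\<mu>] y]])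
      then show ?thesis
        unfolding d iter_deriv_Cons by (simp add: add.commute)
    qed
    have "iter_deriv (vs @ [v]) (\<lambda>x. R x ^ M * H x * iter_deriv ws \<mu> x) x =
        iter_deriv vs (\<lambda>x. R x ^ m * H2 x * iter_deriv ws \<mu> x + R x ^ M * H x * iter_deriv (v # ws) \<mu> x) x"
      unfolding iter_deriv_snoc by (rule iter_deriv_cong_open[OF S eq x])
    also have "\<dots> = iter_deriv vs (\<lambda>x. R x ^ m * H2 x * iter_deriv ws \<mu> x) x +
        iter_deriv vs (\<lambda>x. R x ^ M * H x * iter_deriv (v # ws) \<mu> x) x"
      by (rule iter_deriv_add[OF S s1 s2 x])
    finally show ?thesis
      using C1(2)[OF \<mu> x] C2(2)[OF \<mu> x]
      by (simp only: distrib_right) (rule norm_triangle_le, rule add_mono)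
  qed
  then show ?case using C1(1) C2(1) by (intro exI[of _ "C1 + C2"]) auto
qed

end

section \<open>Reduction to smooth data\<close>

text \<open>Equal pairings with the Bergman space make the projections of \<open>f\<close> and
  \<open>F\<close> coincide, while \<open>F\<close>, unlike \<open>f\<close>, comes with bounds on
  its derivatives.\<close>

definition reduces_to ::
    "(complex ^ 'n) set \<Rightarrow> nat \<Rightarrow> (complex ^ 'n \<Rightarrow> complex) \<Rightarrow> real \<Rightarrow> (complex ^ 'n \<Rightarrow> complex) \<Rightarrow> bool" where
  "reduces_to S l f A F \<longleftrightarrow> smooth_on S F \<and>
     (\<forall>vs. set vs \<subseteq> Basis \<longrightarrow> length vs \<le> l \<longrightarrow> (\<forall>x\<in>S. cmod (iter_deriv vs F x) \<le> A)) \<and>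
     (\<forall>u\<in>bergman_space S. l2_inner S f u = l2_inner S F u)"

lemma reduces_toD:
  assumes "reduces_to S l f A F"
  shows "smooth_on S F"
    "set vs \<subseteq> Basis \<Longrightarrow> length vs \<le> l \<Longrightarrow> x \<in> S \<Longrightarrow> cmod (iter_deriv vs F x) \<le> A"
    "u \<in> bergman_space S \<Longrightarrow> l2_inner S f u = l2_inner S F u"
  using assms by (auto simp: reduces_to_def)

text \<open>The constant precedes \<open>\<mu>\<close>, while \<open>F\<close> may depend on it.
  This uniform statement is additive in \<open>G\<close> and can therefore be proved
  locally.\<close>

definition reducible :: "(complex ^ 'n) set \<Rightarrow> nat \<Rightarrow> nat \<Rightarrow> (complex ^ 'n \<Rightarrow> complex) \<Rightarrow> bool" where
  "reducible S k l G \<longleftrightarrow> (\<exists>C\<ge>0. \<forall>\<mu>\<in>conj_bergman_space S.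
     \<exists>F. reduces_to S l (\<lambda>z. \<mu> z * G z) (C * neg_sobolev_norm k S \<mu>) F)"

text \<open>Pairing \<open>\<mu> G\<close> with \<open>u\<close> integrates \<open>G\<close> against
  this product, which is the function \<open>w\<close> of the integrations by parts. Its factors are
  square integrable and annihilated by the same operator.\<close>

lemma conj_bergman_mult:
  assumes S: "open S" "bounded S" and \<mu>: "\<mu> \<in> conj_bergman_space S" and u: "u \<in> bergman_space S"
  shows "smooth_on S (\<lambda>x. \<mu> x * cnj (u x))" "x \<in> S \<Longrightarrow> wirtinger v (\<lambda>x. \<mu> x * cnj (u x)) x = 0"
    "integrable (lebesgue_on S) (\<lambda>x. \<mu> x * cnj (u x))"
proof -
  have cu: "(\<lambda>x. cnj (u x)) \<in> conj_bergman_space S"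
    using u by (simp add: conj_bergman_space_def)
  note s = conj_bergman_smooth[OF S \<mu>] conj_bergman_smooth[OF S cu]
  show "smooth_on S (\<lambda>x. \<mu> x * cnj (u x))" by (rule smooth_on_mult[OF S(1) s])
  show "wirtinger v (\<lambda>x. \<mu> x * cnj (u x)) x = 0" if "x \<in> S"
    using wirtinger_conj_bergman[OF \<mu> S that] wirtinger_conj_bergman[OF cu S that]
    by (simp add: wirtinger_mult[OF smooth_on_differentiable[OF s(1) that] smooth_on_differentiable[OF s(2) that]])
  show "integrable (lebesgue_on S) (\<lambda>x. \<mu> x * cnj (u x))"
    by (rule L2_mult_integrable(1)[OF conj_bergman_L2[OF \<mu>] conj_bergman_L2[OF cu]])
qed

lemma reduces_to_L2:
  assumes S: "open S" "bounded S" and F: "reduces_to S l f A F"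
  shows "F \<in> L2 S"
  using reduces_toD(2)[OF F, of "[]"]
  by (intro L2_bounded(1)[OF S smooth_on_borel_measurable[OF S(1) reduces_toD(1)[OF F]]]) auto

section \<open>Linearity of reductions\<close>

lemma l2_inner_add:
  assumes "f \<in> L2 S" "g \<in> L2 S" "u \<in> L2 S"
  shows "l2_inner S (\<lambda>z. f z + g z) u = l2_inner S f u + l2_inner S g u"
  unfolding l2_inner_def distrib_right
  by (rule Bochner_Integration.integral_add[OF L2_mult_integrable(1)[OF assms(1) L2_cnj[OF assms(3)]]
        L2_mult_integrable(1)[OF assms(2) L2_cnj[OF assms(3)]]])

lemma l2_inner_diff:
  assumes "f \<in> L2 S" "g \<in> L2 S" "u \<in> L2 S"
  shows "l2_inner S (\<lambda>z. f z - g z) u = l2_inner S f u - l2_inner S g u"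
  unfolding l2_inner_def left_diff_distrib
  by (rule Bochner_Integration.integral_diff[OF L2_mult_integrable(1)[OF assms(1) L2_cnj[OF assms(3)]]
        L2_mult_integrable(1)[OF assms(2) L2_cnj[OF assms(3)]]])

lemma conj_bergman_times_bounded_smooth_L2:
  assumes S: "open S" and \<mu>: "\<mu> \<in> conj_bergman_space S" and G: "G \<in> bounded_smooth S K"
  shows "(\<lambda>z. \<mu> z * G z) \<in> L2 S"
proof -
  obtain B where "\<And>x. x \<in> S \<Longrightarrow> cmod (G x) \<le> B"
    using bounded_smooth_bound[OF G, of "[]"] by auto
  then show ?thesis
    by (rule L2_mult_bounded[OF smooth_on_borel_measurable[OF S bounded_smoothD(1)[OF G]] _ conj_bergman_L2[OF \<mu>]])
qed

lemma reducible_add: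
  assumes S: "open S" "bounded S" and G: "G \<in> bounded_smooth S K" "H \<in> bounded_smooth S L"
    and red: "reducible S k l G" "reducible S k l H"
  shows "reducible S k l (\<lambda>x. G x + H x)"
proof -
  obtain C1 where C1: "C1 \<ge> 0" "\<And>\<mu>. \<mu> \<in> conj_bergman_space S \<Longrightarrow>
      \<exists>F. reduces_to S l (\<lambda>z. \<mu> z * G z) (C1 * neg_sobolev_norm k S \<mu>) F"
    using red(1) unfolding reducible_def by blast
  obtain C2 where C2: "C2 \<ge> 0" "\<And>\<mu>. \<mu> \<in> conj_bergman_space S \<Longrightarrow>
      \<exists>F. reduces_to S l (\<lambda>z. \<mu> z * H z) (C2 * neg_sobolev_norm k S \<mu>) F"
    using red(2) unfolding reducible_def by blast
  show ?thesis
    unfolding reducible_def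
  proof (intro exI[of _ "C1 + C2"] conjI ballI)
    show "0 \<le> C1 + C2" using C1 C2 by simp
    fix \<mu> assume \<mu>: "\<mu> \<in> conj_bergman_space S"
    obtain F1 where F1: "reduces_to S l (\<lambda>z. \<mu> z * G z) (C1 * neg_sobolev_norm k S \<mu>) F1"
      using C1(2)[OF \<mu>] by blast
    obtain F2 where F2: "reduces_to S l (\<lambda>z. \<mu> z * H z) (C2 * neg_sobolev_norm k S \<mu>) F2"
      using C2(2)[OF \<mu>] by blast
    note L = reduces_to_L2[OF S F1] reduces_to_L2[OF S F2]
    note sm = reduces_toD(1)[OF F1] reduces_toD(1)[OF F2]
    have "reduces_to S l (\<lambda>z. \<mu> z * (G z + H z)) ((C1 + C2) * neg_sobolev_norm k S \<mu>) (\<lambda>x. F1 x + F2 x)"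
      unfolding reduces_to_def
    proof (intro conjI ballI allI impI)
      show "smooth_on S (\<lambda>x. F1 x + F2 x)" by (rule smooth_on_add[OF S(1) sm])
      show "cmod (iter_deriv vs (\<lambda>x. F1 x + F2 x) x) \<le> (C1 + C2) * neg_sobolev_norm k S \<mu>"
        if "set vs \<subseteq> Basis" "length vs \<le> l" "x \<in> S" for vs x
        unfolding iter_deriv_add[OF S(1) sm that(3)] distrib_right
        by (rule norm_triangle_le[OF add_mono[OF reduces_toD(2)[OF F1 that] reduces_toD(2)[OF F2 that]]])
      show "l2_inner S (\<lambda>z. \<mu> z * (G z + H z)) u = l2_inner S (\<lambda>x. F1 x + F2 x) u"
        if u: "u \<in> bergman_space S" for u
      proof -
        have uL: "u \<in> L2 S" using u by (simp add: bergman_space_def)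
        show ?thesis
          unfolding distrib_left l2_inner_add[OF L uL]
            l2_inner_add[OF conj_bergman_times_bounded_smooth_L2[OF S(1) \<mu> G(1)]
              conj_bergman_times_bounded_smooth_L2[OF S(1) \<mu> G(2)] uL]
          using reduces_toD(3)[OF F1 u] reduces_toD(3)[OF F2 u] by simp
      qed
    qed
    then show "\<exists>F. reduces_to S l (\<lambda>z. \<mu> z * (G z + H z)) ((C1 + C2) * neg_sobolev_norm k S \<mu>) F"
      by blast
  qed
qed

lemma l2_inner_cong: "(\<And>x. x \<in> S \<Longrightarrow> f x = g x) \<Longrightarrow> l2_inner S f u = l2_inner S g u"
  unfolding l2_inner_def by (rule Bochner_Integration.integral_cong) auto

lemma reducible_zero:
  assumes "\<And>x. x \<in> S \<Longrightarrow> G x = 0"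
  shows "reducible S k l G"
  unfolding reducible_def
proof (intro exI[of _ 0] conjI ballI)
  fix \<mu> assume "\<mu> \<in> conj_bergman_space S"
  show "\<exists>F. reduces_to S l (\<lambda>z. \<mu> z * G z) (0 * neg_sobolev_norm k S \<mu>) F"
    unfolding reduces_to_def
    using assms by (intro exI[of _ "\<lambda>x. 0"]) (auto simp: iter_deriv_zero intro: l2_inner_cong)
qed simp

lemma reducible_cong:
  assumes "reducible S k l G" "\<And>x. x \<in> S \<Longrightarrow> G x = H x"
  shows "reducible S k l H"
proof -
  have "l2_inner S (\<lambda>z. \<mu> z * G z) u = l2_inner S (\<lambda>z. \<mu> z * H z) u" for \<mu> u
    by (rule l2_inner_cong) (simp add: assms(2))
  with assms(1) show ?thesis by (simp add: reducible_def reduces_to_def)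
qed

section \<open>Reductions near a point of the closure\<close>

context boundary_chart
begin

text \<open>The replacement is \<open>R ^ M * H * \<mu>\<close>. Its derivatives up to order
  \<open>l\<close> are indexed by finitely many basis lists, so the constants of
  \<open>weighted_estimate\<close> can be summed.\<close>

lemma reducible_power_form:
  assumes c: "c > 0" and ball: "\<And>x. x \<in> S \<Longrightarrow> x \<in> K \<Longrightarrow> c * \<bar>r x\<bar> \<le> 1 \<and> cball x (c * \<bar>r x\<bar>) \<subseteq> S"
    and H: "H \<in> bounded_smooth S K" and M: "M \<ge> DIM(complex ^ 'n) + k + l"
    and eq: "\<And>\<mu> u. \<mu> \<in> conj_bergman_space S \<Longrightarrow> u \<in> bergman_space S \<Longrightarrow>
      (LINT x|lebesgue_on S. G x * (\<mu> x * cnj (u x))) = (LINT x|lebesgue_on S. R x ^ M * H x * (\<mu> x * cnj (u x)))"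
  shows "reducible S k l G"
proof -
  define W where "W = {vs. set vs \<subseteq> (Basis :: (complex ^ 'n) set) \<and> length vs \<le> l}"
  have fin: "finite W" unfolding W_def by (rule finite_lists_length_le) simp
  have "\<exists>C\<ge>0. \<forall>\<mu>\<in>conj_bergman_space S. \<forall>x\<in>S.
      cmod (iter_deriv vs (\<lambda>x. R x ^ M * H x * \<mu> x) x) \<le> C * neg_sobolev_norm k S \<mu>" if "vs \<in> W" for vs
    using weighted_estimate[OF c ball H, of k "[]" vs M] that M by (simp add: W_def)
  then have "\<forall>vs\<in>W. \<exists>C. C \<ge> 0 \<and> (\<forall>\<mu>\<in>conj_bergman_space S. \<forall>x\<in>S.
      cmod (iter_deriv vs (\<lambda>x. R x ^ M * H x * \<mu> x) x) \<le> C * neg_sobolev_norm k S \<mu>)"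
    by blast
  from bchoice[OF this] obtain C where C: "\<And>vs. vs \<in> W \<Longrightarrow> C vs \<ge> 0"
    "\<And>vs \<mu> x. vs \<in> W \<Longrightarrow> \<mu> \<in> conj_bergman_space S \<Longrightarrow> x \<in> S \<Longrightarrow>
      cmod (iter_deriv vs (\<lambda>x. R x ^ M * H x * \<mu> x) x) \<le> C vs * neg_sobolev_norm k S \<mu>"
    by blast
  show ?thesis
    unfolding reducible_def
  proof (intro exI[of _ "sum C W"] conjI ballI)
    show "sum C W \<ge> 0" using C(1) by (rule sum_nonneg)
    fix \<mu> assume \<mu>: "\<mu> \<in> conj_bergman_space S"
    have "reduces_to S l (\<lambda>z. \<mu> z * G z) (sum C W * neg_sobolev_norm k S \<mu>) (\<lambda>x. R x ^ M * H x * \<mu> x)"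
      unfolding reduces_to_def
    proof (intro conjI ballI allI impI)
      show "smooth_on S (\<lambda>x. R x ^ M * H x * \<mu> x)"
        by (rule smooth_on_mult[OF S bounded_smoothD(1)[OF R_power_mult[OF H]] conj_bergman_smooth[OF S bS \<mu>]])
      show "cmod (iter_deriv vs (\<lambda>x. R x ^ M * H x * \<mu> x) x) \<le> sum C W * neg_sobolev_norm k S \<mu>"
        if "set vs \<subseteq> Basis" "length vs \<le> l" "x \<in> S" for vs x
      proof -
        have vs: "vs \<in> W" using that by (simp add: W_def)
        have "C vs \<le> sum C W" using C(1) by (intro member_le_sum fin vs) auto
        then have "C vs * neg_sobolev_norm k S \<mu> \<le> sum C W * neg_sobolev_norm k S \<mu>"
          by (rule mult_right_mono[OF _ neg_sobolev_norm_nonneg[OF S bS conj_bergman_L2[OF \<mu>]]])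
        with C(2)[OF vs \<mu> that(3)] show ?thesis by linarith
      qed
      show "l2_inner S (\<lambda>z. \<mu> z * G z) u = l2_inner S (\<lambda>x. R x ^ M * H x * \<mu> x) u"
        if u: "u \<in> bergman_space S" for u
        using eq[OF \<mu> u] by (simp add: l2_inner_def mult_ac)
    qed
    then show "\<exists>F. reduces_to S l (\<lambda>z. \<mu> z * G z) (sum C W * neg_sobolev_norm k S \<mu>) F"
      by blast
  qed
qed

lemma reducible_boundary:
  assumes c: "c > 0" and ball: "\<And>x. x \<in> S \<Longrightarrow> x \<in> K \<Longrightarrow> c * \<bar>r x\<bar> \<le> 1 \<and> cball x (c * \<bar>r x\<bar>) \<subseteq> S"
    and v: "\<And>x. x \<in> U \<Longrightarrow> wirtinger v R x \<noteq> 0" and G: "G \<in> bounded_smooth S K"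
  shows "reducible S k l G"
proof -
  \<comment> \<open>The three terms pay for the mass of the bump, the order of the dual norm and the
    derivatives of the replacement.\<close>
  define M where "M = DIM(complex ^ 'n) + k + l"
  obtain H where H: "H \<in> bounded_smooth S K" "\<And>w. smooth_on S w \<Longrightarrow> \<forall>x\<in>S. wirtinger v w x = 0 \<Longrightarrow>
      integrable (lebesgue_on S) w \<Longrightarrow>
      (LINT x|lebesgue_on S. G x * w x) = (LINT x|lebesgue_on S. R x ^ M * H x * w x)"
    using gain_powers[OF v G, of M] by blast
  show ?thesis
  proof (rule reducible_power_form[OF c ball H(1)])
    show "DIM(complex ^ 'n) + k + l \<le> M" by (simp add: M_def)
    show "(LINT x|lebesgue_on S. G x * (\<mu> x * cnj (u x))) = (LINT x|lebesgue_on S. R x ^ M * H x * (\<mu> x * cnj (u x)))"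
      if "\<mu> \<in> conj_bergman_space S" "u \<in> bergman_space S" for \<mu> u
      using conj_bergman_mult[OF S bS that] by (intro H(2)) auto
  qed
qed

end

text \<open>Away from the boundary no power has to be gained: for the constant defining function
  \<open>- 1\<close>, a coefficient already has the weighted form as soon as the exponent is
  even.\<close>

lemma reducible_interior_point:
  fixes S :: "(complex ^ 'n) set"
  assumes S: "open S" "bounded S" and p: "p \<in> S"
  obtains e where "e > 0" "\<And>G. G \<in> bounded_smooth S (cball p e) \<Longrightarrow> reducible S k l G"
proof -
  obtain \<delta> where \<delta>: "\<delta> > 0" "cball p \<delta> \<subseteq> S"
    using S(1) p open_contains_cball by blast
  define r :: "complex ^ 'n \<Rightarrow> real" where "r = (\<lambda>x. - 1)"
  interpret boundary_chart S S "cball p (\<delta> / 2)" r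
    using S \<delta> by unfold_locales (auto simp: r_def)
  \<comment> \<open>Doubled so that \<open>(- 1) ^ M = 1\<close>.\<close>
  define M where "M = 2 * (DIM(complex ^ 'n) + k + l)"
  show ?thesis
  proof (rule that[of "\<delta> / 2"])
    show "\<delta> / 2 > 0" using \<delta> by simp
    fix G assume G: "G \<in> bounded_smooth S (cball p (\<delta> / 2))"
    show "reducible S k l G"
    proof (rule reducible_power_form[where c = "min 1 (\<delta> / 2)" and H = G and M = M])
      show "min 1 (\<delta> / 2) > 0" using \<delta> by simp
      show "DIM(complex ^ 'n) + k + l \<le> M" by (simp add: M_def)
      fix x assume x: "x \<in> cball p (\<delta> / 2)"
      have "cball x (min 1 (\<delta> / 2)) \<subseteq> cball p \<delta>"
      proof
        fix y assume "y \<in> cball x (min 1 (\<delta> / 2))"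
        then show "y \<in> cball p \<delta>" using x dist_triangle[of p y x] by simp
      qed
      then show "min 1 (\<delta> / 2) * \<bar>r x\<bar> \<le> 1 \<and> cball x (min 1 (\<delta> / 2) * \<bar>r x\<bar>) \<subseteq> S"
        using \<delta> by (auto simp: r_def)
    qed (use G in \<open>auto simp: r_def M_def power_mult\<close>)
  qed
qed

text \<open>Some directional derivative of \<open>r\<close> is nonzero at \<open>p\<close>, hence
  nearby; it is the real part of the \<open>wirtinger\<close> derivative, which may therefore be
  divided by. A Lipschitz bound on \<open>r\<close> provides balls in \<open>S\<close> whose radius
  is proportional to \<open>\<bar>r x\<bar>\<close>.\<close>

lemma reducible_boundary_point:
  fixes S :: "(complex ^ 'n) set"
  assumes S: "open S" "bounded S" and sb: "smooth_boundary S" and p: "p \<in> frontier S"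
  obtains e where "e > 0" "\<And>G. G \<in> bounded_smooth S (cball p e) \<Longrightarrow> reducible S k l G"
proof -
  obtain U0 and r :: "complex ^ 'n \<Rightarrow> real" where U0: "open U0" "p \<in> U0" "smooth_on U0 r"
    "\<And>x. x \<in> U0 \<Longrightarrow> frechet_derivative r (at x) \<noteq> (\<lambda>v. 0)" "S \<inter> U0 = {x\<in>U0. r x < 0}"
    using bspec[OF sb[unfolded smooth_boundary_def] p] by blast
  obtain v where v: "dir_deriv v r p \<noteq> 0"
    using U0(4)[OF U0(2)] unfolding dir_deriv_def by blast
  have cd: "continuous_on U0 (dir_deriv v r)"
    by (rule smooth_on_continuous[OF smooth_on_dir_deriv[OF U0(3)]])
  define U1 where "U1 = U0 \<inter> dir_deriv v r -` (- {0})"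
  have "open U1"
    unfolding U1_def by (rule continuous_open_preimage[OF cd U0(1)]) auto
  moreover have "p \<in> U1" using U0 v by (simp add: U1_def)
  ultimately obtain \<delta> where \<delta>: "\<delta> > 0" "cball p \<delta> \<subseteq> U1"
    using open_contains_cball by blast
  define U where "U = ball p \<delta>"
  have UU0: "U \<subseteq> U0" "cball p \<delta> \<subseteq> U0" using \<delta> by (auto simp: U_def U1_def)
  have rU: "smooth_on U r" by (rule smooth_on_subset[OF U0(3) UU0(1)])
  interpret boundary_chart S U "cball p (\<delta> / 4)" r
  proof
    show "S \<inter> U = {x \<in> U. r x < 0}" using U0(5) UU0(1) by blast
    show "cball p (\<delta> / 4) \<subseteq> U" using \<delta> by (auto simp: U_def)
  qed (use S rU in \<open>auto simp: U_def\<close>)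
  have nz: "wirtinger v R x \<noteq> 0" if "x \<in> U" for x
  proof -
    have d: "r differentiable (at x)" by (rule smooth_on_differentiable[OF rU that])
    have "Re (wirtinger v R x) = dir_deriv v r x"
      by (simp add: wirtinger_def dir_deriv_bounded_linear[OF bounded_linear_of_real d])
    moreover have "dir_deriv v r x \<noteq> 0"
      using subsetD[OF \<delta>(2), of x] that by (simp add: U_def U1_def)
    ultimately show ?thesis by (metis zero_complex.simps(1))
  qed
  obtain L where L: "L \<ge> 0" "\<And>x y. x \<in> cball p (\<delta> / 2) \<Longrightarrow> y \<in> cball p (\<delta> / 2) \<Longrightarrow> \<bar>r y - r x\<bar> \<le> L * norm (y - x)"
  proof -
    \<comment> \<open>Multiplying by a bump turns \<open>r\<close> into a smooth function with
      compact support, so its derivative is bounded and gives a Lipschitz constant; on the ball of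
      radius \<open>\<delta> / 2\<close> nothing has changed.\<close>
    define g where "g x = (if x \<in> U0 then bump p \<delta> x * r x else 0)" for x
    have g: "smooth_on UNIV g"
      unfolding g_def
      by (rule smooth_on_extend_zero[OF U0(1) compact_cball UU0(2)
            smooth_on_mult[OF U0(1) smooth_on_subset[OF smooth_on_bump subset_UNIV] U0(3)]])
        (simp add: bump_compact_support[OF \<delta>(1)])
    have g0: "g x = 0" if "x \<notin> cball p \<delta>" for x
      using bump_compact_support[OF \<delta>(1) that] by (simp add: g_def)
    obtain B where B: "B \<ge> 0" "\<And>x w. norm (dir_deriv w g x) \<le> B * norm w"
      using smooth_compact_support_deriv_bound[OF g compact_cball[of p \<delta>]] g0 by blast
    have lip: "norm (g y - g x) \<le> B * norm (y - x)" for x y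
    proof (rule differentiable_bound[where S = UNIV])
      show "(g has_derivative (\<lambda>w. dir_deriv w g x)) (at x within UNIV)" for x
        using differentiable_has_dir_deriv[OF smooth_on_differentiable[OF g]] by simp
      show "onorm (\<lambda>w. dir_deriv w g x) \<le> B" for x
        using B(2) by (rule onorm_le)
    qed auto
    have "g x = r x" if "x \<in> cball p (\<delta> / 2)" for x
    proof -
      have "x \<in> U0" using that \<delta> UU0(2) by auto
      then show ?thesis using that bump_eq_1[OF \<delta>(1), of p x] by (simp add: g_def)
    qed
    with lip B(1) show ?thesis by (intro that[of B]) (metis real_norm_def)+
  qed
  obtain A where A: "A \<ge> 0" "\<And>x. x \<in> cball p (\<delta> / 4) \<Longrightarrow> \<bar>r x\<bar> \<le> A"
  proof -
    have "continuous_on (cball p (\<delta> / 4)) r"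
      using smooth_on_continuous[OF rU] K(2) by (rule continuous_on_subset)
    from continuous_compact_support_bounded[OF this compact_cball, of "cball p (\<delta> / 4)"]
    obtain A where "A \<ge> 0" "\<And>x. x \<in> cball p (\<delta> / 4) \<Longrightarrow> norm (r x) \<le> A" by auto
    then show ?thesis by (intro that[of A]) auto
  qed
  \<comment> \<open>The bound \<open>1 / (L + 1)\<close> gives \<open>L * c < 1\<close>, so
    \<open>r\<close> stays negative on the ball of radius \<open>c * \<bar>r x\<bar>\<close>. The
    other bound makes this radius at most \<open>1\<close> and at most \<open>\<delta> / 4\<close>,
    so that the ball stays within \<open>\<delta> / 2\<close> of \<open>p\<close>, where the
    Lipschitz bound holds.\<close>
  define c where "c = min (1 / (L + 1)) (min 1 (\<delta> / 4) / (A + 1))"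
  have c: "c > 0" using L A \<delta> by (simp add: c_def)
  show ?thesis
  proof (rule that[of "\<delta> / 4"])
    show "\<delta> / 4 > 0" using \<delta> by simp
    show "reducible S k l G" if G: "G \<in> bounded_smooth S (cball p (\<delta> / 4))" for G
    proof (rule reducible_boundary[OF c _ nz G])
      fix x assume x: "x \<in> S" "x \<in> cball p (\<delta> / 4)"
      have rx: "r x < 0" by (rule r_neg[OF x])
      have "c * \<bar>r x\<bar> \<le> (min 1 (\<delta> / 4) / (A + 1)) * (A + 1)"
        using A(2)[OF x(2)] A(1) \<delta> by (intro mult_mono) (auto simp: c_def)
      then have small: "c * \<bar>r x\<bar> \<le> min 1 (\<delta> / 4)"
        using A(1) by simp
      have "cball x (c * \<bar>r x\<bar>) \<subseteq> S"
      proof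
        fix y assume y: "y \<in> cball x (c * \<bar>r x\<bar>)"
        have y2: "y \<in> cball p (\<delta> / 2)"
          using y small x(2) dist_triangle[of p y x] by simp
        have "\<bar>r y - r x\<bar> \<le> L * norm (y - x)"
          using x(2) y2 \<delta>(1) by (intro L(2)) auto
        also have "\<dots> \<le> L * (c * \<bar>r x\<bar>)"
          using y L(1) by (intro mult_left_mono) (auto simp: dist_norm norm_minus_commute)
        also have "\<dots> = (L * c) * \<bar>r x\<bar>" by simp
        also have "L * c < 1"
        proof -
          have "L * c \<le> L * (1 / (L + 1))" using L(1) by (intro mult_left_mono) (auto simp: c_def)
          also have "\<dots> < 1" using L(1) by (simp add: field_simps)
          finally show ?thesis .
        qed
        then have "(L * c) * \<bar>r x\<bar> < 1 * \<bar>r x\<bar>"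
          using rx by (intro mult_strict_right_mono) auto
        finally have "r y < 0" using rx by linarith
        moreover have "y \<in> U" using y2 \<delta>(1) by (auto simp: U_def)
        ultimately show "y \<in> S" using SU by blast
      qed
      with small show "c * \<bar>r x\<bar> \<le> 1 \<and> cball x (c * \<bar>r x\<bar>) \<subseteq> S" by simp
    qed
  qed
qed

text \<open>One bump is split off from \<open>G\<close> at a time. The remainder
  \<open>(1 - bump) * G\<close> vanishes where the bump is \<open>1\<close>, in particular on the
  ball of half radius, and so satisfies the support condition for the smaller cover.\<close>

lemma reducible_finite_cover:
  fixes S :: "(complex ^ 'n) set"
  assumes S: "open S" "bounded S" and P: "finite P"
    and e: "\<And>p. p \<in> P \<Longrightarrow> e p > 0"
      "\<And>p G. p \<in> P \<Longrightarrow> G \<in> bounded_smooth S (cball p (e p)) \<Longrightarrow> reducible S k l G"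
  shows "G \<in> bounded_smooth S UNIV \<Longrightarrow> (\<And>x. x \<in> S \<Longrightarrow> x \<notin> (\<Union>p\<in>P. cball p (e p / 2)) \<Longrightarrow> G x = 0) \<Longrightarrow>
    reducible S k l G"
  using P e
proof (induction P arbitrary: G rule: finite_induct)
  case empty
  then show ?case by (intro reducible_zero) auto
next
  case (insert p P)
  let ?b = "\<lambda>x. complex_of_real (bump p (e p) x)"
  have ep: "e p > 0" using insert.prems by simp
  have b: "?b \<in> bounded_smooth S (cball p (e p))"
    by (rule bounded_smooth_compact_support[OF smooth_on_of_real[OF open_UNIV smooth_on_bump] compact_cball])
      (simp add: bump_compact_support[OF ep])
  have bG: "(\<lambda>x. ?b x * G x) \<in> bounded_smooth S (cball p (e p))"
    using bounded_smooth_mult[OF S(1) b insert.prems(1)] by simp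
  have "(\<lambda>x. G x + - 1 * (?b x * G x)) \<in> bounded_smooth S UNIV"
    by (intro bounded_smooth_add[OF S(1)] bounded_smooth_scale[OF S(1)] insert.prems(1)
        bounded_smooth_mono[OF bG]) simp
  then have cG: "(\<lambda>x. (1 - ?b x) * G x) \<in> bounded_smooth S UNIV"
    by (simp add: algebra_simps)
  have "reducible S k l (\<lambda>x. (1 - ?b x) * G x)"
  proof (rule insert.IH[OF cG])
    show "(1 - ?b x) * G x = 0" if x: "x \<in> S" "x \<notin> (\<Union>p\<in>P. cball p (e p / 2))" for x
    proof (cases "x \<in> cball p (e p / 2)")
      case True
      then show ?thesis using bump_eq_1[OF ep, of p x] by simp
    next
      case False
      then show ?thesis using insert.prems(2)[OF x(1)] x(2) by simp
    qed
  qed (use insert.prems in auto)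
  moreover have "reducible S k l (\<lambda>x. ?b x * G x)"
    using insert.prems(4) bG by blast
  ultimately have "reducible S k l (\<lambda>x. ?b x * G x + (1 - ?b x) * G x)"
    by (intro reducible_add[OF S bG cG])
  then show ?case
    by (rule reducible_cong) (simp add: algebra_simps)
qed

text \<open>Compactness of the closure leaves finitely many local cases. The cover uses half radii,
  since that is where the bumps equal \<open>1\<close>.\<close>

lemma reducible_bounded_smooth:
  fixes S :: "(complex ^ 'n) set"
  assumes S: "open S" "bounded S" and sb: "smooth_boundary S" and G: "G \<in> bounded_smooth S UNIV"
  shows "reducible S k l G"
proof -
  have "\<exists>e>0. \<forall>G\<in>bounded_smooth S (cball p e). reducible S k l G" if p: "p \<in> closure S" for p
  proof (cases "p \<in> S")
    case True
    then show ?thesis using reducible_interior_point[OF S True] by metis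
  next
    case False
    then have "p \<in> frontier S" using p S(1) by (simp add: frontier_def interior_open)
    then show ?thesis using reducible_boundary_point[OF S sb] by metis
  qed
  then obtain e where e: "\<And>p. p \<in> closure S \<Longrightarrow> e p > 0"
    "\<And>p G. p \<in> closure S \<Longrightarrow> G \<in> bounded_smooth S (cball p (e p)) \<Longrightarrow> reducible S k l G"
    by metis
  have "compact (closure S)" using S(2) by (simp add: compact_closure)
  then obtain P where P: "P \<subseteq> closure S" "finite P" "closure S \<subseteq> (\<Union>p\<in>P. ball p (e p / 2))"
  proof (rule compactE_image)
    show "closure S \<subseteq> (\<Union>p\<in>closure S. ball p (e p / 2))"
      using e(1) by force
  qed auto
  show ?thesis
  proof (rule reducible_finite_cover[OF S P(2) _ _ G])
    show "e p > 0" if "p \<in> P" for p using that P(1) e(1) by blast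
    show "reducible S k l G" if "p \<in> P" "G \<in> bounded_smooth S (cball p (e p))" for p G
      using that P(1) e(2) by blast
    show "G x = 0" if x: "x \<in> S" "x \<notin> (\<Union>p\<in>P. cball p (e p / 2))" for x
    proof -
      have "x \<in> (\<Union>p\<in>P. ball p (e p / 2))" using x(1) P(3) closure_subset by blast
      then have "x \<in> (\<Union>p\<in>P. cball p (e p / 2))" using ball_subset_cball by blast
      with x(2) show ?thesis by simp
    qed
  qed
qed

text \<open>Holds regardless of whether the projection exists: the characterising conditions agree.\<close>

lemma bergman_proj_cong:
  assumes "f1 \<in> L2 S" "f2 \<in> L2 S" "\<And>u. u \<in> bergman_space S \<Longrightarrow> l2_inner S f1 u = l2_inner S f2 u"
  shows "bergman_proj S f1 = bergman_proj S f2"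
proof -
  have "l2_inner S (\<lambda>z. f1 z - h z) u = l2_inner S (\<lambda>z. f2 z - h z) u"
    if "h \<in> bergman_space S" "u \<in> bergman_space S" for h u
  proof -
    have "h \<in> L2 S" "u \<in> L2 S" using that by (auto simp: bergman_space_def)
    then show ?thesis using assms that by (simp add: l2_inner_diff)
  qed
  then show ?thesis
    unfolding bergman_proj_def by (intro arg_cong[where f = The] ext) auto
qed

theorem corollary1p4:
  fixes \<Omega> :: "(complex ^ 'n) set"
    and k1 k2 k :: nat
    and g :: "complex ^ 'n \<Rightarrow> complex"
  assumes "bounded_smooth_domain \<Omega>"
    and "\<exists>C>0. \<forall>f\<in>sobolev k1 \<Omega>.
           bergman_proj \<Omega> f \<in> sobolev k2 \<Omega> \<and>
           sobolev_norm k2 \<Omega> (bergman_proj \<Omega> f) \<le> C * sobolev_norm k1 \<Omega> f"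
    and "k \<ge> 1"
    and "smooth_up_to_boundary \<Omega> g"
  shows "\<exists>C>0. \<forall>\<mu>\<in>conj_bergman_space \<Omega>.
           bergman_proj \<Omega> (\<lambda>z. \<mu> z * g z) \<in> sobolev k2 \<Omega> \<and>
           sobolev_norm k2 \<Omega> (bergman_proj \<Omega> (\<lambda>z. \<mu> z * g z)) \<le> C * neg_sobolev_norm k \<Omega> \<mu>"
proof -
  have S: "open \<Omega>" "bounded \<Omega>" and sb: "smooth_boundary \<Omega>"
    using assms(1) by (auto simp: bounded_smooth_domain_def)
  have g: "g \<in> bounded_smooth \<Omega> UNIV"
    by (rule smooth_up_to_boundary_bounded_smooth[OF S(2) assms(4)])
  obtain A where A: "A > 0" "\<And>f. f \<in> sobolev k1 \<Omega> \<Longrightarrow> bergman_proj \<Omega> f \<in> sobolev k2 \<Omega>"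
    "\<And>f. f \<in> sobolev k1 \<Omega> \<Longrightarrow> sobolev_norm k2 \<Omega> (bergman_proj \<Omega> f) \<le> A * sobolev_norm k1 \<Omega> f"
    using assms(2) by blast
  \<comment> \<open>The order of the reduction is \<open>k1\<close>, the regularity of the data in
    the hypothesis on the projection.\<close>
  obtain C where C: "C \<ge> 0" "\<And>\<mu>. \<mu> \<in> conj_bergman_space \<Omega> \<Longrightarrow>
      \<exists>F. reduces_to \<Omega> k1 (\<lambda>z. \<mu> z * g z) (C * neg_sobolev_norm k \<Omega> \<mu>) F"
    using reducible_bounded_smooth[OF S sb g, of k k1] unfolding reducible_def by blast
  \<comment> \<open>The summand \<open>1\<close> keeps \<open>B\<close> positive when the product
    before it vanishes.\<close>
  define B where "B = A * (sobolev_const k1 \<Omega> * C) + 1"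
  have "sobolev_const k1 \<Omega> \<ge> 0" by (simp add: sobolev_const_def)
  then have B: "B > 0" using A C by (simp add: B_def add_nonneg_pos)
  show ?thesis
  proof (intro exI[of _ B] conjI ballI B)
    fix \<mu> assume \<mu>: "\<mu> \<in> conj_bergman_space \<Omega>"
    obtain F where F: "reduces_to \<Omega> k1 (\<lambda>z. \<mu> z * g z) (C * neg_sobolev_norm k \<Omega> \<mu>) F"
      using C(2)[OF \<mu>] by blast
    have n: "neg_sobolev_norm k \<Omega> \<mu> \<ge> 0"
      by (rule neg_sobolev_norm_nonneg[OF S conj_bergman_L2[OF \<mu>]])
    then have Cn: "C * neg_sobolev_norm k \<Omega> \<mu> \<ge> 0" using C(1) by simp
    have FS: "F \<in> sobolev k1 \<Omega>" "sobolev_norm k1 \<Omega> F \<le> sobolev_const k1 \<Omega> * (C * neg_sobolev_norm k \<Omega> \<mu>)"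
      by (rule sobolev_smooth_bounded[OF S reduces_toD(1)[OF F] _ Cn]; rule reduces_toD(2)[OF F]; assumption)+
    have proj: "bergman_proj \<Omega> (\<lambda>z. \<mu> z * g z) = bergman_proj \<Omega> F"
      using FS(1) reduces_toD(3)[OF F]
      by (intro bergman_proj_cong conj_bergman_times_bounded_smooth_L2[OF S(1) \<mu> g]) (auto simp: sobolev_def)
    show "bergman_proj \<Omega> (\<lambda>z. \<mu> z * g z) \<in> sobolev k2 \<Omega>"
      unfolding proj by (rule A(2)[OF FS(1)])
    have "sobolev_norm k2 \<Omega> (bergman_proj \<Omega> F) \<le> A * sobolev_norm k1 \<Omega> F"
      by (rule A(3)[OF FS(1)])
    also have "\<dots> \<le> A * (sobolev_const k1 \<Omega> * (C * neg_sobolev_norm k \<Omega> \<mu>))"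
      using A(1) FS(2) by simp
    also have "\<dots> \<le> B * neg_sobolev_norm k \<Omega> \<mu>"
      using n by (simp add: B_def algebra_simps)
    finally show "sobolev_norm k2 \<Omega> (bergman_proj \<Omega> (\<lambda>z. \<mu> z * g z)) \<le> B * neg_sobolev_norm k \<Omega> \<mu>"
      unfolding proj .
  qed
qed

end
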